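(* Let $\lambda\in\mathbb{R}^n$ be strictly decreasing, and let $L(t)$, $t\in\mathbb{R}$, denote the Toda flow $\dot L=[L,\pi_{\mathfrak u}(-\mathrm{i}L)]$ on $\mathcal{O}_\lambda$ beginning at a point $L(0)\in\mathcal{O}_\lambda^{\ge0}$. Then $\vartheta_\lambda(L(t))$ (which is defined for all $t\in\mathbb{R}$) is a gradient flow on $\mathcal{O}_\lambda$ of the function $M\mapsto\kappa(M,N)$ in the Kähler metric, where $N=-\mathrm{i}\,\mathrm{Diag}(\lambda)$, i.e. $\mathrm{i}N$ is the diagonal matrix with diagonal entries $\lambda_1,\dots,\lambda_n$.
   Context: Here $\mathrm{i}=\sqrt{-1}$; $\mathrm{U}_n$ is the unitary group and $\mathfrak{u}_n$ the Lie algebra of skew-Hermitian $n\times n$ matrices. $\pi_{\mathfrak u}:\mathfrak{gl}_n(\mathbb{C})\to\mathfrak{u}_n$ is the $\mathbb{R}$-linear projection onto the first summand of $\mathfrak{gl}_n(\mathbb{C})=\mathfrak{u}_n\oplus\{\text{real diagonal matrices}\}\oplus\{\text{strictly upper-triangular complex matrices}\}$. $\mathcal{O}_\lambda=\{g(\mathrm{i}\,\mathrm{Diag}(\lambda))g^{-1}:g\in\mathrm{U}_n\}$. $\mathrm{U}_n^{\ge 0}$ is the set of $g\in\mathrm{U}_n$ all of whose left-justified minors (row set $I$, column set $\{1,\dots,|I|\}$) are nonnegative real numbers, and $\mathcal{O}_\lambda^{\ge 0}=\{g(\mathrm{i}\,\mathrm{Diag}(\lambda))g^{-1}:g\in\mathrm{U}_n^{\ge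 0}\}$. For strictly decreasing $\lambda$ each element of $\mathcal{O}_\lambda^{\ge 0}$ equals $g(\mathrm{i}\,\mathrm{Diag}(\lambda))g^{-1}$ for a unique $g\in\mathrm{U}_n^{\ge0}$, and the twist map $\vartheta_\lambda:\mathcal{O}_\lambda^{\ge0}\to\mathcal{O}_\lambda^{\ge0}$ is $g(\mathrm{i}\,\mathrm{Diag}(\lambda))g^{-1}\mapsto\delta_ng^{-1}(\mathrm{i}\,\mathrm{Diag}(\lambda))g\delta_n$ for $g\in\mathrm{U}_n^{\ge0}$, with $\delta_n=\mathrm{Diag}(1,-1,1,\dots,(-1)^{n-1})$. Let $\kappa(L,M)=2n\,\mathrm{tr}(LM)-2\,\mathrm{tr}(L)\mathrm{tr}(M)$ and $\mathrm{ad}_L(X)=[L,X]=LX-XL$. The tangent space of $\mathcal{O}_\lambda$ at $L$ is $\{[L,X]:X\in\mathfrak{u}_n\}$. For $X\in\mathfrak{u}_n$ write $X=X^L+X_L$ with $X^L\in\mathrm{im}(\mathrm{ad}_L)$, $X_L\in\ker(\mathrm{ad}_L)$ (uniquely). The normal metric is $\langle[L,X],[L,Y]\rangle_{\mathrm{normal}}=-\kappa(X^L,Y^L)$, and the Kähler metric is $\langle[L,X],[L,Y]\rangle_{\mathrm{K\ddot ahler}}=\langle\sqrt{-\mathrm{ad}_L^2}\,([L,X]),[L,Y]\rangle_{\mathrm{normal}}$, with $\sqrt{-\mathrm{ad}_L^2}$ the positive square root of the positive semidefinite operator $-\mathrm{ad}_L^2$. The gradient flow of $H$ is the solution of $\dot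 L(t)=\mathrm{grad}(H)(L(t))$ (steepest ascent). *)

theory Defs
  imports "HOL-Analysis.Analysis"
begin

text \<open>
  Matrices are elements of \<^typ>\<open>complex^'n^'n\<close>, where the index type \<open>'n\<close> is finite and linearly
  ordered and plays the role of \<open>1 < \<dots> < n\<close>, with \<open>n = CARD('n)\<close>.
\<close>

type_synonym 'n cmat = "complex^'n^'n"

definition cscale :: "complex \<Rightarrow> 'n::finite cmat \<Rightarrow> 'n cmat"  (infixr \<open>\<odot>\<close> 75) where
  "c \<odot> A = (\<chi> i j. c * A $ i $ j)"

definition Diag :: "real^'n \<Rightarrow> 'n cmat" where
  "Diag v = (\<chi> i j. if i = j then complex_of_real (v $ i) else 0)"

definition cadjoint :: "'n::finite cmat \<Rightarrow> 'n cmat" where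
  "cadjoint A = (\<chi> i j. cnj (A $ j $ i))"

definition unitary_group :: "('n::finite cmat) set" where
  "unitary_group = {g. g ** cadjoint g = mat 1 \<and> cadjoint g ** g = mat 1}"

definition skew_hermitian :: "('n::finite cmat) set" where
  "skew_hermitian = {X. cadjoint X = - X}"

definition strictly_upper :: "('n::{finite,linorder} cmat) set" where
  "strictly_upper = {R. \<forall>i j. j \<le> i \<longrightarrow> R $ i $ j = 0}"

definition proj_u :: "'n::{finite,linorder} cmat \<Rightarrow> 'n cmat" where
  "proj_u A = (THE X. X \<in> skew_hermitian \<and>
     (\<exists>D \<in> range Diag. \<exists>R \<in> strictly_upper. A = X + D + R))"

lemma proj_u_decomp_iff:
  fixes A :: "'n::{finite,linorder} cmat"
  shows "(X \<in> skew_hermitian \<and> (\<exists>D \<in> range Diag. \<exists>R \<in> strictly_upper. A = X + D + R)) \<longleftrightarrow>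
    X = (\<chi> i j. if j < i then A $ i $ j else if i < j then - cnj (A $ j $ i)
           else \<i> * complex_of_real (Im (A $ i $ i)))"  (is "?P X \<longleftrightarrow> X = ?F")
proof
  assume "?P X"
  then obtain v R where "X \<in> skew_hermitian" "R \<in> strictly_upper" and A: "A = X + Diag v + R"
    by blast
  then have X: "\<And>i j. cnj (X $ j $ i) = - (X $ i $ j)" and R: "\<And>i j. j \<le> i \<Longrightarrow> R $ i $ j = 0"
    by (simp_all add: skew_hermitian_def cadjoint_def strictly_upper_def vec_eq_iff)
  have low: "A $ i $ j = X $ i $ j" if "j < i" for i j
    using that R[of j i] by (simp add: A Diag_def)
  have up: "X $ i $ j = - cnj (X $ j $ i)" for i j
    using X[of j i] by simp
  have dg: "X $ i $ i = \<i> * complex_of_real (Im (A $ i $ i))" for i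
    using X[of i i] R[of i i] by (simp add: A Diag_def complex_eq_iff)
  show "X = ?F"
    unfolding vec_eq_iff
  proof (intro allI)
    fix i j :: 'n
    consider "j < i" | "i < j" | "i = j" by fastforce
    then show "X $ i $ j = ?F $ i $ j"
    proof cases
      case 1
      then show ?thesis using low[of j i] by simp
    next
      case 2
      then show ?thesis using low[of i j] up[of i j] less_not_sym[of i j] by simp
    next
      case 3
      then show ?thesis using dg[of i] by simp
    qed
  qed
next
  assume F: "X = ?F"
  define v :: "real^'n::{finite,linorder}" where "v = (\<chi> i. Re (A $ i $ i))"
  define R where "R = A - X - Diag v"
  have "X \<in> skew_hermitian"
    by (auto simp: F skew_hermitian_def cadjoint_def vec_eq_iff)
  moreover have "R $ i $ j = 0" if "j \<le> i" for i j
    using that by (auto simp: R_def v_def F Diag_def complex_eq_iff)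
  then have "R \<in> strictly_upper"
    by (simp add: strictly_upper_def)
  moreover have "A = X + Diag v + R"
    by (simp add: R_def)
  ultimately show "?P X" by blast
qed

definition ad :: "'n::finite cmat \<Rightarrow> 'n cmat \<Rightarrow> 'n cmat" where
  "ad L X = L ** X - X ** L"

definition kappa :: "'n::finite cmat \<Rightarrow> 'n cmat \<Rightarrow> complex" where
  "kappa L M = 2 * of_nat CARD('n) * trace (L ** M) - 2 * trace L * trace M"

lemma kappa_real:
  fixes X Y :: "'n::finite cmat"
  assumes "X \<in> skew_hermitian" "Y \<in> skew_hermitian"
  shows "kappa X Y \<in> \<real>"
proof -
  have X: "cnj (X $ i $ j) = - (X $ j $ i)" and Y: "cnj (Y $ i $ j) = - (Y $ j $ i)" for i j
    using assms by (auto simp: skew_hermitian_def cadjoint_def vec_eq_iff)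
  have "cnj (trace (X ** Y)) = (\<Sum>i\<in>UNIV. \<Sum>k\<in>UNIV. X $ k $ i * Y $ i $ k)"
    by (simp add: trace_def matrix_matrix_mult_def X Y)
  also have "\<dots> = trace (X ** Y)"
    unfolding trace_def matrix_matrix_mult_def by (subst sum.swap) simp
  finally have 1: "cnj (trace (X ** Y)) = trace (X ** Y)" .
  have 2: "cnj (trace X) = - trace X" "cnj (trace Y) = - trace Y"
    by (simp_all add: trace_def X Y sum_negf)
  have "cnj (kappa X Y) = kappa X Y"
    by (simp add: kappa_def 1 2)
  then show ?thesis by (simp add: Reals_cnj_iff)
qed

text \<open>The 0-based position of an index.\<close>

definition index_pos :: "'n::{finite,linorder} \<Rightarrow> nat" where
  "index_pos i = card {j. j < i}"

text \<open>
  The determinant (Leibniz formula) of the submatrix on the rows \<open>I\<close> and columns \<open>J\<close>, both listed in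
  increasing order; it is meant for \<open>card I = card J\<close>.
\<close>

definition minor :: "'n::{finite,linorder} cmat \<Rightarrow> 'n set \<Rightarrow> 'n set \<Rightarrow> complex" where
  "minor A I J = (\<Sum>p | p permutes {..<card I}. of_int (sign p) *
     (\<Prod>k<card I. A $ (sorted_list_of_set I ! k) $ (sorted_list_of_set J ! p k)))"

definition unitary_nonneg :: "('n::{finite,linorder} cmat) set" where
  "unitary_nonneg =
     {g \<in> unitary_group. \<forall>I. minor g I {j. index_pos j < card I} \<in> \<real>\<^sub>\<ge>\<^sub>0}"

definition orbit :: "real^'n \<Rightarrow> ('n cmat) set" where
  "orbit lam = {g ** (\<i> \<odot> Diag lam) ** matrix_inv g | g. g \<in> unitary_group}"

definition orbit_nonneg :: "real^'n::{finite,linorder} \<Rightarrow> ('n cmat) set" where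
  "orbit_nonneg lam = {g ** (\<i> \<odot> Diag lam) ** matrix_inv g | g. g \<in> unitary_nonneg}"

definition delta :: "'n::{finite,linorder} cmat" where
  "delta = Diag (\<chi> i. (-1) ^ index_pos i)"

text \<open>
  The definite description is proper when the entries of \<open>lam\<close> strictly decrease and
  \<open>M \<in> orbit_nonneg lam\<close>; the value is irrelevant elsewhere.
\<close>

definition twist :: "real^'n::{finite,linorder} \<Rightarrow> 'n cmat \<Rightarrow> 'n cmat" where
  "twist lam M = (let g = (THE g. g \<in> unitary_nonneg \<and> M = g ** (\<i> \<odot> Diag lam) ** matrix_inv g)
     in delta ** matrix_inv g ** (\<i> \<odot> Diag lam) ** g ** delta)"

definition tangent_space :: "'n::finite cmat \<Rightarrow> ('n cmat) set" where
  "tangent_space L = {ad L X | X. X \<in> skew_hermitian}"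

text \<open>The component \<open>X\<^sup>L\<close> of \<open>X = X\<^sup>L + X\<^sub>L\<close>, for \<open>ad L\<close> as an operator on the skew-Hermitian matrices.\<close>

definition im_part :: "'n::finite cmat \<Rightarrow> 'n cmat \<Rightarrow> 'n cmat" where
  "im_part L X = (THE Y. Y \<in> ad L ` skew_hermitian \<and>
     X - Y \<in> {Z \<in> skew_hermitian. ad L Z = 0})"

text \<open>
  The metrics at \<open>L\<close> are functions of two tangent vectors \<open>V = ad L X\<close> and \<open>W = ad L Y\<close>. Taking the
  real part only changes the type, by \<open>kappa_real\<close>.
\<close>

definition normal_metric :: "'n::finite cmat \<Rightarrow> 'n cmat \<Rightarrow> 'n cmat \<Rightarrow> real" where
  "normal_metric L V W = (THE r. \<exists>X \<in> skew_hermitian. \<exists>Y \<in> skew_hermitian.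
     V = ad L X \<and> W = ad L Y \<and> r = - Re (kappa (im_part L X) (im_part L Y)))"

definition pos_sqrt :: "('a::real_inner \<Rightarrow> 'a) \<Rightarrow> 'a \<Rightarrow> 'a" where
  "pos_sqrt T = (THE S. linear S \<and> (\<forall>x y. S x \<bullet> y = x \<bullet> S y) \<and> (\<forall>x. 0 \<le> S x \<bullet> x) \<and> S \<circ> S = T)"

text \<open>
  The square root is taken on all complex matrices with the inner product \<open>X \<bullet> Y = Re (tr (X\<^sup>* Y))\<close>,
  for which \<open>ad L\<close> is skew-adjoint when \<open>L\<close> is skew-Hermitian. It preserves the tangent space; on
  trace-zero skew-Hermitian matrices, hence on the tangent space, \<open>X \<bullet> Y\<close> is \<open>- kappa X Y / (2 * n)\<close>.
\<close>

definition kaehler_metric :: "'n::finite cmat \<Rightarrow> 'n cmat \<Rightarrow> 'n cmat \<Rightarrow> real" where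
  "kaehler_metric L V W = normal_metric L (pos_sqrt (\<lambda>X. - ad L (ad L X)) V) W"

text \<open>
  \<open>V\<close> is the gradient at \<open>L\<close> of the restriction of \<open>H\<close> to \<open>orbit lam\<close>. The derivative is taken within
  the orbit, so only the values of \<open>H\<close> there matter; on tangent vectors it is unique.
\<close>

definition has_kaehler_gradient ::
    "real^'n \<Rightarrow> ('n cmat \<Rightarrow> real) \<Rightarrow> 'n cmat \<Rightarrow> 'n cmat \<Rightarrow> bool" where
  "has_kaehler_gradient lam H V L \<longleftrightarrow> V \<in> tangent_space L \<and>
     (\<exists>dH. (H has_derivative dH) (at L within orbit lam) \<and>
        (\<forall>W \<in> tangent_space L. kaehler_metric L V W = dH W))"

definition kaehler_gradient_flow ::
    "real^'n \<Rightarrow> ('n cmat \<Rightarrow> real) \<Rightarrow> (real \<Rightarrow> 'n cmat) \<Rightarrow> bool" where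
  "kaehler_gradient_flow lam H \<gamma> \<longleftrightarrow> (\<forall>t. \<gamma> t \<in> orbit lam \<and>
     (\<exists>V. has_kaehler_gradient lam H V (\<gamma> t) \<and> (\<gamma> has_vector_derivative V) (at t)))"

definition toda_flow :: "real^'n::{finite,linorder} \<Rightarrow> (real \<Rightarrow> 'n cmat) \<Rightarrow> bool" where
  "toda_flow lam L \<longleftrightarrow> (\<forall>t. L t \<in> orbit lam \<and>
     (L has_vector_derivative ad (L t) (proj_u ((-\<i>) \<odot> L t))) (at t))"

end

theory Submission
  imports Defs "Jordan_Normal_Form.Determinant"
begin

text \<open>
  Let \<open>\<Lambda> = Diag \<lambda>\<close>, \<open>L(0) = g\<^sub>0 (\<i> \<Lambda>) g\<^sub>0\<^sup>*\<close> with \<open>g\<^sub>0\<close> in \<open>U\<^sup>\<ge>\<^sup>0\<close>, and \<open>h\<^sub>0 = \<delta> g\<^sub>0\<^sup>* \<delta>\<close>. Let \<open>h(t)\<close> be the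
  unitary factor in the QR factorisation of \<open>e\<^sup>t\<^sup>\<Lambda> h\<^sub>0\<close>. Passing from \<open>h\<^sub>0\<close> to \<open>h(t)\<close> multiplies every
  left-justified minor by a positive number, so \<open>h(t)\<close> is in \<open>U\<^sup>\<ge>\<^sup>0\<close> if \<open>h\<^sub>0\<close> is. Moreover
  \<open>h' = h \<pi>\<^sub>u(C)\<close> with \<open>C = h\<^sup>* \<Lambda> h\<close>. Hence \<open>g (\<i> \<Lambda>) g\<^sup>*\<close> with \<open>g = \<delta> h\<^sup>* \<delta>\<close> solves the Toda equation, is
  equal to \<open>L\<close> by uniqueness, and has the twist \<open>h (\<i> \<Lambda>) h\<^sup>*\<close>. Conjugated by \<open>h\<close>, both the velocity of
  \<open>h (\<i> \<Lambda>) h\<^sup>*\<close> and the Kaehler gradient have the entries \<open>\<i> \<bar>\<lambda>\<^sub>i - \<lambda>\<^sub>j\<bar> C\<^sub>i\<^sub>j\<close>.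

  The remaining point is that \<open>g \<mapsto> \<delta> g\<^sup>* \<delta>\<close> preserves \<open>U\<^sup>\<ge>\<^sup>0\<close>. By Jacobi's identity for complementary
  minors, this means that the bottom-justified minors of \<open>g\<close> are nonnegative. After a perturbation by
  a totally positive kernel, the left-justified minors of \<open>g\<close> are positive. Then \<open>g = l u\<^sup>-\<^sup>1\<close> with
  \<open>l\<close> unit lower triangular and \<open>u\<close> upper triangular. By Fekete's criterion \<open>l\<close> is totally nonnegative,
  hence so is \<open>u\<^sup>* = l\<^sup>* g\<close>, which has the same bottom-justified minors as \<open>g\<close>.
\<close>

text \<open>An element of \<open>unitary_nonneg\<close> may have vanishing left-justified minors.
  Its triangular factorisation may then fail to exist, and Fekete's criterion needs strict
  inequalities anyway. The kernel repairs this by Cauchy--Binet: its own minors are positive, and an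
  invertible matrix has a nonzero left-justified minor of every order. The product is no longer
  unitary, but its QR factor is, and the left-justified minors keep their signs. That factor is
  given by an explicit determinantal formula, so it is continuous in the parameter and returns
  \<open>g\<close> when the kernel becomes the identity. The same formula gives \<open>h(t)\<close>
  for all times together with its differentiability; for the differential equation only uniqueness
  has to be proved.

  The absolute values have two different origins. In the gradient they are the eigenvalues of the
  square root of the negative square of \<open>ad L\<close>. In the velocity the commutator with the
  diagonal matrix produces signed differences, whose sign is compensated by the sign change of
  \<open>proj_u\<close> above the diagonal, because \<open>lam\<close> decreases.\<close>

section \<open>Determinants of arrays and the Cauchy--Binet formula\<close>

hide_const (open) Matrix.mat Determinant.det
hide_fact (open) Matrix.mat_def Matrix.vec_eq_iff
no_notation vec_index (infixl \<open>$\<close> 100)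
  and scalar_prod (infix \<open>\<bullet>\<close> 70)
  and module.smult (infixl \<open>\<odot>\<index>\<close> 70)

text \<open>The order \<open>k\<close> is a variable and not a type, so inductions over the order
  are possible. Submatrices arise by composing \<open>F\<close> with index maps; entries from
  \<open>k\<close> on do not enter.\<close>

definition fdet :: "nat \<Rightarrow> (nat \<Rightarrow> nat \<Rightarrow> 'a) \<Rightarrow> 'a::comm_ring_1" where
  "fdet k F = (\<Sum>p | p permutes {..<k}. of_int (sign p) * (\<Prod>i<k. F i (p i)))"

lemma fdet_eq_det: "fdet k F = Determinant.det (Matrix.mat k k (\<lambda>(i, j). F i j))"
proof -
  have "(\<Prod>i<k. F i (p i)) = (\<Prod>i = 0..<k. Matrix.mat k k (\<lambda>(i, j). F i j) $$ (i, p i))"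
    if "p permutes {..<k}" for p
    using permutes_in_image[OF that]
    by (intro prod.cong) (auto simp: atLeast0LessThan)
  then show ?thesis
    by (subst det_def'[of _ k]) (auto simp: fdet_def atLeast0LessThan intro!: sum.cong)
qed

lemma fdet_cong:
  assumes "\<And>i j. i < k \<Longrightarrow> j < k \<Longrightarrow> F i j = G i j"
  shows "fdet k F = fdet k G"
  unfolding fdet_eq_det by (rule arg_cong[of _ _ Determinant.det]) (auto intro!: eq_matI simp: assms)

lemma fdet_transpose: "fdet k (\<lambda>i j. F j i) = fdet k F"
proof -
  have "Matrix.mat k k (\<lambda>(i, j). F j i) = transpose_mat (Matrix.mat k k (\<lambda>(i, j). F i j))"
    by (auto intro!: eq_matI)
  then show ?thesis by (simp add: fdet_eq_det det_transpose[of _ k])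
qed

text \<open>\<open>skip i\<close> enumerates the naturals other than \<open>i\<close> in increasing
  order, so composing with it deletes row or column \<open>i\<close>.\<close>

abbreviation skip :: "nat \<Rightarrow> nat \<Rightarrow> nat" where "skip \<equiv> insert_index"

lemma cofactor_mat:
  assumes "i \<le> k" "j \<le> k"
  shows "cofactor (Matrix.mat (Suc k) (Suc k) (\<lambda>(i, j). F i j)) i j
    = (-1) ^ (i + j) * fdet k (\<lambda>a b. F (skip i a) (skip j b))"
proof -
  have "mat_delete (Matrix.mat (Suc k) (Suc k) (\<lambda>(i, j). F i j)) i j
      = Matrix.mat k k (\<lambda>(a, b). F (skip i a) (skip j b))"
    using assms by (intro eq_matI) (auto simp: mat_delete_def insert_index_def)
  then show ?thesis by (simp add: cofactor_def fdet_eq_det)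
qed

lemma fdet_expand_row:
  assumes "i \<le> k"
  shows "fdet (Suc k) F = (\<Sum>j\<le>k. (-1) ^ (i + j) * F i j * fdet k (\<lambda>a b. F (skip i a) (skip j b)))"
proof -
  have "fdet (Suc k) F = (\<Sum>j<Suc k. Matrix.mat (Suc k) (Suc k) (\<lambda>(i, j). F i j) $$ (i, j) *
      cofactor (Matrix.mat (Suc k) (Suc k) (\<lambda>(i, j). F i j)) i j)"
    unfolding fdet_eq_det using assms by (intro laplace_expansion_row) auto
  also have "\<dots> = (\<Sum>j<Suc k. F i j * ((-1) ^ (i + j) * fdet k (\<lambda>a b. F (skip i a) (skip j b))))"
    using assms by (intro sum.cong refl) (simp add: cofactor_mat)
  finally show ?thesis by (simp only: lessThan_Suc_atMost ac_simps)
qed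

lemma fdet_expand_col:
  assumes "j \<le> k"
  shows "fdet (Suc k) F = (\<Sum>i\<le>k. (-1) ^ (i + j) * F i j * fdet k (\<lambda>a b. F (skip i a) (skip j b)))"
proof -
  have "fdet (Suc k) F = fdet (Suc k) (\<lambda>i j. F j i)"
    by (rule fdet_transpose[symmetric])
  also have "\<dots> = (\<Sum>i\<le>k. (-1) ^ (j + i) * F i j * fdet k (\<lambda>a b. F (skip i b) (skip j a)))"
    by (rule fdet_expand_row[OF assms])
  also have "\<dots> = (\<Sum>i\<le>k. (-1) ^ (i + j) * F i j * fdet k (\<lambda>a b. F (skip i a) (skip j b)))"
  proof (rule sum.cong[OF refl])
    fix i
    show "(-1) ^ (j + i) * F i j * fdet k (\<lambda>a b. F (skip i b) (skip j a))
        = (-1) ^ (i + j) * F i j * fdet k (\<lambda>a b. F (skip i a) (skip j b))"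
      unfolding fdet_transpose[of k "\<lambda>a b. F (skip i a) (skip j b)"] add.commute[of j i] ..
  qed
  finally show ?thesis .
qed

lemma fdet_0 [simp]: "fdet 0 F = 1"
  by (simp add: fdet_def sign_id)

lemma fdet_Suc_0 [simp]: "fdet (Suc 0) F = F 0 0"
  by (subst fdet_expand_row[of 0]) auto

lemma fdet_eq_rows_0:
  assumes "i < k" "i' < k" "i \<noteq> i'" "\<And>j. j < k \<Longrightarrow> F i j = F i' j"
  shows "fdet k F = 0"
  unfolding fdet_eq_det
  by (rule det_identical_rows[of _ k i i']) (use assms in \<open>auto intro!: eq_vecI\<close>)

lemma fdet_eq_cols_0:
  assumes "i < k" "i' < k" "i \<noteq> i'" "\<And>j. j < k \<Longrightarrow> F j i = F j i'"
  shows "fdet k F = 0"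
  using fdet_eq_rows_0[of i k i' "\<lambda>i j. F j i"] assms by (simp add: fdet_transpose[of k F])

lemma fdet_permute_rows:
  assumes "p permutes {..<k}"
  shows "fdet k (\<lambda>i j. F (p i) j) = of_int (sign p) * fdet k F"
proof -
  have "Matrix.mat k k (\<lambda>(i, j). Matrix.mat k k (\<lambda>(i, j). F i j) $$ (p i, j)) = Matrix.mat k k (\<lambda>(i, j). F (p i) j)"
    using permutes_in_image[OF assms] by (intro eq_matI) auto
  then show ?thesis
    using det_permute_rows[of "Matrix.mat k k (\<lambda>(i, j). F i j)" k p] assms
    by (simp add: fdet_eq_det atLeast0LessThan)
qed

lemma fdet_scale_rows: "fdet k (\<lambda>i j. c i * F i j) = (\<Prod>i<k. c i) * fdet k F"
  by (simp add: fdet_def prod.distrib sum_distrib_left ac_simps)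

lemma fdet_scale_cols: "fdet k (\<lambda>i j. c j * F i j) = (\<Prod>i<k. c i) * fdet k F"
  using fdet_scale_rows[of k c "\<lambda>i j. F j i"] fdet_transpose[of k "\<lambda>i j. c j * F i j"]
  by (simp add: fdet_transpose[of k F])

lemma fdet_upper:
  assumes "\<And>i j. i < k \<Longrightarrow> j < i \<Longrightarrow> F i j = 0"
  shows "fdet k F = (\<Prod>i<k. F i i)"
proof -
  have "Determinant.det (Matrix.mat k k (\<lambda>(i, j). F i j)) = prod_list (diag_mat (Matrix.mat k k (\<lambda>(i, j). F i j)))"
    by (rule det_upper_triangular[of _ k]) (auto simp: assms)
  then show ?thesis by (simp add: fdet_eq_det prod_list_diag_prod atLeast0LessThan)
qed

lemma fdet_lower:
  assumes "\<And>i j. j < k \<Longrightarrow> i < j \<Longrightarrow> F i j = 0"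
  shows "fdet k F = (\<Prod>i<k. F i i)"
  using fdet_upper[of k "\<lambda>i j. F j i"] assms by (simp add: fdet_transpose[of k F])

section \<open>Increasing index sequences and the Cauchy--Binet formula\<close>

abbreviation incr :: "nat \<Rightarrow> (nat \<Rightarrow> 'a::linorder) \<Rightarrow> bool" where
  "incr k r \<equiv> strict_mono_on {..<k} r"

lemma sorted_list_nth_bij:
  fixes S :: "'a::linorder set"
  assumes "finite S"
  shows "bij_betw ((!) (sorted_list_of_set S)) {..<card S} S"
  using bij_betw_nth[of "sorted_list_of_set S" "{..<card S}" S] assms by simp

lemma incr_sorted_list_nth:
  fixes S :: "'a::linorder set"
  shows "incr (card S) ((!) (sorted_list_of_set S))"
  by (rule strict_mono_onI)
    (metis lessThan_iff length_sorted_list_of_set strict_sorted_list_of_set sorted_wrt_nth_less)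

lemma sorted_list_of_incr_image:
  fixes r :: "nat \<Rightarrow> 'a::linorder"
  assumes "incr k r"
  shows "sorted_list_of_set (r ` {..<k}) = map r [0..<k]"
proof (rule sorted_distinct_set_unique)
  show "sorted (map r [0..<k])"
    using assms by (auto simp: sorted_iff_nth_mono strict_mono_on_def order_le_less)
  show "distinct (map r [0..<k])"
    using assms by (simp add: distinct_map atLeast0LessThan strict_mono_on_imp_inj_on)
qed (auto simp: atLeast0LessThan)

text \<open>In the expansion behind Cauchy--Binet, the index functions with a common image
  \<open>S\<close> differ by a permutation of the sorted list of \<open>S\<close>. The restriction
  makes them extensional, as the function space requires.\<close>

lemma inj_on_as_sorted_perm:
  fixes f :: "nat \<Rightarrow> 'a::linorder"
  assumes "S \<subseteq> U" "finite U" "card S = k"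
  shows "bij_betw (\<lambda>p. restrict (\<lambda>i. sorted_list_of_set S ! p i) {..<k}) {p. p permutes {..<k}}
    {f \<in> {..<k} \<rightarrow>\<^sub>E U. f ` {..<k} = S}"
proof -
  let ?s = "(!) (sorted_list_of_set S)"
  have s: "bij_betw ?s {..<k} S"
    using sorted_list_nth_bij[of S] assms finite_subset by blast
  define si where "si = inv_into {..<k} ?s"
  have si: "bij_betw si S {..<k}"
    unfolding si_def using s by (rule bij_betw_inv_into)
  have ssi: "?s (si x) = x" if "x \<in> S" for x
    unfolding si_def using s that by (simp add: bij_betw_inv_into_right)
  have sis: "si (?s i) = i" if "i < k" for i
    unfolding si_def using s that by (simp add: bij_betw_inv_into_left)
  show ?thesis
  proof (rule bij_betw_byWitness[where f' = "\<lambda>f i. if i < k then si (f i) else i"])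
    show "\<forall>p\<in>{p. p permutes {..<k}}. (\<lambda>i. if i < k then si (restrict (\<lambda>i. ?s (p i)) {..<k} i) else i) = p"
    proof (intro ballI ext)
      fix p i assume p: "p \<in> {p. p permutes {..<k}}"
      then show "(if i < k then si (restrict (\<lambda>i. ?s (p i)) {..<k} i) else i) = p i"
        using permutes_in_image[of p "{..<k}" i] permutes_not_in[of p "{..<k}" i] by (auto simp: sis)
    qed
    show "\<forall>f\<in>{f \<in> {..<k} \<rightarrow>\<^sub>E U. f ` {..<k} = S}. restrict (\<lambda>i. ?s (if i < k then si (f i) else i)) {..<k} = f"
    proof (intro ballI ext)
      fix f i assume f: "f \<in> {f \<in> {..<k} \<rightarrow>\<^sub>E U. f ` {..<k} = S}"
      show "restrict (\<lambda>i. ?s (if i < k then si (f i) else i)) {..<k} i = f i"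
      proof (cases "i < k")
        case True
        then have "f i \<in> S" using f by auto
        then show ?thesis using ssi True by simp
      next
        case False
        then show ?thesis using f PiE_arb[of f "{..<k}" "\<lambda>_. U" i] by simp
      qed
    qed
    show "(\<lambda>p. restrict (\<lambda>i. ?s (p i)) {..<k}) ` {p. p permutes {..<k}} \<subseteq> {f \<in> {..<k} \<rightarrow>\<^sub>E U. f ` {..<k} = S}"
    proof clarify
      fix p assume p: "p permutes {..<k}"
      have "(\<lambda>i. ?s (p i)) ` {..<k} = ?s ` p ` {..<k}" by auto
      also have "\<dots> = S" using permutes_image[OF p] s by (simp add: bij_betw_def)
      finally show "restrict (\<lambda>i. ?s (p i)) {..<k} \<in> {..<k} \<rightarrow>\<^sub>E U \<and> restrict (\<lambda>i. ?s (p i)) {..<k} ` {..<k} = S"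
        using assms(1) by auto
    qed
    show "(\<lambda>f i. if i < k then si (f i) else i) ` {f \<in> {..<k} \<rightarrow>\<^sub>E U. f ` {..<k} = S} \<subseteq> {p. p permutes {..<k}}"
    proof (rule image_subsetI, rule CollectI)
      fix f assume "f \<in> {f \<in> {..<k} \<rightarrow>\<^sub>E U. f ` {..<k} = S}"
      then have f: "f ` {..<k} = S" by simp
      have "inj_on f {..<k}" using f assms by (intro eq_card_imp_inj_on) auto
      then have "bij_betw f {..<k} S" using f by (simp add: bij_betw_def)
      then have "bij_betw (si \<circ> f) {..<k} {..<k}" using si by (rule bij_betw_trans)
      then have "bij_betw (\<lambda>i. if i < k then si (f i) else i) {..<k} {..<k}"
        by (subst bij_betw_cong[of _ _ "si \<circ> f"]) auto
      then show "(\<lambda>i. if i < k then si (f i) else i) permutes {..<k}"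
        by (rule bij_imp_permutes) auto
    qed
  qed
qed

text \<open>Expanding the product of sums gives one term for each function \<open>f\<close> choosing
  a summation index in every row. A function that is not injective repeats a row of \<open>B\<close>
  and contributes nothing. The others are grouped by their image \<open>S\<close>; inside a group,
  sorting the rows of \<open>B\<close> produces the signs of the determinant of
  \<open>A\<close>.\<close>

theorem Cauchy_Binet:
  fixes U :: "'b::linorder set" and A :: "nat \<Rightarrow> 'b \<Rightarrow> 'a::comm_ring_1"
  assumes "finite U"
  shows "fdet k (\<lambda>i j. \<Sum>s\<in>U. A i s * B s j) =
    (\<Sum>S | S \<subseteq> U \<and> card S = k. fdet k (\<lambda>i j. A i (sorted_list_of_set S ! j)) *
       fdet k (\<lambda>i j. B (sorted_list_of_set S ! i) j))"
proof -
  let ?P = "{p. p permutes {..<k}}" and ?F = "{..<k} \<rightarrow>\<^sub>E U"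
  let ?t = "\<lambda>f. (\<Prod>i<k. A i (f i)) * fdet k (\<lambda>i j. B (f i) j)"
  have finF: "finite ?F" using assms by (intro finite_PiE) auto
  have "fdet k (\<lambda>i j. \<Sum>s\<in>U. A i s * B s j)
      = (\<Sum>p\<in>?P. \<Sum>f\<in>?F. of_int (sign p) * (\<Prod>i<k. A i (f i) * B (f i) (p i)))"
    using assms by (simp add: fdet_def prod_sum_PiE sum_distrib_left)
  also have "\<dots> = (\<Sum>f\<in>?F. ?t f)"
    by (subst sum.swap) (simp add: fdet_def prod.distrib sum_distrib_left ac_simps)
  also have "\<dots> = (\<Sum>f | f \<in> ?F \<and> inj_on f {..<k}. ?t f)"
  proof (rule sum.mono_neutral_right[OF finF])
    show "\<forall>f\<in>?F - {f. f \<in> ?F \<and> inj_on f {..<k}}. ?t f = 0"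
    proof
      fix f assume "f \<in> ?F - {f. f \<in> ?F \<and> inj_on f {..<k}}"
      then obtain i j where "i < k" "j < k" "i \<noteq> j" "f i = f j"
        by (auto simp: inj_on_def)
      then have "fdet k (\<lambda>i j. B (f i) j) = 0"
        by (intro fdet_eq_rows_0[of i k j]) auto
      then show "?t f = 0" by simp
    qed
  qed auto
  also have "\<dots> = (\<Sum>S | S \<subseteq> U \<and> card S = k. \<Sum>f | f \<in> {f. f \<in> ?F \<and> inj_on f {..<k}} \<and> f ` {..<k} = S. ?t f)"
  proof (rule sum.group[symmetric])
    show "finite {f. f \<in> ?F \<and> inj_on f {..<k}}"
      by (rule finite_subset[OF _ finF]) auto
    show "finite {S. S \<subseteq> U \<and> card S = k}"
      by (rule finite_subset[of _ "Pow U"]) (use assms in auto)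
    show "(\<lambda>f. f ` {..<k}) ` {f. f \<in> ?F \<and> inj_on f {..<k}} \<subseteq> {S. S \<subseteq> U \<and> card S = k}"
    proof (rule image_subsetI)
      fix f assume "f \<in> {f. f \<in> ?F \<and> inj_on f {..<k}}"
      then have "f \<in> ?F" "inj_on f {..<k}" by simp_all
      then show "f ` {..<k} \<in> {S. S \<subseteq> U \<and> card S = k}"
        using card_image[of f "{..<k}"] by (simp add: image_subset_iff PiE_iff)
    qed
  qed
  also have "\<dots> = (\<Sum>S | S \<subseteq> U \<and> card S = k. fdet k (\<lambda>i j. A i (sorted_list_of_set S ! j)) *
       fdet k (\<lambda>i j. B (sorted_list_of_set S ! i) j))"
  proof (rule sum.cong[OF refl], clarify)
    fix S assume S: "S \<subseteq> U" "k = card S"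
    let ?s = "\<lambda>i. sorted_list_of_set S ! i"
    have "{f. f \<in> {f. f \<in> ?F \<and> inj_on f {..<k}} \<and> f ` {..<k} = S} = {f \<in> ?F. f ` {..<k} = S}"
      using S by (auto intro!: eq_card_imp_inj_on)
    then have "(\<Sum>f | f \<in> {f. f \<in> ?F \<and> inj_on f {..<k}} \<and> f ` {..<k} = S. ?t f)
        = (\<Sum>p\<in>?P. ?t (restrict (\<lambda>i. ?s (p i)) {..<k}))"
      using sum.reindex_bij_betw[OF inj_on_as_sorted_perm[of S U k], of ?t] S assms by simp
    also have "\<dots> = (\<Sum>p\<in>?P. (\<Prod>i<k. A i (?s (p i))) * (of_int (sign p) * fdet k (\<lambda>i j. B (?s i) j)))"
    proof (intro sum.cong refl arg_cong2[of _ _ _ _ "(*)"])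
      fix p assume p: "p \<in> ?P"
      show "fdet k (\<lambda>i. B (restrict (\<lambda>i. ?s (p i)) {..<k} i)) = of_int (sign p) * fdet k (\<lambda>i. B (?s i))"
        using fdet_permute_rows[of p k "\<lambda>i. B (?s i)"] p
        by (subst fdet_cong[of k _ "\<lambda>i. B (?s (p i))"]) auto
    qed auto
    also have "\<dots> = fdet k (\<lambda>i j. A i (?s j)) * fdet k (\<lambda>i j. B (?s i) j)"
      by (simp add: fdet_def[of k "\<lambda>i j. A i (?s j)"] sum_distrib_left ac_simps)
    finally show "(\<Sum>f | f \<in> {f. f \<in> {..<card S} \<rightarrow>\<^sub>E U \<and> inj_on f {..<card S}} \<and> f ` {..<card S} = S.
        (\<Prod>i<card S. A i (f i)) * fdet (card S) (\<lambda>i j. B (f i) j)) =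
      fdet (card S) (\<lambda>i j. A i (?s j)) * fdet (card S) (\<lambda>i j. B (?s i) j)"
      unfolding S(2) .
  qed
  finally show ?thesis .
qed

lemma fdet_mult: "fdet k (\<lambda>i j. \<Sum>s<k. A i s * B s j) = fdet k A * fdet k B"
proof -
  have "{S. S \<subseteq> {..<k} \<and> card S = k} = {{..<k}}"
    using card_subset_eq[of "{..<k}"] by auto
  moreover have "sorted_list_of_set {..<k} = [0..<k]"
    by (simp add: lessThan_atLeast0)
  ultimately show ?thesis
    by (simp add: Cauchy_Binet fdet_cong[of k "\<lambda>i j. A i ([0..<k] ! j)" A] fdet_cong[of k "\<lambda>i j. B ([0..<k] ! i) j" B])
qed

section \<open>Total positivity\<close>

text \<open>Being real is part of the notion: that a complex minor is real is only ever obtained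
  together with its sign.\<close>

definition cpos :: "complex \<Rightarrow> bool" where
  "cpos z \<longleftrightarrow> z \<in> \<real>\<^sub>\<ge>\<^sub>0 \<and> z \<noteq> 0"

lemma cposD: "cpos z \<Longrightarrow> z \<in> \<real>\<^sub>\<ge>\<^sub>0" "cpos z \<Longrightarrow> z \<noteq> 0"
  by (simp_all add: cpos_def)

lemma cpos_iff: "cpos z \<longleftrightarrow> 0 < Re z \<and> Im z = 0"
  by (auto simp: cpos_def complex_nonneg_Reals_iff complex_eq_iff)

lemma cpos_of_real [simp]: "cpos (of_real x) \<longleftrightarrow> 0 < x"
  by (simp add: cpos_iff)

lemma cpos_1 [simp]: "cpos 1"
  by (simp add: cpos_iff)

lemma cpos_mult: "cpos z \<Longrightarrow> cpos w \<Longrightarrow> cpos (z * w)"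
  by (simp add: cpos_def)

lemma cpos_divide: "cpos z \<Longrightarrow> cpos w \<Longrightarrow> cpos (z / w)"
  by (simp add: cpos_def)

lemma cpos_add: "cpos z \<Longrightarrow> cpos w \<Longrightarrow> cpos (z + w)"
  by (simp add: cpos_iff)

lemma cpos_prod: "(\<And>i. i \<in> A \<Longrightarrow> cpos (f i)) \<Longrightarrow> cpos (prod f A)"
  by (induction A rule: infinite_finite_induct) (auto intro: cpos_mult)

lemma cpos_cancel: "cpos z \<Longrightarrow> cpos (z * w) \<Longrightarrow> cpos w"
  using cpos_divide[of "z * w" z] by (auto simp: cpos_def)

lemma nonneg_Reals_sum: "(\<And>i. i \<in> A \<Longrightarrow> f i \<in> \<real>\<^sub>\<ge>\<^sub>0) \<Longrightarrow> sum f A \<in> (\<real>\<^sub>\<ge>\<^sub>0 :: complex set)"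
  by (induction A rule: infinite_finite_induct) auto

lemma nonneg_Reals_prod: "(\<And>i. i \<in> A \<Longrightarrow> f i \<in> \<real>\<^sub>\<ge>\<^sub>0) \<Longrightarrow> prod f A \<in> (\<real>\<^sub>\<ge>\<^sub>0 :: complex set)"
  by (induction A rule: infinite_finite_induct) auto

lemma cpos_sum:
  assumes "finite A" "a \<in> A" "cpos (f a)" "\<And>i. i \<in> A \<Longrightarrow> f i \<in> \<real>\<^sub>\<ge>\<^sub>0"
  shows "cpos (sum f A)"
proof -
  have "sum f (A - {a}) \<in> \<real>\<^sub>\<ge>\<^sub>0" using assms by (intro nonneg_Reals_sum) auto
  then show ?thesis
    using assms(3) by (auto simp: sum.remove[OF assms(1,2)] cpos_iff complex_nonneg_Reals_iff)
qed

lemma tendsto_fdet: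
  fixes F :: "'x \<Rightarrow> nat \<Rightarrow> nat \<Rightarrow> complex"
  assumes "\<And>i j. i < k \<Longrightarrow> j < k \<Longrightarrow> ((\<lambda>x. F x i j) \<longlongrightarrow> G i j) net"
  shows "((\<lambda>x. fdet k (F x)) \<longlongrightarrow> fdet k G) net"
  unfolding fdet_def
proof (intro tendsto_sum tendsto_mult tendsto_const tendsto_prod)
  fix p i assume "p \<in> {p. p permutes {..<k}}" "i \<in> {..<k}"
  then show "((\<lambda>x. F x i (p i)) \<longlongrightarrow> G i (p i)) net"
    using permutes_in_image[of p "{..<k}" i] by (intro assms) auto
qed

lemma fdet_of_real: "fdet k (\<lambda>i j. complex_of_real (F i j)) = of_real (fdet k F)"
  by (simp add: fdet_def)

text \<open>
  Expanding determinants with a repeated row shows that \<open>(-1) ^ r * E r\<close> is in the kernel of \<open>X\<close>;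
  expanding determinants with a repeated column gives a combination \<open>H\<close> of the rows of \<open>X\<close> that
  vanishes on all columns other than \<open>0\<close>, \<open>m\<close> and \<open>Suc p\<close>.
\<close>

lemma three_term_Pluecker:
  fixes X :: "nat \<Rightarrow> nat \<Rightarrow> 'a::comm_ring_1"
  assumes "0 < m" "m \<le> p"
  defines "E \<equiv> \<lambda>r. fdet (Suc p) (\<lambda>a b. X a (skip r b))"
  shows "fdet p (\<lambda>a b. X a (Suc b)) * E m =
    fdet p (\<lambda>a b. X a (skip m b)) * E 0 + fdet p (\<lambda>a b. X a (Suc (skip (m - 1) b))) * E (Suc p)"
proof -
  obtain q where p: "p = Suc q" using assms by (cases p) auto
  define G where "G = (\<lambda>i. fdet q (\<lambda>a b. X (skip i a) (Suc (skip (m - 1) b))))"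
  define H where "H = (\<lambda>r. \<Sum>i\<le>q. (-1) ^ i * X i r * G i)"
  have R: "(\<Sum>r\<le>Suc p. (-1) ^ r * X i r * E r) = 0" if "i \<le> p" for i
  proof -
    have "0 = fdet (Suc (Suc p)) (\<lambda>a b. if a = 0 then X i b else X (a - 1) b)"
      by (rule fdet_eq_rows_0[symmetric, of 0 _ "Suc i"]) (use that in auto)
    also have "\<dots> = (\<Sum>r\<le>Suc p. (-1) ^ r * X i r * E r)"
      by (subst fdet_expand_row[of 0]) (simp_all add: E_def)
    finally show ?thesis by simp
  qed
  have H: "H r = fdet p (\<lambda>a b. if b = 0 then X a r else X a (Suc (skip (m - 1) (b - 1))))" for r
    unfolding p by (subst fdet_expand_col[of 0]) (simp_all add: H_def G_def)
  have H0: "H r = 0" if "0 < r" "r \<le> p" "r \<noteq> m" for r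
  proof -
    \<comment> \<open>The columns \<open>Suc (skip (m - 1) b)\<close> with \<open>b < q\<close> are
      \<open>1, ..., p\<close> without \<open>m\<close>, so column \<open>r\<close> occurs twice in
      the determinant \<open>H r\<close>.\<close>
    have "\<exists>b<q. r = Suc (skip (m - 1) b)"
    proof (cases "r < m")
      case True
      then show ?thesis using that assms
        by (intro exI[of _ "r - 1"]) (auto simp: p insert_index_def)
    next
      case False
      then show ?thesis using that assms
        by (intro exI[of _ "r - 2"]) (auto simp: p insert_index_def)
    qed
    then obtain b where "b < q" "r = Suc (skip (m - 1) b)" by blast
    then show ?thesis unfolding H
      by (intro fdet_eq_cols_0[of 0 _ "Suc b"]) (auto simp: p)
  qed
  have F1: "fdet p (\<lambda>a b. X a (skip m b)) = H 0"
    unfolding H using assms by (intro fdet_cong) (auto simp: insert_index_def)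
  \<comment> \<open>\<open>F2\<close> moves column \<open>m\<close> to the front and
    \<open>F3\<close> the last column \<open>Suc p\<close>; this costs \<open>m - 1\<close> and
    \<open>q\<close> transpositions.\<close>
  have F2: "fdet p (\<lambda>a b. X a (Suc b)) = (-1) ^ (m - 1) * H m"
  proof -
    obtain l where l: "m = Suc l" "l \<le> q" using assms p by (cases m) auto
    show ?thesis
      unfolding p H_def G_def l(1) using l(2)
      by (subst fdet_expand_col[of l]) (auto simp: sum_distrib_left power_add ac_simps)
  qed
  have F3: "fdet p (\<lambda>a b. X a (Suc (skip (m - 1) b))) = (-1) ^ q * H (Suc p)"
  proof -
    have "fdet p (\<lambda>a b. X a (Suc (skip (m - 1) b))) =
       (\<Sum>i\<le>q. (-1) ^ (i + q) * X i (Suc (skip (m - 1) q)) * fdet q (\<lambda>a b. X (skip i a) (Suc (skip (m - 1) (skip q b)))))"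
      unfolding p by (rule fdet_expand_col) simp
    also have "\<dots> = (-1) ^ q * H (Suc p)"
      unfolding H_def G_def sum_distrib_left
    proof (rule sum.cong[OF refl])
      fix i
      have "fdet q (\<lambda>a b. X (skip i a) (Suc (skip (m - 1) (skip q b)))) = fdet q (\<lambda>a b. X (skip i a) (Suc (skip (m - 1) b)))"
        by (intro fdet_cong) simp
      moreover have "skip (m - 1) q = p" using assms p by (simp add: insert_index_def)
      ultimately show "(-1) ^ (i + q) * X i (Suc (skip (m - 1) q)) * fdet q (\<lambda>a b. X (skip i a) (Suc (skip (m - 1) (skip q b))))
        = (-1) ^ q * ((-1) ^ i * X i (Suc p) * fdet q (\<lambda>a b. X (skip i a) (Suc (skip (m - 1) b))))"
        by (simp add: power_add ac_simps)
    qed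
    finally show ?thesis .
  qed
  have "0 = (\<Sum>i\<le>q. (-1) ^ i * G i * (\<Sum>r\<le>Suc p. (-1) ^ r * X i r * E r))"
    using R by (intro sum.neutral[symmetric] ballI) (simp del: sum.atMost_Suc add: p)
  also have "\<dots> = (\<Sum>r\<le>Suc p. (-1) ^ r * E r * H r)"
    unfolding H_def sum_distrib_left by (subst sum.swap) (simp only: ac_simps)
  also have "\<dots> = (\<Sum>r\<in>{0, m, Suc p}. (-1) ^ r * E r * H r)"
    by (rule sum.mono_neutral_right) (use assms H0 in auto)
  also have "\<dots> = E 0 * H 0 + (-1) ^ m * E m * H m + (-1) ^ q * E (Suc p) * H (Suc p)"
    using assms by (simp add: p)
  finally have *: "0 = E 0 * H 0 + (-1) ^ m * E m * H m + (-1) ^ q * E (Suc p) * H (Suc p)" .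
  have m: "(-1) ^ m = - ((-1) ^ (m - 1) :: 'a)"
    using assms by (cases m) auto
  show ?thesis
    unfolding F1 F2 F3 using * m by (simp add: algebra_simps add_eq_0_iff2)
qed

lemma incrD: "incr k r \<Longrightarrow> i < j \<Longrightarrow> j < k \<Longrightarrow> r i < r j"
  by (auto simp: strict_mono_on_def)

lemma incr_mono: "incr k r \<Longrightarrow> k' \<le> k \<Longrightarrow> incr k' r"
  by (auto simp: strict_mono_on_def)

lemma incr_comp_skip: "incr (Suc k) r \<Longrightarrow> incr k (\<lambda>i. r (skip m i))"
  by (auto simp: strict_mono_on_def insert_index_def)

lemma incr_ge:
  fixes r :: "nat \<Rightarrow> nat"
  assumes "incr k r" "i < k"
  shows "r 0 + i \<le> r i"
  using assms(2)
proof (induction i)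
  case (Suc i)
  then show ?case using incrD[OF assms(1), of i "Suc i"] by simp
qed simp

text \<open>
  Fekete's criterion. The first gap in the column set is filled, and the three-term relation expresses
  the minor by minors of smaller order or on a column set of smaller spread.
\<close>

theorem cpos_minors_if_consecutive:
  fixes F :: "'b::linorder \<Rightarrow> nat \<Rightarrow> complex"
  assumes consec: "\<And>k r j. incr k r \<Longrightarrow> r ` {..<k} \<subseteq> R \<Longrightarrow> j + k \<le> n \<Longrightarrow>
      cpos (fdet k (\<lambda>a b. F (r a) (j + b)))"
    and "incr k r" "r ` {..<k} \<subseteq> R" "incr k c" "c ` {..<k} \<subseteq> {..<n}"
  shows "cpos (fdet k (\<lambda>a b. F (r a) (c b)))"
  using assms(2-)
proof (induction k arbitrary: r c)
  case 0
  then show ?case by simp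
next
  case (Suc p)
  note IH = Suc.IH
  have r: "incr p r" "r ` {..<p} \<subseteq> R"
    using incr_mono[OF Suc.prems(1)] Suc.prems(2) by auto
  show ?case using Suc.prems
  proof (induction "c p - c 0" arbitrary: c rule: less_induct)
    case less
    show ?case
    proof (cases "\<forall>b\<le>p. c b = c 0 + b")
      case True
      then have c: "c b = c 0 + b" if "b \<le> p" for b using that by blast
      have "fdet (Suc p) (\<lambda>a b. F (r a) (c b)) = fdet (Suc p) (\<lambda>a b. F (r a) (c 0 + b))"
        by (rule fdet_cong) (metis c less_Suc_eq_le)
      moreover have "c p < n" using less.prems(4) by auto
      then have "c 0 + p < n" using c[of p] by simp
      ultimately show ?thesis using consec[OF less.prems(1,2), of "c 0"] by simp
    next
      case False
      define m where "m = (LEAST b. b \<le> p \<and> c b \<noteq> c 0 + b)"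
      have m: "m \<le> p" "c m \<noteq> c 0 + m"
        using LeastI_ex[of "\<lambda>b. b \<le> p \<and> c b \<noteq> c 0 + b"] False by (auto simp: m_def)
      have m_less: "c b = c 0 + b" if "b < m" for b
        using not_less_Least[of b "\<lambda>b. b \<le> p \<and> c b \<noteq> c 0 + b"] that m(1) by (auto simp: m_def)
      have "0 < m" using m by (cases m) auto
      have cm: "c 0 + m < c m"
        using incr_ge[OF less.prems(3), of m] m by simp
      \<comment> \<open>\<open>x\<close> is \<open>c\<close> with the missing value
        \<open>c 0 + m\<close> inserted at position \<open>m\<close>, so \<open>c\<close> is
        recovered by skipping that position.\<close>
      define x where "x = (\<lambda>i. if i < m then c i else if i = m then c 0 + m else c (i - 1))"
      have c_x: "c = (\<lambda>i. x (skip m i))"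
        by (auto simp: x_def insert_index_def)
      have xc: "incr (Suc (Suc p)) x"
      proof (rule strict_mono_onI)
        fix i j assume ij: "i \<in> {..<Suc (Suc p)}" "j \<in> {..<Suc (Suc p)}" "i < j"
        consider "j < m" | "j = m" | "i < m" "m < j" | "i = m" "j = Suc m" | "i = m" "Suc m < j" | "m < i"
          using ij(3) by linarith
        then show "x i < x j"
        proof cases
          case 1
          then show ?thesis using incrD[OF less.prems(3), of i j] ij m(1) by (auto simp: x_def)
        next
          case 2
          then have "c i = c 0 + i" using ij by (intro m_less) simp
          then show ?thesis using 2 ij by (auto simp: x_def)
        next
          case 4
          then show ?thesis using cm by (auto simp: x_def)
        next
          case 3
          then show ?thesis using incrD[OF less.prems(3), of i "j - 1"] ij by (auto simp: x_def)
        next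
          case 5
          then have "c m < c (j - 1)" using ij by (intro incrD[OF less.prems(3)]) auto
          then show ?thesis using 5 cm by (auto simp: x_def)
        next
          case 6
          then show ?thesis using incrD[OF less.prems(3), of "i - 1" "j - 1"] ij by (auto simp: x_def)
        qed
      qed
      have x0: "x 0 = c 0" "x (Suc p) = c p" using \<open>0 < m\<close> m by (auto simp: x_def)
      have x_lt: "x i < n" if "i < Suc (Suc p)" for i
      proof -
        have "c p < n" using less.prems by auto
        then have "x (Suc p) < n" by (simp add: x0)
        then show ?thesis using incrD[OF xc, of i "Suc p"] that by (cases "i = Suc p") auto
      qed
      let ?X = "\<lambda>a i. F (r a) (x i)"
      have "fdet p (\<lambda>a b. ?X a (Suc b)) * fdet (Suc p) (\<lambda>a b. ?X a (skip m b)) =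
        fdet p (\<lambda>a b. ?X a (skip m b)) * fdet (Suc p) (\<lambda>a b. ?X a (skip 0 b)) +
        fdet p (\<lambda>a b. ?X a (Suc (skip (m - 1) b))) * fdet (Suc p) (\<lambda>a b. ?X a (skip (Suc p) b))"
        by (rule three_term_Pluecker) fact+
      moreover have "cpos (fdet p (\<lambda>a b. ?X a (Suc b)))"
        using r xc x_lt by (intro IH) (auto simp: strict_mono_on_def)
      moreover have "cpos (fdet p (\<lambda>a b. ?X a (skip m b)))"
        using r xc x_lt by (intro IH) (auto simp: strict_mono_on_def insert_index_def)
      moreover have "cpos (fdet p (\<lambda>a b. ?X a (Suc (skip (m - 1) b))))"
        using r xc x_lt by (intro IH) (auto simp: strict_mono_on_def insert_index_def)
      \<comment> \<open>The minors of order \<open>p\<close> are covered by the outer induction. The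
        two remaining minors of order \<open>Suc p\<close> omit the first or the last entry of
        \<open>x\<close>, which lowers the spread of the columns. All of them being positive, the
        three-term relation can be divided by its first factor.\<close>
      moreover have "cpos (fdet (Suc p) (\<lambda>a b. ?X a (skip 0 b)))"
      proof (rule less.hyps)
        have "x 0 < x (Suc 0)" "x (Suc 0) \<le> x (Suc p)"
          using incrD[OF xc, of 0 "Suc 0"] incrD[OF xc, of "Suc 0" "Suc p"] m \<open>0 < m\<close> by (auto simp: order_le_less)
        then show "x (skip 0 p) - x (skip 0 0) < c p - c 0" by (simp add: x0)
      qed (use less.prems xc x_lt in \<open>auto simp: strict_mono_on_def\<close>)
      moreover have "cpos (fdet (Suc p) (\<lambda>a b. ?X a (skip (Suc p) b)))"
      proof (rule less.hyps)
        have "x 0 < x p" "x p < x (Suc p)"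
          using incrD[OF xc, of 0 p] incrD[OF xc, of p "Suc p"] m \<open>0 < m\<close> by auto
        then show "x (skip (Suc p) p) - x (skip (Suc p) 0) < c p - c 0" by (simp add: x0)
      qed (use less.prems xc x_lt in \<open>auto simp: strict_mono_on_def\<close>)
      ultimately have "cpos (fdet (Suc p) (\<lambda>a b. ?X a (skip m b)))"
        by (metis cpos_cancel cpos_mult cpos_add)
      then show ?thesis by (subst c_x)
    qed
  qed
qed

section \<open>The Vandermonde determinant and a totally positive kernel\<close>

text \<open>Right multiplication by the unitriangular \<open>B\<close> subtracts \<open>y 0\<close>
  times the preceding column from each column. The first row becomes a unit vector, and row
  \<open>a\<close> of the remaining minor has the positive factor
  \<open>y (Suc a) - y 0\<close>.\<close>

lemma Vandermonde_pos:
  fixes y :: "nat \<Rightarrow> real"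
  assumes "incr k y"
  shows "0 < fdet k (\<lambda>a b. y a ^ b)"
  using assms
proof (induction k arbitrary: y)
  case (Suc k)
  define B where "B = (\<lambda>s b. if s = b then 1 else if Suc s = b then - y 0 else 0)"
  let ?V = "\<lambda>a b. if b = 0 then 1 else y a ^ (b - 1) * (y a - y 0)"
  have "fdet (Suc k) (\<lambda>a b. y a ^ b) = fdet (Suc k) (\<lambda>a b. y a ^ b) * fdet (Suc k) B"
    by (subst fdet_upper[of "Suc k" B]) (auto simp: B_def)
  also have "\<dots> = fdet (Suc k) (\<lambda>a b. \<Sum>s<Suc k. y a ^ s * B s b)"
    by (rule fdet_mult[symmetric])
  also have "\<dots> = fdet (Suc k) ?V"
  proof (rule fdet_cong)
    fix a b assume "b < Suc k"
    have "(\<Sum>s<Suc k. y a ^ s * B s b) = (\<Sum>s\<in>(if b = 0 then {0} else {b - 1, b}). y a ^ s * B s b)"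
      using \<open>b < Suc k\<close> by (intro sum.mono_neutral_right) (auto simp: B_def)
    also have "\<dots> = ?V a b"
      by (cases b) (auto simp: B_def algebra_simps)
    finally show "(\<Sum>s<Suc k. y a ^ s * B s b) = ?V a b" .
  qed
  also have "\<dots> = (\<Sum>j\<le>k. if j = 0 then fdet k (\<lambda>a b. (y (Suc a) - y 0) * y (Suc a) ^ b) else 0)"
  proof -
    have "fdet (Suc k) ?V = (\<Sum>j\<le>k. (-1) ^ (0 + j) * ?V 0 j * fdet k (\<lambda>a b. ?V (skip 0 a) (skip j b)))"
      by (rule fdet_expand_row) simp
    also have "\<dots> = (\<Sum>j\<le>k. if j = 0 then fdet k (\<lambda>a b. (y (Suc a) - y 0) * y (Suc a) ^ b) else 0)"
      by (rule sum.cong[OF refl]) (simp add: mult.commute)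
    finally show ?thesis .
  qed
  also have "\<dots> = fdet k (\<lambda>a b. (y (Suc a) - y 0) * y (Suc a) ^ b)"
    by simp
  also have "\<dots> = (\<Prod>a<k. y (Suc a) - y 0) * fdet k (\<lambda>a b. y (Suc a) ^ b)"
    by (rule fdet_scale_rows)
  also have "0 < \<dots>"
  proof (rule mult_pos_pos)
    show "0 < (\<Prod>a<k. y (Suc a) - y 0)"
      using Suc.prems by (intro prod_pos) (auto simp: strict_mono_on_def)
    show "0 < fdet k (\<lambda>a b. y (Suc a) ^ b)"
      using Suc.prems by (intro Suc.IH) (auto simp: strict_mono_on_def)
  qed
  finally show ?case .
qed simp

text \<open>The exponent is \<open>\<bar>i - j\<bar>\<^sup>2\<close>, written with truncated subtraction.\<close>

definition gauss_kernel :: "real \<Rightarrow> nat \<Rightarrow> nat \<Rightarrow> complex" where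
  "gauss_kernel q i j = of_real (q ^ ((i - j)\<^sup>2 + (j - i)\<^sup>2))"

text \<open>Expanding the square in the exponent shows that the kernel is a Vandermonde matrix with
  nodes \<open>inverse q ^ (2 * i)\<close>, up to positive scalings of rows and columns. For
  \<open>q < 1\<close> the nodes increase with \<open>i\<close>.\<close>

lemma gauss_kernel_factor:
  assumes "0 < q"
  shows "gauss_kernel q i j = of_real (q ^ i\<^sup>2 * (q ^ j\<^sup>2 * (inverse q ^ (2 * i)) ^ j))"
proof -
  have e: "i\<^sup>2 + j\<^sup>2 = ((i - j)\<^sup>2 + (j - i)\<^sup>2) + 2 * i * j"
  proof (cases "i \<le> j")
    case True
    then obtain d where "j = i + d" by (auto simp: le_iff_add)
    then show ?thesis by (simp add: power2_eq_square algebra_simps)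
  next
    case False
    then obtain d where "i = j + d" by (metis le_iff_add nat_le_linear)
    then show ?thesis by (simp add: power2_eq_square algebra_simps)
  qed
  have "q ^ i\<^sup>2 * (q ^ j\<^sup>2 * (inverse q ^ (2 * i)) ^ j) = q ^ (i\<^sup>2 + j\<^sup>2) * inverse q ^ (2 * i * j)"
    by (simp add: power_add power_mult mult.assoc)
  also have "\<dots> = q ^ ((i - j)\<^sup>2 + (j - i)\<^sup>2) * (q * inverse q) ^ (2 * i * j)"
    unfolding e by (simp add: power_add power_mult_distrib)
  also have "\<dots> = q ^ ((i - j)\<^sup>2 + (j - i)\<^sup>2)"
    using assms by simp
  finally show ?thesis by (simp add: gauss_kernel_def)
qed

text \<open>On consecutive columns starting at \<open>j\<close> the power \<open>y a ^ j\<close> is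
  a further row scaling, which leaves a genuine Vandermonde determinant. Fekete's criterion passes
  to arbitrary columns.\<close>

lemma gauss_kernel_cpos_minors:
  fixes r c :: "nat \<Rightarrow> nat"
  assumes "0 < q" "q < 1" "incr k r" "incr k c"
  shows "cpos (fdet k (\<lambda>a b. gauss_kernel q (r a) (c b)))"
proof -
  have "cpos (fdet k (\<lambda>a b. gauss_kernel q (r a) (j + b)))" if r: "incr k r" for k r j
  proof -
    define y where "y = (\<lambda>a. inverse q ^ (2 * r a))"
    have "fdet k (\<lambda>a b. gauss_kernel q (r a) (j + b)) =
       of_real (fdet k (\<lambda>a b. (q ^ (r a)\<^sup>2 * y a ^ j) * (q ^ (j + b)\<^sup>2 * y a ^ b)))"
      unfolding fdet_of_real[symmetric] gauss_kernel_factor[OF assms(1)]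
      by (intro fdet_cong) (simp add: y_def power_add ac_simps)
    also have "\<dots> = of_real ((\<Prod>a<k. q ^ (r a)\<^sup>2 * y a ^ j) * ((\<Prod>b<k. q ^ (j + b)\<^sup>2) * fdet k (\<lambda>a b. y a ^ b)))"
      by (simp only: fdet_scale_rows fdet_scale_cols)
    also have "cpos \<dots>"
    proof -
      have "1 < inverse q" using assms by (simp add: one_less_inverse)
      then have "incr k y"
        using r by (auto simp: strict_mono_on_def y_def intro!: power_strict_increasing)
      then have V: "0 < fdet k (\<lambda>a b. y a ^ b)" by (rule Vandermonde_pos)
      have "0 < (\<Prod>a<k. q ^ (r a)\<^sup>2 * y a ^ j)" "0 < (\<Prod>b<k. q ^ (j + b)\<^sup>2)"
        using assms(1) by (auto intro!: prod_pos simp: y_def)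
      then show ?thesis unfolding cpos_of_real by (intro mult_pos_pos V)
    qed
    finally show ?thesis .
  qed
  moreover obtain n where "c ` {..<k} \<subseteq> {..<n}"
    using finite_nat_iff_bounded[of "c ` {..<k}"] by auto
  ultimately show ?thesis
    using cpos_minors_if_consecutive[of UNIV n "gauss_kernel q" k r c] assms by auto
qed

lemma tendsto_gauss_kernel: "((\<lambda>q. gauss_kernel q i j) \<longlongrightarrow> (if i = j then 1 else 0)) (at_right 0)"
proof -
  have "((\<lambda>q. gauss_kernel q i j) \<longlongrightarrow> of_real (0 ^ ((i - j)\<^sup>2 + (j - i)\<^sup>2))) (at_right 0)"
    unfolding gauss_kernel_def by (intro tendsto_intros)
  moreover have "(i - j)\<^sup>2 + (j - i)\<^sup>2 = 0 \<longleftrightarrow> i = j" by auto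
  ultimately show ?thesis by (auto simp: power_0_left)
qed

section \<open>Total nonnegativity of lower triangular matrices\<close>

lemma fdet_lower_block:
  assumes "\<And>a b. a < j \<Longrightarrow> a < b \<Longrightarrow> b < j + k \<Longrightarrow> F a b = 0"
  shows "fdet (j + k) F = (\<Prod>a<j. F a a) * fdet k (\<lambda>a b. F (j + a) (j + b))"
  using assms
proof (induction j arbitrary: F)
  case (Suc j)
  have "fdet (Suc (j + k)) F = (\<Sum>b\<le>j + k. (-1) ^ (0 + b) * F 0 b * fdet (j + k) (\<lambda>a b'. F (skip 0 a) (skip b b')))"
    by (rule fdet_expand_row) simp
  also have "\<dots> = (\<Sum>b\<le>j + k. if b = 0 then F 0 0 * fdet (j + k) (\<lambda>a b'. F (Suc a) (Suc b')) else 0)"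
    using Suc.prems by (intro sum.cong refl) auto
  also have "\<dots> = F 0 0 * fdet (j + k) (\<lambda>a b'. F (Suc a) (Suc b'))"
    by simp
  also have "fdet (j + k) (\<lambda>a b'. F (Suc a) (Suc b')) =
      (\<Prod>a<j. F (Suc a) (Suc a)) * fdet k (\<lambda>a b. F (Suc (j + a)) (Suc (j + b)))"
    using Suc.prems by (intro Suc.IH) auto
  finally show ?case
    by (simp add: prod.lessThan_Suc_shift mult.assoc del: prod.lessThan_Suc)
qed simp

lemma fdet_zero_row:
  assumes "i < k" "\<And>j. j < k \<Longrightarrow> F i j = 0"
  shows "fdet k F = 0"
proof -
  obtain p where "k = Suc p" using assms by (cases k) auto
  then show ?thesis using assms by (auto simp: fdet_expand_row[of i p] intro!: sum.neutral)
qed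

definition left_minors_pos :: "nat \<Rightarrow> (nat \<Rightarrow> nat \<Rightarrow> complex) \<Rightarrow> bool" where
  "left_minors_pos n A \<longleftrightarrow>
     (\<forall>k r. k \<le> n \<longrightarrow> incr k r \<longrightarrow> r ` {..<k} \<subseteq> {..<n} \<longrightarrow> cpos (fdet k (\<lambda>a b. A (r a) b)))"

lemma left_minors_posD:
  "left_minors_pos n A \<Longrightarrow> k \<le> n \<Longrightarrow> incr k r \<Longrightarrow> r ` {..<k} \<subseteq> {..<n} \<Longrightarrow>
    cpos (fdet k (\<lambda>a b. A (r a) b))"
  by (auto simp: left_minors_pos_def)

lemma incr_index_less:
  fixes r :: "nat \<Rightarrow> nat"
  assumes "incr k r" "r ` {..<k} \<subseteq> {..<n}"
  shows "k \<le> n"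
  using card_inj_on_le[OF strict_mono_on_imp_inj_on[OF assms(1)] assms(2)] by simp

context
  fixes n :: nat and A :: "nat \<Rightarrow> nat \<Rightarrow> complex"
  assumes low: "\<And>i j. i < j \<Longrightarrow> j < n \<Longrightarrow> A i j = 0"
    and left: "left_minors_pos n A"
begin

lemma lower_diag_prod_cpos: "k \<le> n \<Longrightarrow> cpos (\<Prod>i<k. A i i)"
  using left_minors_posD[OF left, of k "\<lambda>a. a"] low fdet_lower[of k A]
  by (auto simp: strict_mono_on_def)

text \<open>Prepending the rows and columns \<open>0, ..., j - 1\<close> turns the minor into a
  left-justified one. As \<open>A\<close> is lower triangular, this only multiplies it by the
  positive product of the first \<open>j\<close> diagonal entries. The bound
  \<open>j \<le> r a\<close> keeps the extended row sequence increasing.\<close>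

lemma lower_consecutive_cpos:
  assumes r: "incr k r" "r ` {..<k} \<subseteq> {..<n}" and jk: "j + k \<le> n" and ge: "\<And>a. a < k \<Longrightarrow> j \<le> r a"
  shows "cpos (fdet k (\<lambda>a b. A (r a) (j + b)))"
proof -
  let ?r = "\<lambda>a. if a < j then a else r (a - j)"
  have "incr (j + k) ?r"
  proof (rule strict_mono_onI)
    fix a a' assume "a \<in> {..<j + k}" "a' \<in> {..<j + k}" "a < a'"
    then consider "a' < j" | "a < j" "j \<le> a'" "a' - j < k" | "j \<le> a" "a - j < a' - j" "a' - j < k"
      by fastforce
    then show "?r a < ?r a'"
    proof cases
      case 2
      then show ?thesis using ge[of "a' - j"] by simp
    next
      case 3
      then show ?thesis using incrD[OF r(1), of "a - j" "a' - j"] by simp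
    qed (use \<open>a < a'\<close> in simp)
  qed
  moreover have "?r ` {..<j + k} \<subseteq> {..<n}" using r jk by (auto simp: image_subset_iff)
  ultimately have "cpos (fdet (j + k) (\<lambda>a b. A (?r a) b))"
    using left jk by (intro left_minors_posD)
  also have "fdet (j + k) (\<lambda>a b. A (?r a) b) = (\<Prod>a<j. A a a) * fdet k (\<lambda>a b. A (r a) (j + b))"
    using low jk by (subst fdet_lower_block) auto
  finally show ?thesis
    using cpos_cancel[OF lower_diag_prod_cpos[of j]] jk by simp
qed

text \<open>In the case not covered by \<open>lower_consecutive_cpos\<close> some row lies above
  \<open>j\<close>, and such a row of a lower triangular matrix vanishes on all columns from
  \<open>j\<close> on.\<close>

lemma lower_consecutive_nonneg:
  assumes r: "incr k r" "r ` {..<k} \<subseteq> {..<n}" and jk: "j + k \<le> n"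
  shows "fdet k (\<lambda>a b. A (r a) (j + b)) \<in> \<real>\<^sub>\<ge>\<^sub>0"
proof (cases "\<forall>a<k. j \<le> r a")
  case True
  then show ?thesis using lower_consecutive_cpos[OF assms] by (auto simp: cpos_def)
next
  case False
  then obtain a where "a < k" "r a < j" by auto
  then have "fdet k (\<lambda>a b. A (r a) (j + b)) = 0"
    using low jk by (intro fdet_zero_row[of a]) auto
  then show ?thesis by simp
qed

text \<open>
  After multiplication by a totally positive kernel close to the identity, all minors on consecutive
  columns are positive by Cauchy--Binet.
\<close>

theorem lower_totally_nonneg:
  assumes r: "incr k r" "r ` {..<k} \<subseteq> {..<n}" and c: "incr k c" "c ` {..<k} \<subseteq> {..<n}"
  shows "fdet k (\<lambda>a b. A (r a) (c b)) \<in> \<real>\<^sub>\<ge>\<^sub>0"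
proof -
  define B where "B = (\<lambda>q i j. \<Sum>s<n. gauss_kernel q i s * A s j)"
  have "cpos (fdet k (\<lambda>a b. B q (r a) (c b)))" if q: "0 < q" "q < 1" for q
  proof (rule cpos_minors_if_consecutive[of "{..<n}" n])
    fix k r j assume r: "incr k r" "r ` {..<k} \<subseteq> {..<n}" and jk: "j + k \<le> n"
    let ?t = "\<lambda>S. fdet k (\<lambda>a b. gauss_kernel q (r a) (sorted_list_of_set S ! b)) *
       fdet k (\<lambda>a b. A (sorted_list_of_set S ! a) (j + b))"
    have "fdet k (\<lambda>a b. B q (r a) (j + b)) = (\<Sum>S | S \<subseteq> {..<n} \<and> card S = k. ?t S)"
      unfolding B_def by (rule Cauchy_Binet) simp
    also have "cpos \<dots>"
    proof (rule cpos_sum)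
      show "finite {S. S \<subseteq> {..<n} \<and> card S = k}"
        by (rule finite_subset[of _ "Pow {..<n}"]) auto
      \<comment> \<open>One strictly positive summand suffices. The row set
        \<open>{j..<j + k}\<close> provides it, since all its rows are at least
        \<open>j\<close>.\<close>
      show "{j..<j + k} \<in> {S. S \<subseteq> {..<n} \<and> card S = k}" using jk by auto
      have "sorted_list_of_set {j..<j + k} = [j..<j + k]" by simp
      then have "?t {j..<j + k} = fdet k (\<lambda>a b. gauss_kernel q (r a) (j + b)) * fdet k (\<lambda>a b. A (j + a) (j + b))"
        by (intro arg_cong2[of _ _ _ _ "(*)"] fdet_cong) simp_all
      moreover have "cpos (fdet k (\<lambda>a b. gauss_kernel q (r a) (j + b)))"
        by (rule gauss_kernel_cpos_minors) (use q r in \<open>auto simp: strict_mono_on_def\<close>)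
      moreover have "cpos (fdet k (\<lambda>a b. A (j + a) (j + b)))"
        by (rule lower_consecutive_cpos) (use jk in \<open>auto simp: strict_mono_on_def\<close>)
      ultimately show "cpos (?t {j..<j + k})" by (simp add: cpos_mult)
      fix S assume "S \<in> {S. S \<subseteq> {..<n} \<and> card S = k}"
      then have S: "S \<subseteq> {..<n}" "card S = k" "finite S" by (auto intro: finite_subset)
      then have s: "incr k ((!) (sorted_list_of_set S))" "(!) (sorted_list_of_set S) ` {..<k} \<subseteq> {..<n}"
        using incr_sorted_list_nth[of S] sorted_list_nth_bij[of S] by (auto simp: bij_betw_def)
      have "cpos (fdet k (\<lambda>a b. gauss_kernel q (r a) (sorted_list_of_set S ! b)))"
        by (rule gauss_kernel_cpos_minors) (use q r s in auto)
      then show "?t S \<in> \<real>\<^sub>\<ge>\<^sub>0"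
        using lower_consecutive_nonneg[OF s jk] by (auto simp: cpos_def)
    qed
    finally show "cpos (fdet k (\<lambda>a b. B q (r a) (j + b)))" .
  qed (use r c in auto)
  \<comment> \<open>The kernel tends to the identity as \<open>q\<close> decreases to
    \<open>0\<close>, and nonnegativity is a closed condition, so it survives in the limit.\<close>
  then have "eventually (\<lambda>q. fdet k (\<lambda>a b. B q (r a) (c b)) \<in> \<real>\<^sub>\<ge>\<^sub>0) (at_right 0)"
    unfolding eventually_at_right_field by (intro exI[of _ 1]) (auto simp: cpos_def)
  moreover have "((\<lambda>q. fdet k (\<lambda>a b. B q (r a) (c b))) \<longlongrightarrow> fdet k (\<lambda>a b. A (r a) (c b))) (at_right 0)"
  proof (rule tendsto_fdet)
    fix a b assume "a < k"
    have "((\<lambda>q. B q (r a) (c b)) \<longlongrightarrow> (\<Sum>s<n. (if r a = s then 1 else 0) * A s (c b))) (at_right 0)"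
      unfolding B_def by (intro tendsto_intros tendsto_gauss_kernel)
    also have "(\<Sum>s<n. (if r a = s then 1 else 0) * A s (c b)) = A (r a) (c b)"
      using r(2) \<open>a < k\<close> by (simp add: if_distrib[of "\<lambda>x. x * _"] image_subset_iff cong: if_cong)
    finally show "((\<lambda>q. B q (r a) (c b)) \<longlongrightarrow> A (r a) (c b)) (at_right 0)" .
  qed
  ultimately show ?thesis
    by (intro Lim_in_closed_set[of "\<real>\<^sub>\<ge>\<^sub>0"]) (auto simp: closed_nonneg_Reals_complex)
qed

end

section \<open>Triangular factorisation and bottom-justified minors\<close>

text \<open>
  The upper triangular factor turning \<open>G\<close> into a unit lower triangular matrix: its entries are
  normalised cofactors of the leading principal submatrices.
\<close>

definition lu_factor :: "(nat \<Rightarrow> nat \<Rightarrow> complex) \<Rightarrow> nat \<Rightarrow> nat \<Rightarrow> complex" where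
  "lu_factor G b j = (if b \<le> j then (-1) ^ (j + b) * fdet j (\<lambda>a b'. G a (skip b b')) / fdet (Suc j) G else 0)"

lemma lu_factor_upper: "j < b \<Longrightarrow> lu_factor G b j = 0"
  by (simp add: lu_factor_def)

lemma lu_factor_diag: "lu_factor G j j = fdet j G / fdet (Suc j) G"
proof -
  have "fdet j (\<lambda>a b'. G a (skip j b')) = fdet j G" by (rule fdet_cong) simp
  then show ?thesis by (simp add: lu_factor_def flip: mult_2)
qed

text \<open>The sum is a Laplace expansion along the last row of the leading submatrix of order
  \<open>Suc j\<close>, with that row replaced by row \<open>i\<close>. A repeated row gives
  \<open>0\<close> for \<open>i < j\<close>, and \<open>i = j\<close> gives the normalisation
  \<open>1\<close>.\<close>

lemma sum_lu_factor:
  assumes "j < n"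
  shows "(\<Sum>b<n. G i b * lu_factor G b j) = fdet (Suc j) (\<lambda>a b. if a = j then G i b else G a b) / fdet (Suc j) G"
proof -
  have "(\<Sum>b<n. G i b * lu_factor G b j) = (\<Sum>b\<le>j. G i b * lu_factor G b j)"
    using assms by (intro sum.mono_neutral_right) (auto simp: lu_factor_upper)
  also have "\<dots> = (\<Sum>b\<le>j. (-1) ^ (j + b) * G i b * fdet j (\<lambda>a b'. G a (skip b b'))) / fdet (Suc j) G"
    unfolding sum_divide_distrib by (intro sum.cong refl) (simp add: lu_factor_def)
  also have "(\<Sum>b\<le>j. (-1) ^ (j + b) * G i b * fdet j (\<lambda>a b'. G a (skip b b'))) =
      fdet (Suc j) (\<lambda>a b. if a = j then G i b else G a b)"
    by (subst fdet_expand_row[of j]) (auto intro!: sum.cong fdet_cong)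
  finally show ?thesis .
qed

lemma sum_lu_factor_lower:
  assumes "i < j" "j < n"
  shows "(\<Sum>b<n. G i b * lu_factor G b j) = 0"
proof -
  have "fdet (Suc j) (\<lambda>a b. if a = j then G i b else G a b) = 0"
    by (rule fdet_eq_rows_0[of j _ i]) (use assms in auto)
  then show ?thesis using assms by (simp add: sum_lu_factor)
qed

lemma sum_lu_factor_diag:
  assumes "j < n" "fdet (Suc j) G \<noteq> 0"
  shows "(\<Sum>b<n. G j b * lu_factor G b j) = 1"
proof -
  have "fdet (Suc j) (\<lambda>a b. if a = j then G j b else G a b) = fdet (Suc j) G"
    by (rule fdet_cong) auto
  then show ?thesis using assms by (simp add: sum_lu_factor)
qed

text \<open>An upper triangular right factor mixes the first \<open>k\<close> columns only among
  themselves, hence it rescales every left-justified minor by the same diagonal product.\<close>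

lemma fdet_mult_upper:
  assumes "k \<le> n" "\<And>s j. j < s \<Longrightarrow> s < n \<Longrightarrow> U s j = 0"
  shows "fdet k (\<lambda>i j. \<Sum>s<n. X i s * U s j) = fdet k X * (\<Prod>j<k. U j j)"
proof -
  have "fdet k (\<lambda>i j. \<Sum>s<n. X i s * U s j) = fdet k (\<lambda>i j. \<Sum>s<k. X i s * U s j)"
    using assms by (intro fdet_cong sum.mono_neutral_right) auto
  also have "\<dots> = fdet k X * (\<Prod>j<k. U j j)"
    using assms by (subst fdet_mult, subst fdet_upper) auto
  finally show ?thesis .
qed

definition unitary_fun :: "nat \<Rightarrow> (nat \<Rightarrow> nat \<Rightarrow> complex) \<Rightarrow> bool" where
  "unitary_fun n G \<longleftrightarrow> (\<forall>i<n. \<forall>j<n. (\<Sum>s<n. cnj (G s i) * G s j) = (if i = j then 1 else 0))"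

lemma unitary_funD:
  "unitary_fun n G \<Longrightarrow> i < n \<Longrightarrow> j < n \<Longrightarrow> (\<Sum>s<n. cnj (G s i) * G s j) = (if i = j then 1 else 0)"
  by (simp add: unitary_fun_def)

lemma cpos_cnj: "cpos z \<Longrightarrow> cnj z = z"
  by (auto simp: cpos_iff complex_eq_iff)

lemma nonneg_Reals_cnj: "z \<in> \<real>\<^sub>\<ge>\<^sub>0 \<Longrightarrow> cnj z = z"
  by (auto simp: complex_nonneg_Reals_iff complex_eq_iff)

text \<open>
  With \<open>l = G u\<close> unit lower triangular, unitarity gives \<open>u\<^sup>* = l\<^sup>* G\<close>. So first \<open>l\<close> and then the lower
  triangular \<open>h = u\<^sup>*\<close> have positive left-justified minors, and \<open>h\<close> has the bottom-justified minors
  of \<open>G\<close>.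
\<close>

theorem unitary_bottom_minors_nonneg:
  assumes unit: "unitary_fun n G" and left: "left_minors_pos n G"
    and c: "incr p c" "c ` {..<p} \<subseteq> {..<n}"
  shows "fdet p (\<lambda>a b. G (n - p + a) (c b)) \<in> \<real>\<^sub>\<ge>\<^sub>0"
proof -
  have lead: "cpos (fdet k G)" if "k \<le> n" for k
    using left_minors_posD[OF left that, of "\<lambda>a. a"] that by (auto simp: strict_mono_on_def)
  define u where "u = lu_factor G"
  define l where "l = (\<lambda>i j. \<Sum>b<n. G i b * u b j)"
  have u_upper: "u s j = 0" if "j < s" for s j
    using that by (simp add: u_def lu_factor_upper)
  have u_diag: "cpos (u j j)" if "j < n" for j
    using that lead by (simp add: u_def lu_factor_diag cpos_divide)
  have l_low: "l i j = 0" if "i < j" "j < n" for i j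
    using that by (simp add: l_def u_def sum_lu_factor_lower)
  have l_diag: "l j j = 1" if "j < n" for j
    using that lead[of "Suc j"] by (simp add: l_def u_def sum_lu_factor_diag cpos_def)
  have l_left: "left_minors_pos n l"
    unfolding left_minors_pos_def l_def
    using left_minors_posD[OF left] u_diag by (auto simp: fdet_mult_upper u_upper intro!: cpos_mult cpos_prod)
  have l_nonneg: "fdet k (\<lambda>a b. l (r a) (c b)) \<in> \<real>\<^sub>\<ge>\<^sub>0"
    if "incr k r" "r ` {..<k} \<subseteq> {..<n}" "incr k c" "c ` {..<k} \<subseteq> {..<n}" for k r c
    using lower_totally_nonneg[of n l k r c] l_low l_left that by auto
  \<comment> \<open>Minors of order one are entries. Since they are real, the transpose of
    \<open>l\<close> is its adjoint, so the nonnegative minors of \<open>l\<close> can be used for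
    the adjoint in Cauchy--Binet.\<close>
  have l_real: "cnj (l i j) = l i j" if "i < n" "j < n" for i j
  proof -
    have inc: "incr (Suc 0) (\<lambda>_. x)" for x :: nat
      by (auto simp: strict_mono_on_def)
    have "fdet (Suc 0) (\<lambda>_ _. l i j) \<in> \<real>\<^sub>\<ge>\<^sub>0"
      using that by (intro l_nonneg[of "Suc 0" "\<lambda>_. i" "\<lambda>_. j"] inc) auto
    then show ?thesis by (simp add: nonneg_Reals_cnj)
  qed
  define h where "h = (\<lambda>i j. cnj (u j i))"
  \<comment> \<open>The adjoint of \<open>l = G u\<close> is the adjoint of \<open>u\<close> times
    the adjoint of \<open>G\<close>; multiplying by \<open>G\<close> on the right cancels the
    unitary part.\<close>
  have h: "(\<Sum>s<n. l s i * G s j) = h i j" if "i < n" "j < n" for i j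
  proof -
    have "(\<Sum>s<n. l s i * G s j) = (\<Sum>s<n. cnj (l s i) * G s j)"
      using that by (intro sum.cong refl) (simp add: l_real)
    also have "\<dots> = (\<Sum>s<n. \<Sum>b<n. cnj (u b i) * (cnj (G s b) * G s j))"
      by (simp add: l_def sum_distrib_left sum_distrib_right ac_simps)
    also have "\<dots> = (\<Sum>b<n. cnj (u b i) * (\<Sum>s<n. cnj (G s b) * G s j))"
      by (subst sum.swap) (simp add: sum_distrib_left)
    also have "\<dots> = (\<Sum>b<n. if b = j then cnj (u b i) else 0)"
      using unit that by (intro sum.cong refl) (auto simp: unitary_fun_def)
    also have "\<dots> = h i j" using that by (simp add: h_def)
    finally show ?thesis .
  qed
  have h_left: "left_minors_pos n h"
    unfolding left_minors_pos_def
  proof (intro allI impI)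
    fix k and r :: "nat \<Rightarrow> nat" assume k: "k \<le> n" and r: "incr k r" "r ` {..<k} \<subseteq> {..<n}"
    let ?t = "\<lambda>S. fdet k (\<lambda>a b. l (sorted_list_of_set S ! b) (r a)) *
       fdet k (\<lambda>a b. G (sorted_list_of_set S ! a) b)"
    have "fdet k (\<lambda>a b. h (r a) b) = fdet k (\<lambda>a b. \<Sum>s<n. l s (r a) * G s b)"
      using r k by (intro fdet_cong h[symmetric]) (auto simp: image_subset_iff)
    also have "\<dots> = (\<Sum>S | S \<subseteq> {..<n} \<and> card S = k. ?t S)"
      by (rule Cauchy_Binet) simp
    also have "cpos \<dots>"
    proof (rule cpos_sum)
      show "finite {S. S \<subseteq> {..<n} \<and> card S = k}"
        by (rule finite_subset[of _ "Pow {..<n}"]) auto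
      have S: "incr k ((!) (sorted_list_of_set S))" "(!) (sorted_list_of_set S) ` {..<k} \<subseteq> {..<n}"
        if "S \<in> {S. S \<subseteq> {..<n} \<and> card S = k}" for S
      proof -
        have "S \<subseteq> {..<n}" "card S = k" "finite S" using that by (auto intro: finite_subset)
        then show "incr k ((!) (sorted_list_of_set S))" "(!) (sorted_list_of_set S) ` {..<k} \<subseteq> {..<n}"
          using incr_sorted_list_nth[of S] sorted_list_nth_bij[of S] by (auto simp: bij_betw_def)
      qed
      have lT: "fdet k (\<lambda>a b. l (sorted_list_of_set S ! b) (r a)) = fdet k (\<lambda>a b. l (sorted_list_of_set S ! a) (r b))" for S
        by (rule fdet_transpose)
      show "?t S \<in> \<real>\<^sub>\<ge>\<^sub>0" if "S \<in> {S. S \<subseteq> {..<n} \<and> card S = k}" for S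
        unfolding lT using l_nonneg[OF S[OF that] r] left_minors_posD[OF left k S[OF that]]
        by (auto simp: cpos_def)
      \<comment> \<open>The strictly positive summand: on the row set of \<open>r\<close> itself the
        minor of \<open>l\<close> is a principal one, equal to \<open>1\<close> because
        \<open>l\<close> is unit lower triangular.\<close>
      let ?S = "r ` {..<k}"
      show rS: "?S \<in> {S. S \<subseteq> {..<n} \<and> card S = k}"
        using r by (auto simp: card_image strict_mono_on_imp_inj_on)
      have "fdet k (\<lambda>a b. l (sorted_list_of_set ?S ! a) (r b)) = fdet k (\<lambda>a b. l (r a) (r b))"
        using r by (intro fdet_cong) (simp add: sorted_list_of_incr_image)
      also have "\<dots> = (\<Prod>a<k. l (r a) (r a))"
        using r by (intro fdet_lower l_low) (auto simp: strict_mono_on_def image_subset_iff)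
      also have "\<dots> = 1" using r by (intro prod.neutral) (auto simp: l_diag)
      finally show "cpos (?t ?S)"
        unfolding lT using left_minors_posD[OF left k S[OF rS]] by simp
    qed
    finally show "cpos (fdet k (\<lambda>a b. h (r a) b))" .
  qed
  have p: "p \<le> n" using incr_index_less[OF c] .
  have "fdet p (\<lambda>a b. h (n - p + a) (c b)) \<in> \<real>\<^sub>\<ge>\<^sub>0"
  proof (rule lower_totally_nonneg[of n])
    show "h i j = 0" if "i < j" "j < n" for i j using that by (simp add: h_def u_upper)
  qed (use h_left c p in \<open>auto simp: strict_mono_on_def\<close>)
  also have "fdet p (\<lambda>a b. h (n - p + a) (c b)) =
      fdet p (\<lambda>a b. \<Sum>s<p. l (n - p + s) (n - p + a) * G (n - p + s) (c b))"
  proof (rule fdet_cong)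
    fix a b assume ab: "a < p" "b < p"
    have "h (n - p + a) (c b) = (\<Sum>s<n. l s (n - p + a) * G s (c b))"
      using ab c p by (intro h[symmetric]) (auto simp: image_subset_iff)
    \<comment> \<open>As \<open>l\<close> is lower triangular, the last \<open>p\<close> rows of its
      adjoint only combine the last \<open>p\<close> rows of \<open>G\<close>, through a
      unitriangular block of determinant \<open>1\<close>.\<close>
    also have "\<dots> = (\<Sum>s\<in>{n - p..<n}. l s (n - p + a) * G s (c b))"
      using ab p by (intro sum.mono_neutral_right) (auto simp: l_low)
    also have "\<dots> = (\<Sum>s<p. l (n - p + s) (n - p + a) * G (n - p + s) (c b))"
      using p by (intro sum.reindex_bij_witness[of _ "\<lambda>s. n - p + s" "\<lambda>s. s - (n - p)"]) auto
    finally show "h (n - p + a) (c b) = (\<Sum>s<p. l (n - p + s) (n - p + a) * G (n - p + s) (c b))" .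
  qed
  also have "\<dots> = fdet p (\<lambda>a b. G (n - p + a) (c b))"
    using p by (subst fdet_mult, subst fdet_upper) (auto simp: l_low l_diag)
  finally show ?thesis .
qed

section \<open>Complementary minors and QR factorisation\<close>

lemma unitary_fun_right:
  assumes "unitary_fun n G" "i < n" "j < n"
  shows "(\<Sum>s<n. G i s * cnj (G j s)) = (if i = j then 1 else 0)"
proof -
  define A where "A = Matrix.mat n n (\<lambda>(i, j). cnj (G j i))"
  define B where "B = Matrix.mat n n (\<lambda>(i, j). G i j)"
  have "A * B = 1\<^sub>m n"
  proof (rule eq_matI)
    fix i j assume "i < dim_row (1\<^sub>m n :: complex mat)" "j < dim_col (1\<^sub>m n :: complex mat)"
    then have ij: "i < n" "j < n" by simp_all
    then have "(A * B) $$ (i, j) = (\<Sum>s<n. cnj (G s i) * G s j)"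
      by (simp add: A_def B_def scalar_prod_def atLeast0LessThan)
    also have "\<dots> = (if i = j then 1 else 0)"
      by (rule unitary_funD[OF assms(1) ij])
    also have "\<dots> = 1\<^sub>m n $$ (i, j)"
      using ij by simp
    finally show "(A * B) $$ (i, j) = 1\<^sub>m n $$ (i, j)" .
  qed (simp_all add: A_def B_def)
  then have "B * A = 1\<^sub>m n"
    by (rule mat_mult_left_right_inverse[rotated 2]) (auto simp: A_def B_def)
  then have "(B * A) $$ (i, j) = 1\<^sub>m n $$ (i, j)" by simp
  then show ?thesis
    using assms(2,3) by (simp add: A_def B_def scalar_prod_def atLeast0LessThan)
qed

lemma incr_range_id:
  fixes r :: "nat \<Rightarrow> nat"
  assumes "incr k r" "r ` {..<k} = {..<k}" "a < k"
  shows "r a = a"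
proof -
  have "map r [0..<k] = [0..<k]"
    using sorted_list_of_incr_image[OF assms(1)] unfolding assms(2) by (simp add: lessThan_atLeast0)
  then show ?thesis using assms(3) map_eq_conv[of r "[0..<k]" id] by simp
qed

text \<open>Laplace expansion along the appended unit columns, the last one first. Each expansion
  deletes one row outside the range of \<open>r\<close>, and the lemma keeps track of the
  accumulated sign.\<close>

lemma fdet_append_unit_columns:
  fixes X :: "nat \<Rightarrow> nat \<Rightarrow> 'a::comm_ring_1"
  assumes "incr k r" "incr p t" "t ` {..<p} \<subseteq> {..<k + p}" "r ` {..<k} = {..<k + p} - t ` {..<p}"
  shows "fdet (k + p) (\<lambda>a b. if b < k then X a b else if a = t (b - k) then 1 else 0) =
    (-1) ^ ((\<Sum>a<k. r a) + (\<Sum>a<k. a)) * fdet k (\<lambda>a b. X (r a) b)"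
  using assms
proof (induction p arbitrary: X r)
  case 0
  have r: "r a = a" if "a < k" for a
    using incr_range_id[of k r a] 0 that by simp
  then have "(\<Sum>a<k. r a) + (\<Sum>a<k. a) = 2 * (\<Sum>a<k. a)" by (simp add: mult_2)
  then have "(-1) ^ ((\<Sum>a<k. r a) + (\<Sum>a<k. a)) = (1 :: 'a)" by (simp add: power_mult)
  moreover have "fdet k (\<lambda>a b. if b < k then X a b else if a = t (b - k) then 1 else 0) = fdet k (\<lambda>a b. X (r a) b)"
    by (rule fdet_cong) (simp add: r)
  ultimately show ?case by simp
next
  case (Suc q)
  let ?Y = "\<lambda>a b. if b < k then X a b else if a = t (b - k) then 1 else 0"
  define j where "j = t q"
  have j: "j \<le> k + q" using Suc.prems(3) by (auto simp: j_def)
  have tj: "t b < j" if "b < q" for b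
    using incrD[OF Suc.prems(2), of b q] that by (simp add: j_def)
  \<comment> \<open>The numbers that the rows \<open>r a\<close> receive after row \<open>j\<close>
    is deleted; \<open>skip j\<close> restores the old ones.\<close>
  define r' where "r' = (\<lambda>a. if r a < j then r a else r a - 1)"
  have rj: "r a \<noteq> j" "r a \<le> k + q" if "a < k" for a
  proof -
    have "r a \<in> {..<k + Suc q} - t ` {..<Suc q}"
      using Suc.prems(4) that by blast
    then show "r a \<noteq> j" "r a \<le> k + q" by (auto simp: j_def)
  qed
  have skip_r': "skip j (r' a) = r a" if "a < k" for a
    using rj[OF that] by (auto simp: r'_def insert_index_def)
  have t_skip: "skip j a = t b \<longleftrightarrow> a = t b" if "b < q" for a b
    using tj[OF that] by (auto simp: insert_index_def)
  have r'_incr: "incr k r'"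
  proof (rule strict_mono_onI)
    fix a b assume ab: "a \<in> {..<k}" "b \<in> {..<k}" "a < b"
    then have "r a < r b" "r a \<noteq> j" "r b \<noteq> j" using incrD[OF Suc.prems(1), of a b] rj by auto
    then show "r' a < r' b" by (auto simp: r'_def)
  qed
  have r'_range: "r' ` {..<k} = {..<k + q} - t ` {..<q}"
  proof (intro equalityI subsetI)
    fix x assume "x \<in> r' ` {..<k}"
    then obtain a where a: "a < k" "x = r' a" by auto
    have "x \<notin> t ` {..<q}"
    proof
      assume "x \<in> t ` {..<q}"
      then obtain b where b: "b < q" "x = t b" by auto
      then have "r a = t b" using t_skip[OF b(1), of x] skip_r'[OF a(1)] a(2) by simp
      moreover have "r a \<in> {..<k + Suc q} - t ` {..<Suc q}" using Suc.prems(4) a by blast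
      ultimately show False using b by auto
    qed
    moreover have "x < k + q" using rj[OF a(1)] j a by (auto simp: r'_def)
    ultimately show "x \<in> {..<k + q} - t ` {..<q}" by simp
  next
    fix x assume x: "x \<in> {..<k + q} - t ` {..<q}"
    have "skip j x \<noteq> t b" if "b < Suc q" for b
    proof (cases "b < q")
      case True
      then show ?thesis using x t_skip[OF True, of x] by auto
    next
      case False
      then have "b = q" using that by simp
      then show ?thesis by (auto simp: j_def[symmetric] insert_index_def)
    qed
    moreover have "skip j x < k + Suc q" using x by (auto simp: insert_index_def)
    ultimately have "skip j x \<in> r ` {..<k}" unfolding Suc.prems(4) by auto
    then obtain a where a: "a < k" "skip j x = r a" by auto
    then have "r' a = x" using rj[of a] by (auto simp: r'_def insert_index_def split: if_splits)
    then show "x \<in> r' ` {..<k}" using a by auto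
  qed
  \<comment> \<open>\<open>j = t q\<close> is the largest row outside the range of \<open>r\<close>.
    So all \<open>k + q - j\<close> later rows are values of \<open>r\<close>, and exactly these
    drop by one; this difference has the parity of the exponent \<open>j + (k + q)\<close>.\<close>
  have sum_r: "(\<Sum>a<k. r a) = (\<Sum>a<k. r' a) + (k + q - j)"
  proof -
    have "(\<Sum>a<k. r a) = (\<Sum>a<k. r' a + (if j < r a then 1 else 0))"
      using rj by (intro sum.cong refl) (auto simp: r'_def)
    also have "\<dots> = (\<Sum>a<k. r' a) + card {a \<in> {..<k}. j < r a}"
      using sum.inter_filter[of "{..<k}" "\<lambda>_. 1 :: nat" "\<lambda>a. j < r a"] by (simp add: sum.distrib)
    also have "card {a \<in> {..<k}. j < r a} = card (r ` {a \<in> {..<k}. j < r a})"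
      using strict_mono_on_imp_inj_on[OF Suc.prems(1)]
      by (intro card_image[symmetric]) (auto simp: inj_on_def)
    also have "r ` {a \<in> {..<k}. j < r a} = {j<..<k + Suc q}"
    proof (intro equalityI subsetI)
      fix x assume x: "x \<in> {j<..<k + Suc q}"
      have "x \<notin> t ` {..<Suc q}"
      proof
        assume "x \<in> t ` {..<Suc q}"
        then obtain b where "b < Suc q" "x = t b" by auto
        then show False using x tj[of b] by (cases "b = q") (auto simp: j_def)
      qed
      then have "x \<in> r ` {..<k}" using x unfolding Suc.prems(4) by auto
      then show "x \<in> r ` {a \<in> {..<k}. j < r a}" using x by auto
    qed (use rj in \<open>auto simp: less_Suc_eq_le\<close>)
    finally show ?thesis using j by simp
  qed
  have "fdet (k + Suc q) ?Y = (\<Sum>i\<le>k + q. (-1) ^ (i + (k + q)) * ?Y i (k + q) *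
      fdet (k + q) (\<lambda>a b. ?Y (skip i a) (skip (k + q) b)))"
    unfolding add_Suc_right by (rule fdet_expand_col) simp
  also have "\<dots> = (\<Sum>i\<le>k + q. if i = j then (-1) ^ (j + (k + q)) *
      fdet (k + q) (\<lambda>a b. ?Y (skip j a) (skip (k + q) b)) else 0)"
    by (intro sum.cong refl) (auto simp flip: j_def)
  also have "\<dots> = (-1) ^ (j + (k + q)) * fdet (k + q) (\<lambda>a b. ?Y (skip j a) (skip (k + q) b))"
    using j by simp
  also have "fdet (k + q) (\<lambda>a b. ?Y (skip j a) (skip (k + q) b)) =
      fdet (k + q) (\<lambda>a b. if b < k then X (skip j a) b else if a = t (b - k) then 1 else 0)"
    by (rule fdet_cong) (auto simp: t_skip)
  also have "\<dots> = (-1) ^ ((\<Sum>a<k. r' a) + (\<Sum>a<k. a)) * fdet k (\<lambda>a b. X (skip j (r' a)) b)"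
  proof (rule Suc.IH[of r' "\<lambda>a. X (skip j a)"])
    show "incr q t" using incr_mono[OF Suc.prems(2)] by simp
    show "t ` {..<q} \<subseteq> {..<k + q}" using j by (auto intro: less_le_trans[OF tj])
  qed (fact r'_incr r'_range)+
  also have "fdet k (\<lambda>a b. X (skip j (r' a)) b) = fdet k (\<lambda>a b. X (r a) b)"
    by (rule fdet_cong) (simp add: skip_r')
  also have "(-1) ^ (j + (k + q)) * ((-1) ^ ((\<Sum>a<k. r' a) + (\<Sum>a<k. a)) * fdet k (\<lambda>a b. X (r a) b)) =
      (-1) ^ ((\<Sum>a<k. r a) + (\<Sum>a<k. a)) * fdet k (\<lambda>a b. X (r a) b)"
  proof -
    have "(\<Sum>a<k. r a) + (\<Sum>a<k. a) + 2 * j = j + (k + q) + ((\<Sum>a<k. r' a) + (\<Sum>a<k. a))"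
      using sum_r j by simp
    then have "(-1 :: 'a) ^ ((\<Sum>a<k. r a) + (\<Sum>a<k. a) + 2 * j) =
        (-1) ^ (j + (k + q) + ((\<Sum>a<k. r' a) + (\<Sum>a<k. a)))" by (rule arg_cong)
    then show ?thesis by (simp add: power_add power_mult mult.assoc)
  qed
  finally show ?case .
qed

text \<open>
  Multiply \<open>A\<close> by the matrix consisting of the first \<open>k\<close> columns of \<open>B\<close> and the unit vectors at the
  positions \<open>t\<close>.
\<close>

lemma Jacobi_left_minor:
  fixes A B :: "nat \<Rightarrow> nat \<Rightarrow> 'a::comm_ring_1"
  assumes inv: "\<And>i j. i < k + p \<Longrightarrow> j < k + p \<Longrightarrow> (\<Sum>s<k + p. A i s * B s j) = (if i = j then 1 else 0)"
    and rt: "incr k r" "incr p t" "t ` {..<p} \<subseteq> {..<k + p}" "r ` {..<k} = {..<k + p} - t ` {..<p}"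
  shows "fdet (k + p) A * ((-1) ^ ((\<Sum>a<k. r a) + (\<Sum>a<k. a)) * fdet k (\<lambda>a b. B (r a) b)) =
    fdet p (\<lambda>a b. A (k + a) (t b))"
proof -
  let ?Y = "\<lambda>a b. if b < k then B a b else if a = t (b - k) then 1 else 0"
  have "fdet (k + p) A * ((-1) ^ ((\<Sum>a<k. r a) + (\<Sum>a<k. a)) * fdet k (\<lambda>a b. B (r a) b)) =
      fdet (k + p) A * fdet (k + p) ?Y"
    by (subst fdet_append_unit_columns[OF rt]) simp
  also have "\<dots> = fdet (k + p) (\<lambda>i j. \<Sum>s<k + p. A i s * ?Y s j)"
    by (rule fdet_mult[symmetric])
  also have "\<dots> = fdet (k + p) (\<lambda>i j. if j < k then if i = j then 1 else 0 else A i (t (j - k)))"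
  proof (rule fdet_cong)
    fix i j assume ij: "i < k + p" "j < k + p"
    show "(\<Sum>s<k + p. A i s * ?Y s j) = (if j < k then if i = j then 1 else 0 else A i (t (j - k)))"
    proof (cases "j < k")
      case True
      then show ?thesis using inv[OF ij] by simp
    next
      case False
      then have "j - k \<in> {..<p}" using ij by auto
      then have "t (j - k) < k + p" using rt(3) by blast
      then show ?thesis using False by (simp add: if_distrib[of "(*) _"] cong: if_cong)
    qed
  qed
  also have "\<dots> = fdet (k + p) (\<lambda>j i. if j < k then if i = j then 1 else 0 else A i (t (j - k)))"
    by (rule fdet_transpose)
  also have "\<dots> = fdet p (\<lambda>b a. A (k + a) (t b))"
    by (subst fdet_lower_block) auto
  also have "\<dots> = fdet p (\<lambda>a b. A (k + a) (t b))"
    by (rule fdet_transpose)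
  finally show ?thesis .
qed

text \<open>Downward induction: if a left-justified minor of order \<open>Suc k\<close> is nonzero,
  so is some term of its expansion along the last column, and the cofactor there is a left-justified
  minor of order \<open>k\<close>. This supplies the strictly positive summand in later uses of
  Cauchy--Binet.\<close>

lemma exists_left_minor_nonzero:
  fixes M :: "nat \<Rightarrow> nat \<Rightarrow> complex"
  assumes "fdet n M \<noteq> 0" "k \<le> n"
  shows "\<exists>r. incr k r \<and> r ` {..<k} \<subseteq> {..<n} \<and> fdet k (\<lambda>a b. M (r a) b) \<noteq> 0"
  using assms(2)
proof (induction rule: inc_induct)
  case base
  then show ?case using assms(1) by (intro exI[of _ "\<lambda>a. a"]) (auto simp: strict_mono_on_def)
next
  case (step k)
  then obtain r where r: "incr (Suc k) r" "r ` {..<Suc k} \<subseteq> {..<n}" "fdet (Suc k) (\<lambda>a b. M (r a) b) \<noteq> 0"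
    by blast
  then have "(\<Sum>i\<le>k. (-1) ^ (i + k) * M (r i) k * fdet k (\<lambda>a b. M (r (skip i a)) (skip k b))) \<noteq> 0"
    by (subst (asm) fdet_expand_col[of k]) simp_all
  then obtain i where i: "i \<le> k" "fdet k (\<lambda>a b. M (r (skip i a)) (skip k b)) \<noteq> 0"
    by (auto elim!: sum.not_neutral_contains_not_neutral)
  have "fdet k (\<lambda>a b. M (r (skip i a)) (skip k b)) = fdet k (\<lambda>a b. M (r (skip i a)) b)"
    by (rule fdet_cong) simp
  then show ?case
    using r i incr_comp_skip[OF r(1), of i]
    by (intro exI[of _ "\<lambda>a. r (skip i a)"]) (auto simp: insert_index_def image_subset_iff)
qed

lemma sorted_list_nth_incr_image:
  assumes "S \<subseteq> {..<n::nat}" "card S = k"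
  shows "incr k ((!) (sorted_list_of_set S))" "(!) (sorted_list_of_set S) ` {..<k} = S"
  using incr_sorted_list_nth[of S] sorted_list_nth_bij[of S] assms finite_subset[OF assms(1)]
  by (auto simp: bij_betw_def)

section \<open>QR factorisation by Gram determinants\<close>

definition gram :: "nat \<Rightarrow> (nat \<Rightarrow> nat \<Rightarrow> complex) \<Rightarrow> nat \<Rightarrow> nat \<Rightarrow> complex" where
  "gram n M i j = (\<Sum>s<n. cnj (M s i) * M s j)"

lemma fdet_cnj: "fdet k (\<lambda>i j. cnj (F i j)) = cnj (fdet k F)"
  by (simp add: fdet_def)

text \<open>By Cauchy--Binet a leading Gram minor is the sum of the squared moduli of the
  left-justified minors of \<open>M\<close> of that order, not all of which vanish.\<close>

lemma gram_leading_cpos: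
  assumes "fdet n M \<noteq> 0" "k \<le> n"
  shows "cpos (fdet k (gram n M))"
proof -
  obtain r where r: "incr k r" "r ` {..<k} \<subseteq> {..<n}" "fdet k (\<lambda>a b. M (r a) b) \<noteq> 0"
    using exists_left_minor_nonzero[OF assms] by blast
  let ?m = "\<lambda>S. fdet k (\<lambda>a b. M (sorted_list_of_set S ! a) b)"
  let ?t = "\<lambda>S. fdet k (\<lambda>a b. cnj (M (sorted_list_of_set S ! b) a)) * ?m S"
  have t: "?t S = of_real ((cmod (?m S))\<^sup>2)" for S
  proof -
    have "fdet k (\<lambda>a b. cnj (M (sorted_list_of_set S ! b) a)) = fdet k (\<lambda>a b. cnj (M (sorted_list_of_set S ! a) b))"
      by (rule fdet_transpose)
    then show ?thesis by (simp only: fdet_cnj complex_norm_square mult.commute)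
  qed
  have "fdet k (gram n M) = (\<Sum>S | S \<subseteq> {..<n} \<and> card S = k. ?t S)"
    unfolding gram_def by (rule Cauchy_Binet) simp
  also have "cpos \<dots>"
  proof (rule cpos_sum)
    show "finite {S. S \<subseteq> {..<n} \<and> card S = k}"
      by (rule finite_subset[of _ "Pow {..<n}"]) auto
    show "r ` {..<k} \<in> {S. S \<subseteq> {..<n} \<and> card S = k}"
      using r by (auto simp: card_image strict_mono_on_imp_inj_on)
    have "?m (r ` {..<k}) = fdet k (\<lambda>a b. M (r a) b)"
      using r by (intro fdet_cong) (simp add: sorted_list_of_incr_image)
    then show "cpos (?t (r ` {..<k}))" unfolding t cpos_of_real using r by simp
    show "?t S \<in> \<real>\<^sub>\<ge>\<^sub>0" for S unfolding t nonneg_Reals_of_real_iff by simp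
  qed
  finally show ?thesis .
qed

text \<open>Let \<open>u = lu_factor (gram n M)\<close>. The Gram matrix times \<open>u\<close> is
  lower triangular, and so is its product with the adjoint of \<open>u\<close> from the left. The
  latter product is Hermitian, hence diagonal with entries \<open>u j j\<close>. So the columns of
  \<open>M u\<close> are orthogonal with squared lengths \<open>u j j\<close>, and the square roots
  normalise them.\<close>

definition qr_factor :: "nat \<Rightarrow> (nat \<Rightarrow> nat \<Rightarrow> complex) \<Rightarrow> nat \<Rightarrow> nat \<Rightarrow> complex" where
  "qr_factor n M b j =
     lu_factor (gram n M) b j / of_real (sqrt (Re (lu_factor (gram n M) j j)))"

definition qr_unitary :: "nat \<Rightarrow> (nat \<Rightarrow> nat \<Rightarrow> complex) \<Rightarrow> nat \<Rightarrow> nat \<Rightarrow> complex" where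
  "qr_unitary n M i j = (\<Sum>b<n. M i b * qr_factor n M b j)"

lemma qr_factor_upper: "j < b \<Longrightarrow> qr_factor n M b j = 0"
  by (simp add: qr_factor_def lu_factor_upper)

context
  fixes n :: nat and M :: "nat \<Rightarrow> nat \<Rightarrow> complex"
  assumes M: "fdet n M \<noteq> 0"
begin

lemma lu_gram_diag_cpos: "j < n \<Longrightarrow> cpos (lu_factor (gram n M) j j)"
  unfolding lu_factor_diag using M by (intro cpos_divide gram_leading_cpos) auto

lemma qr_factor_diag_cpos: "j < n \<Longrightarrow> cpos (qr_factor n M j j)"
  unfolding qr_factor_def
  using lu_gram_diag_cpos[of j] by (intro cpos_divide) (auto simp: cpos_iff)

lemma unitary_qr: "unitary_fun n (qr_unitary n M)"
proof -
  define u where "u = lu_factor (gram n M)"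
  define d where "d = (\<lambda>j. complex_of_real (sqrt (Re (u j j))))"
  let ?Q = "qr_unitary n M"
  have Q: "?Q i j = (\<Sum>b<n. M i b * u b j) / d j" for i j
    by (simp add: qr_unitary_def qr_factor_def u_def d_def sum_divide_distrib)
  have G: "(\<Sum>s<n. cnj (?Q s i) * ?Q s j) =
      (\<Sum>b<n. cnj (u b i) * (\<Sum>b'<n. gram n M b b' * u b' j)) / (d i * d j)" for i j
  proof -
    have "cnj (?Q s i) * ?Q s j =
        (\<Sum>b<n. \<Sum>b'<n. cnj (u b i) * (cnj (M s b) * M s b' * u b' j)) / (d i * d j)" for s
    proof -
      have "cnj (?Q s i) * ?Q s j =
          ((\<Sum>b<n. cnj (M s b) * cnj (u b i)) * (\<Sum>b'<n. M s b' * u b' j)) / (d i * d j)"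
        by (simp add: Q d_def)
      also have "(\<Sum>b<n. cnj (M s b) * cnj (u b i)) * (\<Sum>b'<n. M s b' * u b' j) =
          (\<Sum>b<n. \<Sum>b'<n. cnj (u b i) * (cnj (M s b) * M s b' * u b' j))"
        unfolding sum_product by (intro sum.cong refl) (simp add: ac_simps)
      finally show ?thesis .
    qed
    then have "(\<Sum>s<n. cnj (?Q s i) * ?Q s j) =
        (\<Sum>s<n. \<Sum>b<n. \<Sum>b'<n. cnj (u b i) * (cnj (M s b) * M s b' * u b' j)) / (d i * d j)"
      by (simp only: sum_divide_distrib)
    also have "(\<Sum>s<n. \<Sum>b<n. \<Sum>b'<n. cnj (u b i) * (cnj (M s b) * M s b' * u b' j)) =
        (\<Sum>b<n. \<Sum>b'<n. \<Sum>s<n. cnj (u b i) * (cnj (M s b) * M s b' * u b' j))"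
      by (subst sum.swap) (rule sum.cong[OF refl], rule sum.swap)
    also have "\<dots> = (\<Sum>b<n. cnj (u b i) * (\<Sum>b'<n. gram n M b b' * u b' j))"
      by (simp add: gram_def sum_distrib_left sum_distrib_right)
    finally show ?thesis .
  qed
  \<comment> \<open>For \<open>i \<le> j\<close> a summand survives only if
    \<open>b = i = j\<close>: the Gram matrix times \<open>u\<close> vanishes for
    \<open>b < j\<close>, and \<open>u b i\<close> vanishes for \<open>i < b\<close>. The other half
    follows by conjugation.\<close>
  have upper: "(\<Sum>s<n. cnj (?Q s i) * ?Q s j) = (if i = j then 1 else 0)" if "i \<le> j" "j < n" for i j
  proof -
    have "(\<Sum>b<n. cnj (u b i) * (\<Sum>b'<n. gram n M b b' * u b' j)) =
        (\<Sum>b<n. if b = j then if i = j then u j j else 0 else 0)"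
    proof (rule sum.cong[OF refl])
      fix b assume "b \<in> {..<n}"
      consider "b < j" | "b = j" "i = j" | "i < b" "j \<le> b" using \<open>i \<le> j\<close> by linarith
      then show "cnj (u b i) * (\<Sum>b'<n. gram n M b b' * u b' j) = (if b = j then if i = j then u j j else 0 else 0)"
      proof cases
        case 1
        then show ?thesis using that by (simp add: u_def sum_lu_factor_lower)
      next
        case 2
        then show ?thesis
          using that gram_leading_cpos[OF M, of "Suc j"] lu_gram_diag_cpos[of j]
          by (simp add: u_def sum_lu_factor_diag cpos_def cpos_cnj)
      next
        case 3
        then show ?thesis using that by (auto simp: u_def lu_factor_upper)
      qed
    qed
    also have "\<dots> = (if i = j then u j j else 0)" using that by simp
    also have "\<dots> / (d i * d j) = (if i = j then 1 else 0)"
      using lu_gram_diag_cpos[of j] that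
      by (auto simp: d_def u_def cpos_iff complex_eq_iff simp flip: of_real_mult)
    finally show ?thesis unfolding G .
  qed
  show ?thesis unfolding unitary_fun_def
  proof (intro allI impI)
    fix i j assume ij: "i < n" "j < n"
    show "(\<Sum>s<n. cnj (?Q s i) * ?Q s j) = (if i = j then 1 else 0)"
    proof (cases "i \<le> j")
      case True
      then show ?thesis using upper ij by simp
    next
      case False
      have "(\<Sum>s<n. cnj (?Q s i) * ?Q s j) = cnj (\<Sum>s<n. cnj (?Q s j) * ?Q s i)"
        by (simp add: mult.commute)
      also have "\<dots> = 0" using upper[of j i] False ij by simp
      finally show ?thesis using False by simp
    qed
  qed
qed

lemma qr_left_minor:
  assumes "k \<le> n"
  shows "fdet k (\<lambda>a b. qr_unitary n M (r a) b) = fdet k (\<lambda>a b. M (r a) b) * (\<Prod>j<k. qr_factor n M j j)"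
  unfolding qr_unitary_def using assms by (intro fdet_mult_upper) (auto simp: qr_factor_upper)

lemma qr_factor_prod_cpos: "k \<le> n \<Longrightarrow> cpos (\<Prod>j<k. qr_factor n M j j)"
  by (intro cpos_prod qr_factor_diag_cpos) auto

end

text \<open>The Gram matrix of \<open>G\<close> is the identity, hence so is the factor. This
  identifies the limit of the perturbed matrices as well as the initial value of the flow.\<close>

lemma qr_unitary_id:
  assumes G: "unitary_fun n G" and "j < n"
  shows "qr_unitary n G i j = G i j"
proof -
  have g: "gram n G i j = (if i = j then 1 else 0)" if "i < n" "j < n" for i j
    using assms that by (auto simp: gram_def unitary_fun_def)
  have det1: "fdet k (gram n G) = 1" if "k \<le> n" for k
    using that by (subst fdet_upper) (auto simp: g)
  have lu: "lu_factor (gram n G) b j = (if b = j then 1 else 0)" if "b < n" for b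
  proof -
    consider "b < j" | "b = j" | "j < b" by linarith
    then show ?thesis
    proof cases
      case 1
      have "fdet j (\<lambda>a b'. gram n G a (skip b b')) = 0"
        by (rule fdet_zero_row[of b]) (use 1 assms in \<open>auto simp: g insert_index_def\<close>)
      then show ?thesis using 1 by (simp add: lu_factor_def)
    qed (use assms in \<open>auto simp: lu_factor_diag lu_factor_upper det1\<close>)
  qed
  have "qr_unitary n G i j = (\<Sum>b<n. if b = j then G i b else 0)"
    unfolding qr_unitary_def using assms by (intro sum.cong refl) (auto simp: qr_factor_def lu)
  then show ?thesis using assms by simp
qed

lemma unitary_fun_fdet_nonzero:
  assumes "unitary_fun n G"
  shows "fdet n G \<noteq> 0"
proof -
  have "fdet n (\<lambda>i s. cnj (G s i)) * fdet n G = fdet n (\<lambda>i j. if i = j then 1 else 0)"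
    unfolding fdet_mult[symmetric] using assms by (intro fdet_cong) (auto simp: unitary_fun_def)
  also have "\<dots> = 1" by (subst fdet_upper) auto
  finally show ?thesis by auto
qed

lemma differentiable_fdet:
  fixes F :: "real \<Rightarrow> nat \<Rightarrow> nat \<Rightarrow> complex"
  assumes "\<And>i j. i < k \<Longrightarrow> j < k \<Longrightarrow> (\<lambda>x. F x i j) differentiable at t"
  shows "(\<lambda>x. fdet k (F x)) differentiable at t"
  unfolding fdet_def
proof (intro differentiable_sum finite_permutations finite_lessThan ballI differentiable_mult differentiable_const)
  fix p assume "p \<in> {p. p permutes {..<k}}"
  then have "(\<lambda>x. F x i (p i)) differentiable at t" if "i < k" for i
    using permutes_in_image[of p "{..<k}" i] that by (intro assms) auto
  then have "\<forall>i\<in>{..<k}. \<exists>D. ((\<lambda>x. F x i (p i)) has_derivative D) (at t)"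
    unfolding differentiable_def by auto
  then obtain D where D: "\<forall>i\<in>{..<k}. ((\<lambda>x. F x i (p i)) has_derivative D i) (at t)"
    using bchoice by metis
  have "((\<lambda>x. \<Prod>i<k. F x i (p i)) has_derivative
      (\<lambda>y. \<Sum>i<k. D i y * (\<Prod>j\<in>{..<k} - {i}. F t j (p j)))) (at t)"
    by (rule has_derivative_prod) (use D in auto)
  then show "(\<lambda>x. \<Prod>i<k. F x i (p i)) differentiable at t"
    unfolding differentiable_def by blast
qed

lemma differentiable_bounded_linear:
  assumes "bounded_linear h" "f differentiable F"
  shows "(\<lambda>x. h (f x)) differentiable F"
  using assms bounded_linear.has_derivative unfolding differentiable_def by blast

text \<open>The formula is rational in the entries and their conjugates, apart from a square root.
  The denominators are leading Gram minors and the argument of the root is positive, so nothing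
  degenerates where \<open>M t\<close> is invertible.\<close>

lemma differentiable_qr_unitary:
  fixes M :: "real \<Rightarrow> nat \<Rightarrow> nat \<Rightarrow> complex"
  assumes diff: "\<And>i j. i < n \<Longrightarrow> j < n \<Longrightarrow> (\<lambda>x. M x i j) differentiable at t"
    and M: "fdet n (M t) \<noteq> 0" and ij: "i < n" "j < n"
  shows "(\<lambda>x. qr_unitary n (M x) i j) differentiable at t"
proof -
  note bl = differentiable_bounded_linear[OF bounded_linear_cnj]
    differentiable_bounded_linear[OF bounded_linear_Re]
    differentiable_bounded_linear[OF bounded_linear_of_real]
  have g: "(\<lambda>x. gram n (M x) i j) differentiable at t" if "i < n" "j < n" for i j
    unfolding gram_def using that by (intro differentiable_sum ballI finite_lessThan differentiable_mult bl diff) auto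
  have lu: "(\<lambda>x. lu_factor (gram n (M x)) b j) differentiable at t" if "j < n" for b j
  proof (cases "b \<le> j")
    case True
    have "fdet (Suc j) (gram n (M t)) \<noteq> 0" using gram_leading_cpos[OF M, of "Suc j"] that by (simp add: cpos_def)
    moreover have "(\<lambda>x. fdet j (\<lambda>a b'. gram n (M x) a (skip b b'))) differentiable at t"
      using that by (intro differentiable_fdet g) (auto simp: insert_index_def)
    moreover have "(\<lambda>x. fdet (Suc j) (gram n (M x))) differentiable at t"
      using that by (intro differentiable_fdet g) auto
    ultimately show ?thesis using True by (simp add: lu_factor_def)
  qed (simp add: lu_factor_def)
  have pos: "0 < Re (lu_factor (gram n (M t)) j j)"
    using lu_gram_diag_cpos[OF M, of j] ij by (simp add: cpos_iff)
  have "sqrt differentiable at (Re (lu_factor (gram n (M t)) j j))"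
    using DERIV_real_sqrt[OF pos] by (auto simp: has_field_derivative_def differentiable_def)
  then have sq: "(\<lambda>x. sqrt (Re (lu_factor (gram n (M x)) j j))) differentiable at t"
    using differentiable_chain_at[OF bl(2)[OF lu[of j j]], of sqrt] ij by (simp add: o_def)
  have "(\<lambda>x. qr_factor n (M x) b j) differentiable at t" for b
    unfolding qr_factor_def using pos lu ij sq by (intro differentiable_divide bl) auto
  then show ?thesis
    unfolding qr_unitary_def using ij diff by (intro differentiable_sum ballI finite_lessThan differentiable_mult) auto
qed

section \<open>The signed adjoint of a unitary array with nonnegative left-justified minors\<close>

definition left_minors_nonneg :: "nat \<Rightarrow> (nat \<Rightarrow> nat \<Rightarrow> complex) \<Rightarrow> bool" where
  "left_minors_nonneg n A \<longleftrightarrow>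
     (\<forall>k r. k \<le> n \<longrightarrow> incr k r \<longrightarrow> r ` {..<k} \<subseteq> {..<n} \<longrightarrow> fdet k (\<lambda>a b. A (r a) b) \<in> \<real>\<^sub>\<ge>\<^sub>0)"

lemma left_minors_nonnegD:
  "left_minors_nonneg n A \<Longrightarrow> k \<le> n \<Longrightarrow> incr k r \<Longrightarrow> r ` {..<k} \<subseteq> {..<n} \<Longrightarrow>
    fdet k (\<lambda>a b. A (r a) b) \<in> \<real>\<^sub>\<ge>\<^sub>0"
  by (auto simp: left_minors_nonneg_def)

lemma gauss_kernel_left_minors_pos:
  assumes q: "0 < q" "q < 1" and G: "left_minors_nonneg n G" "fdet n G \<noteq> 0"
  shows "left_minors_pos n (\<lambda>i j. \<Sum>s<n. gauss_kernel q i s * G s j)"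
  unfolding left_minors_pos_def
proof (intro allI impI)
  fix k and r :: "nat \<Rightarrow> nat" assume k: "k \<le> n" and r: "incr k r" "r ` {..<k} \<subseteq> {..<n}"
  let ?t = "\<lambda>S. fdet k (\<lambda>a b. gauss_kernel q (r a) (sorted_list_of_set S ! b)) *
     fdet k (\<lambda>a b. G (sorted_list_of_set S ! a) b)"
  obtain r0 where r0: "incr k r0" "r0 ` {..<k} \<subseteq> {..<n}" "fdet k (\<lambda>a b. G (r0 a) b) \<noteq> 0"
    using exists_left_minor_nonzero[OF G(2) k] by blast
  have K: "cpos (fdet k (\<lambda>a b. gauss_kernel q (r a) (sorted_list_of_set S ! b)))"
    and m: "fdet k (\<lambda>a b. G (sorted_list_of_set S ! a) b) \<in> \<real>\<^sub>\<ge>\<^sub>0"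
    if "S \<in> {S. S \<subseteq> {..<n} \<and> card S = k}" for S
  proof -
    have s: "incr k ((!) (sorted_list_of_set S))" "(!) (sorted_list_of_set S) ` {..<k} = S"
      by (rule sorted_list_nth_incr_image[of S n k]; use that in simp)+
    show "cpos (fdet k (\<lambda>a b. gauss_kernel q (r a) (sorted_list_of_set S ! b)))"
      by (rule gauss_kernel_cpos_minors[OF q r(1) s(1)])
    show "fdet k (\<lambda>a b. G (sorted_list_of_set S ! a) b) \<in> \<real>\<^sub>\<ge>\<^sub>0"
      by (rule left_minors_nonnegD[OF G(1) k s(1)]) (use s that in simp)
  qed
  have "fdet k (\<lambda>a b. \<Sum>s<n. gauss_kernel q (r a) s * G s b) = (\<Sum>S | S \<subseteq> {..<n} \<and> card S = k. ?t S)"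
    by (rule Cauchy_Binet) simp
  also have "cpos \<dots>"
  proof (rule cpos_sum)
    show "finite {S. S \<subseteq> {..<n} \<and> card S = k}"
      by (rule finite_subset[of _ "Pow {..<n}"]) auto
    show S0: "r0 ` {..<k} \<in> {S. S \<subseteq> {..<n} \<and> card S = k}"
      using r0 by (auto simp: card_image strict_mono_on_imp_inj_on)
    have "fdet k (\<lambda>a b. G (sorted_list_of_set (r0 ` {..<k}) ! a) b) = fdet k (\<lambda>a b. G (r0 a) b)"
      using r0 by (intro fdet_cong) (simp add: sorted_list_of_incr_image)
    then show "cpos (?t (r0 ` {..<k}))"
      using K[OF S0] m[OF S0] r0(3) by (simp add: cpos_def)
    show "?t S \<in> \<real>\<^sub>\<ge>\<^sub>0" if "S \<in> {S. S \<subseteq> {..<n} \<and> card S = k}" for S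
      using K[OF that] m[OF that] by (simp add: cpos_def)
  qed
  finally show "cpos (fdet k (\<lambda>a b. \<Sum>s<n. gauss_kernel q (r a) s * G s b))" .
qed

text \<open>The strict version applies to the QR factor of the kernel times \<open>G\<close>, whose
  left-justified minors are positive multiples of those of the product. As \<open>q\<close> tends to
  \<open>0\<close> this factor tends to \<open>G\<close>.\<close>

theorem unitary_bottom_minors_nonneg':
  assumes unit: "unitary_fun n G" and left: "left_minors_nonneg n G"
    and c: "incr p c" "c ` {..<p} \<subseteq> {..<n}"
  shows "fdet p (\<lambda>a b. G (n - p + a) (c b)) \<in> \<real>\<^sub>\<ge>\<^sub>0"
proof -
  define M where "M = (\<lambda>q i j. \<Sum>s<n. gauss_kernel q i s * G s j)"
  have det: "fdet n G \<noteq> 0" using unit by (rule unitary_fun_fdet_nonzero)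
  have p: "p \<le> n" using incr_index_less[OF c] .
  have "fdet p (\<lambda>a b. qr_unitary n (M q) (n - p + a) (c b)) \<in> \<real>\<^sub>\<ge>\<^sub>0" if q: "0 < q" "q < 1" for q
  proof (rule unitary_bottom_minors_nonneg[OF _ _ c])
    have lp: "left_minors_pos n (M q)"
      unfolding M_def by (rule gauss_kernel_left_minors_pos[OF q left det])
    then have "fdet n (M q) \<noteq> 0"
      using left_minors_posD[of n "M q" n "\<lambda>a. a"] by (auto simp: strict_mono_on_def cpos_def)
    then show "unitary_fun n (qr_unitary n (M q))" "left_minors_pos n (qr_unitary n (M q))"
      using lp by (auto simp: unitary_qr left_minors_pos_def qr_left_minor qr_factor_prod_cpos intro!: cpos_mult)
  qed
  then have "eventually (\<lambda>q. fdet p (\<lambda>a b. qr_unitary n (M q) (n - p + a) (c b)) \<in> \<real>\<^sub>\<ge>\<^sub>0) (at_right 0)"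
    unfolding eventually_at_right_field by (intro exI[of _ 1]) auto
  moreover have "((\<lambda>q. fdet p (\<lambda>a b. qr_unitary n (M q) (n - p + a) (c b))) \<longlongrightarrow> fdet p (\<lambda>a b. G (n - p + a) (c b))) (at_right 0)"
  proof (rule tendsto_fdet)
    fix a b assume ab: "a < p" "b < p"
    \<comment> \<open>Because \<open>0 ^ 0 = 1\<close>, the kernel at \<open>q = 0\<close> is
      exactly the identity. It is polynomial in \<open>q\<close>, so the limit is the value at
      \<open>0\<close>.\<close>
    have gk0: "gauss_kernel 0 i j = (if i = j then 1 else 0)" for i j
    proof -
      have "(i - j)\<^sup>2 + (j - i)\<^sup>2 = 0 \<longleftrightarrow> i = j" by auto
      then show ?thesis by (simp add: gauss_kernel_def power_0_left)
    qed
    have M0: "M 0 i j = G i j" if "i < n" for i j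
      using that by (simp add: M_def gk0 if_distrib[of "\<lambda>x. x * _"] cong: if_cong)
    have "(\<lambda>q. qr_unitary n (M q) (n - p + a) (c b)) differentiable at 0"
    proof (rule differentiable_qr_unitary)
      show "(\<lambda>q. M q i j) differentiable at 0" for i j
        unfolding M_def gauss_kernel_def
        by (intro differentiable_sum ballI finite_lessThan differentiable_mult
            differentiable_bounded_linear[OF bounded_linear_of_real] differentiable_power) auto
      show "fdet n (M 0) \<noteq> 0" using det fdet_cong[of n "M 0" G] by (simp add: M0)
    qed (use ab c p in auto)
    then have "isCont (\<lambda>q. qr_unitary n (M q) (n - p + a) (c b)) 0"
      by (rule differentiable_imp_continuous_within)
    then have "((\<lambda>q. qr_unitary n (M q) (n - p + a) (c b)) \<longlongrightarrow> qr_unitary n (M 0) (n - p + a) (c b)) (at_right 0)"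
      unfolding isCont_def by (rule tendsto_within_subset) simp
    moreover have "qr_unitary n (M 0) (n - p + a) (c b) = G (n - p + a) (c b)"
    proof -
      have "unitary_fun n (M 0)" using unit by (simp add: unitary_fun_def M0)
      then have "qr_unitary n (M 0) (n - p + a) (c b) = M 0 (n - p + a) (c b)"
        using ab c by (intro qr_unitary_id) auto
      then show ?thesis using ab p by (simp add: M0)
    qed
    ultimately show "((\<lambda>q. qr_unitary n (M q) (n - p + a) (c b)) \<longlongrightarrow> G (n - p + a) (c b)) (at_right 0)"
      by simp
  qed
  ultimately show ?thesis
    by (intro Lim_in_closed_set[of "\<real>\<^sub>\<ge>\<^sub>0"]) auto
qed

lemma nonneg_Reals_cancel:
  assumes "cpos w" "w * z \<in> \<real>\<^sub>\<ge>\<^sub>0"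
  shows "z \<in> \<real>\<^sub>\<ge>\<^sub>0"
  using nonneg_Reals_divide_I[OF assms(2) cposD(1)[OF assms(1)]] cposD(2)[OF assms(1)] by simp

text \<open>Jacobi's identity is applied to \<open>G\<close> and its adjoint. The signs of the
  signed adjoint multiply to exactly the sign in that identity. The remaining factor
  \<open>fdet n G\<close> is positive: it is a left-justified minor of full order, and it is nonzero
  by unitarity.\<close>

theorem left_minors_nonneg_twist:
  assumes unit: "unitary_fun n G" and left: "left_minors_nonneg n G"
  shows "left_minors_nonneg n (\<lambda>i j. (-1) ^ i * ((-1) ^ j * cnj (G j i)))"
  unfolding left_minors_nonneg_def
proof (intro allI impI)
  fix k and r :: "nat \<Rightarrow> nat" assume k: "k \<le> n" and r: "incr k r" "r ` {..<k} \<subseteq> {..<n}"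
  define p where "p = n - k"
  have n: "n = k + p" using k by (simp add: p_def)
  define T where "T = {..<n} - r ` {..<k}"
  define t where "t = (!) (sorted_list_of_set T)"
  have "card (r ` {..<k}) = k" using r by (simp add: card_image strict_mono_on_imp_inj_on)
  then have "T \<subseteq> {..<n}" "card T = p"
    using r by (auto simp: T_def p_def card_Diff_subset)
  note t = sorted_list_nth_incr_image[OF this, folded t_def]
  let ?s = "(-1) ^ ((\<Sum>a<k. r a) + (\<Sum>a<k. a)) :: complex"
  let ?B = "fdet k (\<lambda>a b. cnj (G b (r a)))"
  have "fdet k (\<lambda>i j. (-1) ^ r i * ((-1) ^ j * cnj (G j (r i)))) = ?s * ?B"
    by (simp only: fdet_scale_rows fdet_scale_cols power_add power_sum mult.assoc)
  moreover have "fdet (k + p) G * (?s * ?B) = fdet p (\<lambda>a b. G (k + a) (t b))"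
  proof (rule Jacobi_left_minor)
    show "(\<Sum>s<k + p. G i s * cnj (G j s)) = (if i = j then 1 else 0)" if "i < k + p" "j < k + p" for i j
      using unitary_fun_right[OF unit, of i j] that unfolding n by simp
    show "t ` {..<p} \<subseteq> {..<k + p}" "r ` {..<k} = {..<k + p} - t ` {..<p}"
      using r(2) unfolding t(2) T_def n by auto
  qed (fact r t)+
  moreover have "fdet p (\<lambda>a b. G (k + a) (t b)) \<in> \<real>\<^sub>\<ge>\<^sub>0"
    using unitary_bottom_minors_nonneg'[OF unit left t(1)] t(2) n by (auto simp: T_def)
  moreover have "cpos (fdet n G)"
    using left_minors_nonnegD[OF left, of n "\<lambda>a. a"] unitary_fun_fdet_nonzero[OF unit]
    by (auto simp: cpos_def strict_mono_on_def)
  ultimately show "fdet k (\<lambda>a b. (-1) ^ r a * ((-1) ^ b * cnj (G b (r a)))) \<in> \<real>\<^sub>\<ge>\<^sub>0"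
    using nonneg_Reals_cancel[of "fdet n G" "?s * ?B"] n by simp
qed

section \<open>The Kaehler metric on a regular orbit\<close>

lemma matrix_mult_nth: "(A ** B) $ i $ j = (\<Sum>k\<in>UNIV. A $ i $ k * B $ k $ j)"
  by (simp add: matrix_matrix_mult_def)

lemma cadjoint_nth [simp]: "cadjoint A $ i $ j = cnj (A $ j $ i)"
  by (simp add: cadjoint_def)

lemma Diag_nth [simp]: "Diag v $ i $ j = (if i = j then of_real (v $ i) else 0)"
  by (simp add: Diag_def)

lemma cscale_nth [simp]: "(c \<odot> A) $ i $ j = c * A $ i $ j"
  by (simp add: cscale_def)

lemma cadjoint_cadjoint [simp]: "cadjoint (cadjoint A) = A"
  by (simp add: vec_eq_iff)

lemma cadjoint_mult: "cadjoint (A ** B) = cadjoint B ** cadjoint A"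
  by (simp add: vec_eq_iff matrix_mult_nth mult.commute)

lemma cadjoint_minus: "cadjoint (- A) = - cadjoint A"
  by (simp add: vec_eq_iff)

lemma cadjoint_Diag [simp]: "cadjoint (Diag v) = Diag v"
  by (simp add: vec_eq_iff)

lemma matrix_mult_minus_left: "(- A :: 'n::finite cmat) ** B = - (A ** B)"
  by (simp add: vec_eq_iff matrix_mult_nth sum_negf)

lemma matrix_mult_minus_right: "(A :: 'n::finite cmat) ** - B = - (A ** B)"
  by (simp add: vec_eq_iff matrix_mult_nth sum_negf)

lemma matrix_mult_diff_left: "(A - B :: 'n::finite cmat) ** C = A ** C - B ** C"
  by (simp add: vec_eq_iff matrix_mult_nth sum_subtractf algebra_simps)

lemma matrix_mult_diff_right: "(A :: 'n::finite cmat) ** (B - C) = A ** B - A ** C"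
  by (simp add: vec_eq_iff matrix_mult_nth sum_subtractf algebra_simps)

lemma matrix_mult_add_left: "(A + B :: 'n::finite cmat) ** C = A ** C + B ** C"
  by (simp add: vec_eq_iff matrix_mult_nth sum.distrib algebra_simps)

lemma matrix_mult_scaleR_left: "(r *\<^sub>R A :: 'n::finite cmat) ** B = r *\<^sub>R (A ** B)"
  by (simp add: vec_eq_iff matrix_mult_nth scaleR_right.sum)

lemma matrix_mult_scaleR_right: "(A :: 'n::finite cmat) ** (r *\<^sub>R B) = r *\<^sub>R (A ** B)"
  by (simp add: vec_eq_iff matrix_mult_nth scaleR_right.sum)

lemma cscale_mult_left: "(c \<odot> A) ** B = c \<odot> (A ** B)"
  by (simp add: vec_eq_iff matrix_mult_nth sum_distrib_left mult.assoc)

lemma cscale_mult_right: "A ** (c \<odot> B) = c \<odot> (A ** B)"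
  by (simp add: vec_eq_iff matrix_mult_nth sum_distrib_left algebra_simps)

lemma Diag_mult_nth: "(Diag v ** A) $ i $ j = of_real (v $ i) * A $ i $ j"
proof -
  have "(\<Sum>k\<in>UNIV. Diag v $ i $ k * A $ k $ j) = (\<Sum>k\<in>UNIV. if k = i then of_real (v $ i) * A $ i $ j else 0)"
    by (intro sum.cong) auto
  then show ?thesis by (simp add: matrix_mult_nth)
qed

lemma mult_Diag_nth: "(A ** Diag v) $ i $ j = A $ i $ j * of_real (v $ j)"
proof -
  have "(\<Sum>k\<in>UNIV. A $ i $ k * Diag v $ k $ j) = (\<Sum>k\<in>UNIV. if k = j then A $ i $ j * of_real (v $ j) else 0)"
    by (intro sum.cong) auto
  then show ?thesis by (simp add: matrix_mult_nth)
qed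

lemma unitary_groupD:
  "g \<in> unitary_group \<Longrightarrow> g ** cadjoint g = mat 1" "g \<in> unitary_group \<Longrightarrow> cadjoint g ** g = mat 1"
  by (simp_all add: unitary_group_def)

lemma cadjoint_unitary: "g \<in> unitary_group \<Longrightarrow> cadjoint g \<in> unitary_group"
  by (simp add: unitary_group_def)

lemma matrix_inv_unitary:
  assumes "g \<in> unitary_group"
  shows "matrix_inv g = cadjoint g"
proof -
  have "\<exists>A. g ** A = mat 1 \<and> A ** g = mat 1" using unitary_groupD[OF assms] by blast
  then have *: "g ** matrix_inv g = mat 1"
    unfolding matrix_inv_def by (rule someI2_ex) simp
  have "matrix_inv g = (cadjoint g ** g) ** matrix_inv g"
    by (simp add: unitary_groupD[OF assms])
  also have "\<dots> = cadjoint g"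
    by (simp add: * flip: matrix_mul_assoc)
  finally show ?thesis .
qed

definition conj_by :: "'n::finite cmat \<Rightarrow> 'n cmat \<Rightarrow> 'n cmat" where
  "conj_by g X = g ** X ** cadjoint g"

lemma conj_by_mult:
  assumes "g \<in> unitary_group"
  shows "conj_by g X ** conj_by g Y = conj_by g (X ** Y)"
proof -
  have "conj_by g X ** conj_by g Y = g ** X ** (cadjoint g ** g) ** Y ** cadjoint g"
    by (simp add: conj_by_def matrix_mul_assoc)
  then show ?thesis by (simp add: unitary_groupD[OF assms] conj_by_def matrix_mul_assoc)
qed

lemma conj_by_diff: "conj_by g (X - Y) = conj_by g X - conj_by g Y"
  by (simp add: conj_by_def matrix_mult_diff_left matrix_mult_diff_right)

lemma conj_by_minus: "conj_by g (- X) = - conj_by g X"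
  by (simp add: conj_by_def matrix_mult_minus_left matrix_mult_minus_right)

lemma linear_conj_by: "linear (conj_by g)"
  by (rule linearI)
    (simp_all add: conj_by_def matrix_add_ldistrib matrix_mult_add_left matrix_mult_scaleR_left matrix_mult_scaleR_right)

lemma cadjoint_conj_by: "cadjoint (conj_by g X) = conj_by g (cadjoint X)"
  by (simp add: conj_by_def cadjoint_mult matrix_mul_assoc)

lemma conj_by_inverse [simp]:
  assumes "g \<in> unitary_group"
  shows "conj_by (cadjoint g) (conj_by g X) = X" "conj_by g (conj_by (cadjoint g) X) = X"
proof -
  have "conj_by (cadjoint g) (conj_by g X) = (cadjoint g ** g) ** X ** (cadjoint g ** g)"
    "conj_by g (conj_by (cadjoint g) X) = (g ** cadjoint g) ** X ** (g ** cadjoint g)"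
    by (simp_all add: conj_by_def matrix_mul_assoc)
  then show "conj_by (cadjoint g) (conj_by g X) = X" "conj_by g (conj_by (cadjoint g) X) = X"
    by (simp_all add: unitary_groupD[OF assms])
qed

lemma conj_by_skew_iff:
  assumes "g \<in> unitary_group"
  shows "conj_by g X \<in> skew_hermitian \<longleftrightarrow> X \<in> skew_hermitian"
  unfolding skew_hermitian_def
  by (simp add: cadjoint_conj_by flip: conj_by_minus) (metis assms conj_by_inverse(1))

lemma trace_conj_by:
  assumes "g \<in> unitary_group"
  shows "trace (conj_by g X) = trace X"
proof -
  have "trace (conj_by g X) = trace (cadjoint g ** (g ** X))"
    unfolding conj_by_def by (rule trace_mul_sym)
  then show ?thesis by (simp add: matrix_mul_assoc unitary_groupD[OF assms])
qed

lemma inner_cmat: "X \<bullet> Y = Re (trace (cadjoint X ** Y))" for X Y :: "'n::finite cmat"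
proof -
  have "X \<bullet> Y = (\<Sum>i\<in>UNIV. \<Sum>j\<in>UNIV. Re (cnj (X $ i $ j) * Y $ i $ j))"
    by (simp add: inner_vec_def inner_complex_def)
  also have "\<dots> = Re (trace (cadjoint X ** Y))"
    by (subst sum.swap) (simp add: trace_def matrix_mult_nth)
  finally show ?thesis .
qed

lemma inner_conj_by:
  assumes "g \<in> unitary_group"
  shows "conj_by g X \<bullet> conj_by g Y = X \<bullet> Y"
  by (simp add: inner_cmat cadjoint_conj_by conj_by_mult[OF assms] trace_conj_by[OF assms])

lemma kappa_conj_by:
  assumes "g \<in> unitary_group"
  shows "kappa (conj_by g X) (conj_by g Y) = kappa X Y"
  by (simp add: kappa_def conj_by_mult[OF assms] trace_conj_by[OF assms])

lemma ad_conj_by: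
  assumes "g \<in> unitary_group"
  shows "ad (conj_by g X) (conj_by g Y) = conj_by g (ad X Y)"
  by (simp add: ad_def conj_by_mult[OF assms] conj_by_diff)

text \<open>The vector \<open>w = S v - m v\<close> satisfies \<open>S w = - m w\<close>, which
  contradicts positivity unless \<open>w = 0\<close>; for \<open>m = 0\<close> symmetry makes the
  norm of \<open>S v\<close> vanish. This gives uniqueness of the positive square root on
  eigenvectors of the square without diagonalising \<open>S\<close>.\<close>

lemma pos_operator_eigenvector:
  fixes S :: "'a::real_inner \<Rightarrow> 'a"
  assumes lin: "linear S" and sym: "\<And>x y. S x \<bullet> y = x \<bullet> S y" and pos: "\<And>x. 0 \<le> S x \<bullet> x"
    and eig: "S (S v) = m\<^sup>2 *\<^sub>R v" and "0 \<le> m"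
  shows "S v = m *\<^sub>R v"
proof (cases "m = 0")
  case True
  have "S v \<bullet> S v = S (S v) \<bullet> v" by (simp add: sym[of "S v" v])
  then show ?thesis using True eig by simp
next
  case False
  define w where "w = S v - m *\<^sub>R v"
  have "S w = - m *\<^sub>R w"
    using eig by (simp add: w_def linear_diff[OF lin] linear_cmul[OF lin] scaleR_right_diff_distrib power2_eq_square)
  then have "0 \<le> - m * (w \<bullet> w)" using pos[of w] by simp
  then have "w \<bullet> w \<le> 0" using False \<open>0 \<le> m\<close> by (simp add: mult_le_0_iff zero_le_mult_iff)
  then have "w \<bullet> w = 0" using inner_ge_zero[of w] by linarith
  then show ?thesis by (simp add: w_def)
qed

definition elem_mat :: "'n \<Rightarrow> 'n \<Rightarrow> complex \<Rightarrow> 'n::finite cmat" where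
  "elem_mat i j z = (\<chi> a b. if a = i \<and> b = j then z else 0)"

lemma sum_elem_mat: "(\<Sum>i\<in>UNIV. \<Sum>j\<in>UNIV. elem_mat i j (Y $ i $ j)) = Y"
proof -
  have "(\<Sum>i\<in>UNIV. \<Sum>j\<in>UNIV. if a = i \<and> b = j then Y $ i $ j else 0) = Y $ a $ b" for a b
  proof -
    have "(\<Sum>i\<in>UNIV. \<Sum>j\<in>UNIV. if a = i \<and> b = j then Y $ i $ j else 0) =
        (\<Sum>i\<in>UNIV. if a = i then Y $ i $ b else 0)"
      by (intro sum.cong refl) auto
    then show ?thesis by simp
  qed
  then show ?thesis by (simp add: vec_eq_iff elem_mat_def)
qed

section \<open>The tangent space and the metrics at an orbit point with distinct eigenvalues\<close>

text \<open>Conjugation by \<open>h\<close> makes \<open>L\<close> diagonal, and \<open>ad L\<close>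
  then multiplies entry \<open>(i, j)\<close> by a scalar that vanishes only for
  \<open>i = j\<close>. All constructions below become entrywise in these coordinates.\<close>

locale regular_orbit_point =
  fixes lam :: "real^'n::finite" and h L :: "'n cmat"
  assumes lam: "\<And>i j. i \<noteq> j \<Longrightarrow> lam $ i \<noteq> lam $ j"
    and h: "h \<in> unitary_group"
    and L: "L = conj_by h (\<i> \<odot> Diag lam)"
begin

lemma ad_L: "ad L (conj_by h X) = conj_by h (\<chi> i j. \<i> * of_real (lam $ i - lam $ j) * X $ i $ j)"
proof -
  have "ad (\<i> \<odot> Diag lam) X = (\<chi> i j. \<i> * of_real (lam $ i - lam $ j) * X $ i $ j)"
    by (simp add: vec_eq_iff ad_def cscale_mult_left cscale_mult_right Diag_mult_nth mult_Diag_nth algebra_simps)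
  then show ?thesis by (simp add: L ad_conj_by[OF h])
qed

lemma conj_cases:
  obtains X0 where "X = conj_by h X0"
  using conj_by_inverse(2)[OF h] by metis

lemma conj_by_eq_iff [simp]: "conj_by h X = conj_by h Y \<longleftrightarrow> X = Y"
  by (metis conj_by_inverse(1) h)

text \<open>The candidate for the positive square root: entrywise, the absolute values of the
  eigenvalues of \<open>ad L\<close>.\<close>

definition weight :: "'n cmat \<Rightarrow> 'n cmat" where
  "weight X = conj_by h (\<chi> i j. of_real \<bar>lam $ i - lam $ j\<bar> * conj_by (cadjoint h) X $ i $ j)"

lemma weight_conj: "weight (conj_by h X) = conj_by h (\<chi> i j. of_real \<bar>lam $ i - lam $ j\<bar> * X $ i $ j)"
  by (simp add: weight_def h)

lemma linear_weight: "linear weight"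
proof -
  have "linear (\<lambda>X :: 'n cmat. (\<chi> i j. of_real \<bar>lam $ i - lam $ j\<bar> * X $ i $ j) :: 'n cmat)"
    by (rule linearI) (simp_all add: vec_eq_iff algebra_simps)
  from linear_compose[OF linear_compose[OF linear_conj_by this] linear_conj_by] show ?thesis
    by (simp add: o_def weight_def[abs_def])
qed

lemma weight_weight: "weight (weight X) = - ad L (ad L X)"
proof -
  obtain X0 where X: "X = conj_by h X0" by (rule conj_cases)
  have "complex_of_real \<bar>r\<bar> * (complex_of_real \<bar>r\<bar> * z) = - (\<i> * complex_of_real r * (\<i> * complex_of_real r * z))" for r z
    by (cases "0 \<le> r") (simp_all add: complex_eq_iff)
  then have "(\<chi> i j. of_real \<bar>lam $ i - lam $ j\<bar> * (of_real \<bar>lam $ i - lam $ j\<bar> * X0 $ i $ j)) =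
      - (\<chi> i j. \<i> * of_real (lam $ i - lam $ j) * (\<i> * of_real (lam $ i - lam $ j) * X0 $ i $ j))"
    by (simp only: vec_eq_iff vec_lambda_beta vector_uminus_component simp_thms)
  then show ?thesis
    by (simp add: X weight_conj ad_L flip: conj_by_minus)
qed

lemma inner_conj_weight:
  "weight (conj_by h X) \<bullet> conj_by h Y = (\<Sum>i\<in>UNIV. \<Sum>j\<in>UNIV. \<bar>lam $ i - lam $ j\<bar> * (X $ i $ j \<bullet> Y $ i $ j))"
  by (simp add: weight_conj inner_conj_by[OF h]) (simp add: inner_vec_def inner_complex_def algebra_simps)

lemma weight_sym: "weight X \<bullet> Y = X \<bullet> weight Y"
proof -
  obtain X0 Y0 where "X = conj_by h X0" "Y = conj_by h Y0" by (metis conj_cases)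
  then show ?thesis
    by (simp add: inner_conj_weight inner_commute[of "conj_by h X0"]) (simp add: inner_commute)
qed

lemma weight_pos: "0 \<le> weight X \<bullet> X"
proof -
  obtain X0 where "X = conj_by h X0" by (rule conj_cases)
  then show ?thesis by (simp add: inner_conj_weight sum_nonneg)
qed

text \<open>The conjugated matrix units are eigenvectors of \<open>weight\<close> that span all
  matrices, and any competing square root agrees with \<open>weight\<close> on them by
  \<open>pos_operator_eigenvector\<close>.\<close>

lemma pos_sqrt_ad: "pos_sqrt (\<lambda>X. - ad L (ad L X)) = weight"
  unfolding pos_sqrt_def
proof (rule the_equality)
  show "linear weight \<and> (\<forall>x y. weight x \<bullet> y = x \<bullet> weight y) \<and> (\<forall>x. 0 \<le> weight x \<bullet> x) \<and>
      weight \<circ> weight = (\<lambda>X. - ad L (ad L X))"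
    by (intro conjI allI linear_weight weight_sym weight_pos ext) (simp add: weight_weight)
next
  fix S assume S: "linear S \<and> (\<forall>x y. S x \<bullet> y = x \<bullet> S y) \<and> (\<forall>x. 0 \<le> S x \<bullet> x) \<and> S \<circ> S = (\<lambda>X. - ad L (ad L X))"
  then have lin: "linear S" and sym: "S X \<bullet> Y = X \<bullet> S Y" and pos: "0 \<le> S X \<bullet> X" for X Y
    by blast+
  from S have SS: "S (S X) = weight (weight X)" for X
    by (auto simp: weight_weight fun_eq_iff)
  \<comment> \<open>\<open>S\<close> is only known to be real linear, so the single nonzero entry
    \<open>z\<close> has to be an arbitrary complex number.\<close>
  have eq: "S (conj_by h (elem_mat i j z)) = weight (conj_by h (elem_mat i j z))" for i j z
  proof -
    let ?m = "\<bar>lam $ i - lam $ j\<bar>" and ?E = "conj_by h (elem_mat i j z)"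
    have w: "weight ?E = ?m *\<^sub>R ?E"
    proof -
      have "(\<chi> a b. of_real \<bar>lam $ a - lam $ b\<bar> * elem_mat i j z $ a $ b) = ?m *\<^sub>R elem_mat i j z"
        by (simp add: vec_eq_iff elem_mat_def scaleR_conv_of_real[symmetric])
      then show ?thesis by (simp add: weight_conj linear_cmul[OF linear_conj_by])
    qed
    have "S (S ?E) = ?m\<^sup>2 *\<^sub>R ?E"
      unfolding SS by (simp add: w linear_cmul[OF linear_weight] power2_eq_square)
    then have "S ?E = ?m *\<^sub>R ?E"
      by (rule pos_operator_eigenvector[OF lin sym pos]) simp
    then show ?thesis using w by simp
  qed
  show "S = weight"
  proof
    fix X
    obtain X0 where X: "X = conj_by h X0" by (rule conj_cases)
    have "X = conj_by h (\<Sum>i\<in>UNIV. \<Sum>j\<in>UNIV. elem_mat i j (X0 $ i $ j))"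
      by (simp add: X sum_elem_mat)
    also have "\<dots> = (\<Sum>i\<in>UNIV. \<Sum>j\<in>UNIV. conj_by h (elem_mat i j (X0 $ i $ j)))"
      by (simp add: linear_sum[OF linear_conj_by])
    finally have "X = \<dots>" .
    then show "S X = weight X"
      by (simp add: linear_sum[OF lin] linear_sum[OF linear_weight] eq)
  qed
qed

text \<open>On the diagonal the division by zero returns \<open>0\<close>. This selects, among the
  preimages of a tangent vector under \<open>ad L\<close>, the one with zero diagonal, which lies in
  the image of \<open>ad L\<close>.\<close>

definition ad_inverse :: "'n cmat \<Rightarrow> 'n cmat" where
  "ad_inverse V = conj_by h (\<chi> i j. conj_by (cadjoint h) V $ i $ j / (\<i> * of_real (lam $ i - lam $ j)))"

lemma ad_inverse_conj:
  "ad_inverse (conj_by h V) = conj_by h (\<chi> i j. V $ i $ j / (\<i> * of_real (lam $ i - lam $ j)))"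
  by (simp add: ad_inverse_def h)

lemma skew_iff: "X \<in> skew_hermitian \<longleftrightarrow> (\<forall>i j. cnj (X $ j $ i) = - X $ i $ j)" for X :: "'n cmat"
  by (simp add: skew_hermitian_def vec_eq_iff)

lemma skew_divide:
  assumes "X \<in> skew_hermitian"
  shows "(\<chi> i j. X $ i $ j / (\<i> * of_real (lam $ i - lam $ j))) \<in> skew_hermitian"
  using assms unfolding skew_iff
  by (auto simp: divide_simps algebra_simps)

lemma tangent_iff:
  "conj_by h V \<in> tangent_space L \<longleftrightarrow> V \<in> skew_hermitian \<and> (\<forall>i. V $ i $ i = 0)"
proof
  assume "conj_by h V \<in> tangent_space L"
  then obtain X where X: "X \<in> skew_hermitian" "conj_by h V = ad L X" by (auto simp: tangent_space_def)
  obtain X0 where X0: "X = conj_by h X0" by (rule conj_cases)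
  have "X0 \<in> skew_hermitian" using X X0 conj_by_skew_iff[OF h] by simp
  moreover have "V = (\<chi> i j. \<i> * of_real (lam $ i - lam $ j) * X0 $ i $ j)"
    using X(2) unfolding X0 ad_L by simp
  ultimately show "V \<in> skew_hermitian \<and> (\<forall>i. V $ i $ i = 0)"
    by (auto simp: skew_iff algebra_simps)
next
  assume V: "V \<in> skew_hermitian \<and> (\<forall>i. V $ i $ i = 0)"
  let ?X = "\<chi> i j. V $ i $ j / (\<i> * of_real (lam $ i - lam $ j))"
  have "V $ i $ j = \<i> * of_real (lam $ i - lam $ j) * (V $ i $ j / (\<i> * of_real (lam $ i - lam $ j)))" for i j
    using V lam[of i j] by (cases "i = j") auto
  then have "V = (\<chi> i j. \<i> * of_real (lam $ i - lam $ j) * ?X $ i $ j)"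
    unfolding vec_eq_iff vec_lambda_beta by blast
  then have "conj_by h V = ad L (conj_by h ?X)"
    unfolding ad_L by (rule arg_cong)
  moreover have "conj_by h ?X \<in> skew_hermitian"
    using V skew_divide conj_by_skew_iff[OF h] by blast
  ultimately show "conj_by h V \<in> tangent_space L"
    by (auto simp: tangent_space_def)
qed

text \<open>In the coordinates of \<open>h\<close> the kernel of \<open>ad L\<close> consists of the
  diagonal matrices and its image of those with zero diagonal, so taking the image component erases
  the diagonal.\<close>

lemma im_part_eq:
  assumes X: "X \<in> skew_hermitian"
  shows "im_part L X = ad_inverse (ad L X)"
proof -
  obtain X0 where X0: "X = conj_by h X0" by (rule conj_cases)
  define Y where "Y = (\<chi> i j. if i = j then 0 else X0 $ i $ j)"
  have sk: "X0 \<in> skew_hermitian" using X X0 conj_by_skew_iff[OF h] by simp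
  then have Y: "Y \<in> skew_hermitian" by (auto simp: skew_iff Y_def)
  have "ad_inverse (ad L X) = conj_by h Y"
  proof -
    have "lam $ i = lam $ j \<longleftrightarrow> i = j" for i j using lam by blast
    then have "(\<chi> i j. \<i> * of_real (lam $ i - lam $ j) * X0 $ i $ j / (\<i> * of_real (lam $ i - lam $ j))) = Y"
      by (simp add: vec_eq_iff Y_def)
    then show ?thesis by (simp add: X0 ad_L ad_inverse_conj)
  qed
  moreover have "im_part L X = conj_by h Y"
    unfolding im_part_def
  proof (rule the_equality)
    have "conj_by h Y \<in> ad L ` skew_hermitian"
      using tangent_iff[of Y] Y by (auto simp: tangent_space_def Y_def)
    moreover have "X - conj_by h Y = conj_by h (X0 - Y)" by (simp add: X0 conj_by_diff)
    moreover have "X0 - Y \<in> skew_hermitian" using sk Y by (simp add: skew_iff)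
    moreover have "ad L (conj_by h (X0 - Y)) = 0"
    proof -
      have "(\<chi> i j. \<i> * of_real (lam $ i - lam $ j) * (X0 - Y) $ i $ j) = 0"
        by (auto simp: vec_eq_iff Y_def)
      then show ?thesis unfolding ad_L by (simp add: linear_0[OF linear_conj_by])
    qed
    ultimately show "conj_by h Y \<in> ad L ` skew_hermitian \<and> X - conj_by h Y \<in> {Z \<in> skew_hermitian. ad L Z = 0}"
      using conj_by_skew_iff[OF h] by simp
  next
    fix Z assume Z: "Z \<in> ad L ` skew_hermitian \<and> X - Z \<in> {Z \<in> skew_hermitian. ad L Z = 0}"
    obtain Z0 where Z0: "Z = conj_by h Z0" by (rule conj_cases)
    have diag: "Z0 $ i $ i = 0" for i
      using Z tangent_iff[of Z0] by (auto simp: Z0 tangent_space_def)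
    have "ad L (conj_by h (X0 - Z0)) = conj_by h 0"
      using Z by (simp add: X0 Z0 conj_by_diff linear_0[OF linear_conj_by])
    then have "X0 $ i $ j = Z0 $ i $ j" if "i \<noteq> j" for i j
      using lam[OF that] unfolding ad_L conj_by_eq_iff by (auto simp: vec_eq_iff)
    then have "Z0 = Y" using diag by (auto simp: vec_eq_iff Y_def)
    then show "Z = conj_by h Y" by (simp add: Z0)
  qed
  ultimately show ?thesis by simp
qed

text \<open>By \<open>im_part_eq\<close> the component \<open>im_part L X\<close> depends on
  \<open>ad L X\<close> only, so the choice of \<open>X\<close> and \<open>Y\<close> in the definite
  description does not affect the value.\<close>

lemma normal_metric_eq:
  assumes "V \<in> tangent_space L" "W \<in> tangent_space L"
  shows "normal_metric L V W = - Re (kappa (ad_inverse V) (ad_inverse W))"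
  unfolding normal_metric_def
  by (rule the_equality) (use assms im_part_eq in \<open>auto simp: tangent_space_def\<close>)

text \<open>Write \<open>r\<close> for the eigenvalue difference. The factor
  \<open>\<bar>r\<bar>\<close> of the square root and the two inverse factors with denominators
  \<open>\<i> r\<close> and \<open>- \<i> r\<close> multiply to \<open>1 / \<bar>r\<bar>\<close>.
  The trace terms of \<open>kappa\<close> vanish because the diagonals do.\<close>

lemma kaehler_metric_eq:
  assumes "conj_by h V \<in> tangent_space L" "conj_by h W \<in> tangent_space L"
  shows "kaehler_metric L (conj_by h V) (conj_by h W) = - Re (2 * of_nat CARD('n) *
    (\<Sum>i\<in>UNIV. \<Sum>j\<in>UNIV. V $ i $ j * W $ j $ i / of_real \<bar>lam $ i - lam $ j\<bar>))"
proof -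
  let ?V = "\<chi> i j. of_real \<bar>lam $ i - lam $ j\<bar> * V $ i $ j"
  let ?q = "\<lambda>V. \<chi> i j. V $ i $ j / (\<i> * of_real (lam $ i - lam $ j))"
  have V: "V \<in> skew_hermitian" "\<And>i. V $ i $ i = 0" and W: "\<And>i. W $ i $ i = 0"
    using assms unfolding tangent_iff by auto
  have "?V \<in> skew_hermitian" using V(1) by (simp add: skew_iff abs_minus_commute)
  then have "conj_by h ?V \<in> tangent_space L" unfolding tangent_iff by simp
  then have "kaehler_metric L (conj_by h V) (conj_by h W) = - Re (kappa (?q ?V) (?q W))"
    unfolding kaehler_metric_def pos_sqrt_ad weight_conj
    by (subst normal_metric_eq) (use assms in \<open>simp_all add: ad_inverse_conj kappa_conj_by[OF h]\<close>)
  also have "kappa (?q ?V) (?q W) = 2 * of_nat CARD('n) * trace (?q ?V ** ?q W)"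
    by (simp add: kappa_def trace_def V W)
  also have "trace (?q ?V ** ?q W) = (\<Sum>i\<in>UNIV. \<Sum>j\<in>UNIV. V $ i $ j * W $ j $ i / of_real \<bar>lam $ i - lam $ j\<bar>)"
    unfolding trace_def matrix_mult_nth
  proof (intro sum.cong refl)
    fix i j
    show "?q ?V $ i $ j * ?q W $ j $ i = V $ i $ j * W $ j $ i / of_real \<bar>lam $ i - lam $ j\<bar>"
    proof (cases "i = j")
      case False
      define r where "r = lam $ i - lam $ j"
      have r: "r \<noteq> 0" "lam $ j - lam $ i = - r" using lam[OF False] by (auto simp: r_def)
      have "complex_of_real \<bar>r\<bar> * v / (\<i> * of_real r) * (w / (\<i> * of_real (- r))) = v * w / of_real \<bar>r\<bar>" for v w
        using r(1) by (cases "0 \<le> r") (auto simp: field_simps)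
      then show ?thesis by (simp only: vec_lambda_beta r(2) flip: r_def)
    qed simp
  qed
  finally show ?thesis .
qed

text \<open>The function is linear, hence its own derivative. In the coordinates of \<open>h\<close>
  the matrix of the functional is \<open>- \<i>\<close> times the conjugated
  \<open>Diag lam\<close>, and the weights in the gradient cancel the denominators of the
  metric.\<close>

theorem has_kaehler_gradient_kappa:
  "has_kaehler_gradient lam (\<lambda>M. Re (kappa M ((- \<i>) \<odot> Diag lam)))
     (conj_by h (\<chi> i j. \<i> * of_real \<bar>lam $ i - lam $ j\<bar> * (cadjoint h ** Diag lam ** h) $ i $ j)) L"
proof -
  let ?N = "(- \<i>) \<odot> Diag lam :: 'n cmat"
  define C where "C = cadjoint h ** Diag lam ** h"
  define V where "V = (\<chi> i j. \<i> * of_real \<bar>lam $ i - lam $ j\<bar> * C $ i $ j)"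
  have "cadjoint C = C" by (simp add: C_def cadjoint_mult matrix_mul_assoc)
  then have C: "cnj (C $ j $ i) = C $ i $ j" for i j by (simp add: vec_eq_iff)
  have V: "conj_by h V \<in> tangent_space L"
    unfolding tangent_iff by (auto simp: V_def skew_iff C abs_minus_commute)
  have N: "?N = conj_by h ((- \<i>) \<odot> C)"
  proof -
    have "conj_by h C = (h ** cadjoint h) ** Diag lam ** (h ** cadjoint h)"
      by (simp add: C_def conj_by_def matrix_mul_assoc)
    then have "Diag lam = conj_by h C" by (simp add: unitary_groupD[OF h])
    then show ?thesis by (simp add: conj_by_def cscale_mult_left cscale_mult_right)
  qed
  have "linear (\<lambda>M. Re (kappa M ?N))"
    by (rule linearI)
      (simp_all add: kappa_def matrix_mult_add_left matrix_mult_scaleR_left trace_def sum.distrib algebra_simps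
        flip: scaleR_sum_right)
  then have "((\<lambda>M. Re (kappa M ?N)) has_derivative (\<lambda>M. Re (kappa M ?N))) (at L within orbit lam)"
    by (intro bounded_linear_imp_has_derivative linear_conv_bounded_linear[THEN iffD1])
  moreover have "kaehler_metric L (conj_by h V) W = Re (kappa W ?N)" if "W \<in> tangent_space L" for W
  proof -
    obtain W0 where W: "W = conj_by h W0" by (rule conj_cases)
    have W0: "W0 $ i $ i = 0" for i using that tangent_iff[of W0] W by simp
    have "kaehler_metric L (conj_by h V) W = - Re (2 * of_nat CARD('n) *
        (\<Sum>i\<in>UNIV. \<Sum>j\<in>UNIV. V $ i $ j * W0 $ j $ i / of_real \<bar>lam $ i - lam $ j\<bar>))"
      using V that unfolding W by (rule kaehler_metric_eq)
    also have "(\<Sum>i\<in>UNIV. \<Sum>j\<in>UNIV. V $ i $ j * W0 $ j $ i / of_real \<bar>lam $ i - lam $ j\<bar>) =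
        (\<Sum>i\<in>UNIV. \<Sum>j\<in>UNIV. - (((- \<i>) \<odot> C) $ i $ j * W0 $ j $ i))"
    proof (intro sum.cong refl)
      fix i j
      \<comment> \<open>On the diagonal, where nothing can be cancelled, both sides vanish with
        \<open>W0 $ i $ i\<close>.\<close>
      show "V $ i $ j * W0 $ j $ i / of_real \<bar>lam $ i - lam $ j\<bar> = - (((- \<i>) \<odot> C) $ i $ j * W0 $ j $ i)"
        using lam[of i j] by (cases "i = j") (auto simp: V_def W0)
    qed
    also have "\<dots> = - trace (W0 ** ((- \<i>) \<odot> C))"
      by (subst trace_mul_sym) (simp add: trace_def matrix_mult_nth sum_negf)
    finally have "kaehler_metric L (conj_by h V) W = Re (2 * of_nat CARD('n) * trace (W0 ** ((- \<i>) \<odot> C)))"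
      by simp
    also have "\<dots> = Re (kappa W0 ((- \<i>) \<odot> C))"
      by (simp add: kappa_def trace_def W0)
    also have "\<dots> = Re (kappa W ?N)"
      unfolding W N by (simp add: kappa_conj_by[OF h])
    finally show ?thesis .
  qed
  ultimately show ?thesis
    using V unfolding has_kaehler_gradient_def V_def C_def by blast
qed

end

section \<open>Matrices indexed by a finite linear order\<close>

text \<open>The order isomorphism from \<open>{..<CARD('n)}\<close> to the index type, inverse to
  \<open>index_pos\<close>; it carries the results on arrays over to matrices.\<close>

abbreviation ix :: "nat \<Rightarrow> 'n::{finite,linorder}" where
  "ix \<equiv> (!) (sorted_list_of_set UNIV)"

lemma ix_bij: "bij_betw (ix :: nat \<Rightarrow> 'n::{finite,linorder}) {..<CARD('n)} UNIV"
  by (rule sorted_list_nth_bij) simp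

lemma ix_incr: "incr CARD('n) (ix :: nat \<Rightarrow> 'n::{finite,linorder})"
  by (rule incr_sorted_list_nth)

lemma index_pos_ix [simp]:
  assumes "a < CARD('n)"
  shows "index_pos (ix a :: 'n::{finite,linorder}) = a"
proof -
  have "{j. j < (ix a :: 'n)} = ix ` {..<a}"
  proof (intro equalityI subsetI)
    fix j :: 'n assume j: "j \<in> {j. j < ix a}"
    obtain b where b: "b < CARD('n)" "j = ix b"
      using ix_bij[where 'n = 'n] by (metis UNIV_I bij_betw_def imageE lessThan_iff)
    have "b < a"
    proof (rule ccontr)
      assume "\<not> b < a"
      then have "(ix a :: 'n) \<le> ix b" using incrD[OF ix_incr[where 'n = 'n], of a b] b
        by (cases "a = b") auto
      then show False using j b by auto
    qed
    then show "j \<in> ix ` {..<a}" using b by auto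
  next
    fix j :: 'n assume "j \<in> ix ` {..<a}"
    then show "j \<in> {j. j < ix a}" using incrD[OF ix_incr[where 'n = 'n]] assms by auto
  qed
  moreover have "card ((ix :: nat \<Rightarrow> 'n) ` {..<a}) = a"
    using card_image[OF inj_on_subset[OF bij_betw_imp_inj_on[OF ix_bij[where 'n = 'n]], of "{..<a}"]] assms by simp
  ultimately show ?thesis by (simp add: index_pos_def)
qed

lemma index_pos_less [simp]: "index_pos (i :: 'n::{finite,linorder}) < CARD('n)"
  and ix_index_pos [simp]: "ix (index_pos i) = i"
proof -
  obtain a where "a < CARD('n)" "i = ix a"
    using ix_bij[where 'n = 'n] by (metis UNIV_I bij_betw_def imageE lessThan_iff)
  then show "index_pos i < CARD('n)" "ix (index_pos i) = i" by simp_all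
qed

lemma index_pos_less_iff: "index_pos i < index_pos j \<longleftrightarrow> i < j" for i j :: "'n::{finite,linorder}"
proof -
  have "ix (index_pos i) < (ix (index_pos j) :: 'n) \<longleftrightarrow> index_pos i < index_pos j"
    by (rule strict_mono_on_less[OF ix_incr]) simp_all
  then show ?thesis by simp
qed

lemma sum_ix: "(\<Sum>i\<in>UNIV. f i) = (\<Sum>a<CARD('n). f (ix a))" for f :: "'n::{finite,linorder} \<Rightarrow> 'a::comm_monoid_add"
  by (rule sum.reindex_bij_betw[OF ix_bij, symmetric])

definition ent :: "'n::{finite,linorder} cmat \<Rightarrow> nat \<Rightarrow> nat \<Rightarrow> complex" where
  "ent A a b = A $ ix a $ ix b"

definition mat_of :: "(nat \<Rightarrow> nat \<Rightarrow> complex) \<Rightarrow> 'n::{finite,linorder} cmat" where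
  "mat_of F = (\<chi> i j. F (index_pos i) (index_pos j))"

lemma ent_index_pos [simp]: "ent A (index_pos i) (index_pos j) = A $ i $ j"
  by (simp add: ent_def)

lemma ent_mat_of: "a < CARD('n) \<Longrightarrow> b < CARD('n) \<Longrightarrow> ent (mat_of F :: 'n::{finite,linorder} cmat) a b = F a b"
  by (simp add: ent_def mat_of_def)

lemma minor_eq_fdet:
  fixes g :: "'n::{finite,linorder} cmat"
  shows "minor g I {j. index_pos j < card I} = fdet (card I) (\<lambda>a b. ent g (index_pos (sorted_list_of_set I ! a)) b)"
proof -
  have le: "card I \<le> CARD('n)" by (rule card_mono) auto
  have "{j :: 'n. index_pos j < card I} = ix ` {..<card I}"
  proof (intro equalityI subsetI)
    fix j :: 'n assume "j \<in> {j. index_pos j < card I}"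
    then show "j \<in> ix ` {..<card I}" by (intro image_eqI[of _ _ "index_pos j"]) auto
  qed (use le in auto)
  then have "sorted_list_of_set {j :: 'n. index_pos j < card I} = map ix [0..<card I]"
    using sorted_list_of_incr_image[OF incr_mono[OF ix_incr le]] by metis
  then have "minor g I {j. index_pos j < card I} =
      fdet (card I) (\<lambda>a b. g $ (sorted_list_of_set I ! a) $ (map ix [0..<card I] ! b))"
    by (simp add: minor_def fdet_def)
  also have "\<dots> = fdet (card I) (\<lambda>a b. ent g (index_pos (sorted_list_of_set I ! a)) b)"
    by (rule fdet_cong) (simp add: ent_def)
  finally show ?thesis .
qed

lemma unitary_nonneg_iff:
  fixes g :: "'n::{finite,linorder} cmat"
  shows "g \<in> unitary_nonneg \<longleftrightarrow> g \<in> unitary_group \<and> left_minors_nonneg CARD('n) (ent g)"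
proof -
  have "(\<forall>I. minor g I {j. index_pos j < card I} \<in> \<real>\<^sub>\<ge>\<^sub>0) \<longleftrightarrow> left_minors_nonneg CARD('n) (ent g)"
  proof
    assume m: "\<forall>I. minor g I {j. index_pos j < card I} \<in> \<real>\<^sub>\<ge>\<^sub>0"
    show "left_minors_nonneg CARD('n) (ent g)"
      unfolding left_minors_nonneg_def
    proof (intro allI impI)
      fix k and r :: "nat \<Rightarrow> nat"
      assume r: "incr k r" "r ` {..<k} \<subseteq> {..<CARD('n)}"
      let ?s = "\<lambda>a. ix (r a) :: 'n"
      have s: "incr k ?s"
        using r incrD[OF ix_incr[where 'n = 'n]] by (auto simp: strict_mono_on_def image_subset_iff)
      have c: "card (?s ` {..<k}) = k" using s by (simp add: card_image strict_mono_on_imp_inj_on)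
      have "minor g (?s ` {..<k}) {j. index_pos j < card (?s ` {..<k})} =
          fdet k (\<lambda>a b. ent g (index_pos (map ?s [0..<k] ! a)) b)"
        by (subst minor_eq_fdet) (simp only: c sorted_list_of_incr_image[OF s])
      also have "\<dots> = fdet k (\<lambda>a b. ent g (r a) b)"
        using r by (intro fdet_cong) (simp add: image_subset_iff)
      finally show "fdet k (\<lambda>a b. ent g (r a) b) \<in> \<real>\<^sub>\<ge>\<^sub>0" using m by metis
    qed
  next
    assume l: "left_minors_nonneg CARD('n) (ent g)"
    show "\<forall>I. minor g I {j. index_pos j < card I} \<in> \<real>\<^sub>\<ge>\<^sub>0"
      unfolding minor_eq_fdet
    proof
      fix I :: "'n set"
      show "fdet (card I) (\<lambda>a b. ent g (index_pos (sorted_list_of_set I ! a)) b) \<in> \<real>\<^sub>\<ge>\<^sub>0"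
      proof (rule left_minors_nonnegD[OF l])
        show "card I \<le> CARD('n)" by (rule card_mono) auto
        show "incr (card I) (\<lambda>a. index_pos (sorted_list_of_set I ! a))"
          using incr_sorted_list_nth[of I] by (auto simp: strict_mono_on_def index_pos_less_iff)
      qed auto
    qed
  qed
  then show ?thesis by (simp add: unitary_nonneg_def)
qed

lemma unitary_fun_iff:
  fixes g :: "'n::{finite,linorder} cmat"
  shows "unitary_fun CARD('n) (ent g) \<longleftrightarrow> g \<in> unitary_group"
proof -
  have e: "(\<Sum>s<CARD('n). cnj (ent g s a) * ent g s b) = (cadjoint g ** g) $ ix a $ ix b" for a b
    by (simp add: matrix_mult_nth sum_ix ent_def)
  have i: "(mat 1 :: 'n cmat) $ ix a $ ix b = (if a = b then 1 else 0)" if "a < CARD('n)" "b < CARD('n)" for a b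
  proof -
    have "(ix a :: 'n) = ix b \<longleftrightarrow> a = b"
      using index_pos_ix[where 'n = 'n, OF that(1)] index_pos_ix[where 'n = 'n, OF that(2)] by metis
    then show ?thesis by (simp add: mat_def)
  qed
  have "cadjoint g ** g = mat 1" if u: "unitary_fun CARD('n) (ent g)"
    unfolding vec_eq_iff
  proof (intro allI)
    fix x y :: 'n
    show "(cadjoint g ** g) $ x $ y = (mat 1 :: 'n cmat) $ x $ y"
      using unitary_funD[OF u, of "index_pos x" "index_pos y"]
        i[of "index_pos x" "index_pos y"] by (simp add: e)
  qed
  moreover have "unitary_fun CARD('n) (ent g)" if "cadjoint g ** g = mat 1"
    using that i by (simp add: unitary_fun_def e)
  moreover have "g ** cadjoint g = mat 1 \<longleftrightarrow> cadjoint g ** g = mat 1"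
    using matrix_left_right_inverse by blast
  ultimately show ?thesis by (auto simp: unitary_group_def)
qed

lemma delta_delta [simp]: "delta ** delta = mat 1"
  by (auto simp: vec_eq_iff delta_def Diag_mult_nth mat_def simp flip: of_real_mult power_mult_distrib)

lemma cadjoint_delta [simp]: "cadjoint delta = delta"
  by (simp add: delta_def)

lemma delta_unitary: "delta \<in> unitary_group"
  by (simp add: unitary_group_def)

lemma unitary_group_mult: "g \<in> unitary_group \<Longrightarrow> h \<in> unitary_group \<Longrightarrow> g ** h \<in> unitary_group"
proof -
  assume g: "g \<in> unitary_group" and h: "h \<in> unitary_group"
  have "(g ** h) ** cadjoint (g ** h) = g ** (h ** cadjoint h) ** cadjoint g"
    "cadjoint (g ** h) ** (g ** h) = cadjoint h ** (cadjoint g ** g) ** h"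
    by (simp_all add: cadjoint_mult matrix_mul_assoc)
  then show "g ** h \<in> unitary_group"
    unfolding unitary_group_def by (simp add: unitary_groupD[OF g] unitary_groupD[OF h])
qed

section \<open>The twist on the level of unitary factors\<close>

text \<open>Since \<open>delta\<close> commutes with diagonal matrices, the twist replaces the
  unitary factor of a point by its signed adjoint.\<close>

definition signed_adjoint :: "'n::{finite,linorder} cmat \<Rightarrow> 'n cmat" where
  "signed_adjoint g = delta ** cadjoint g ** delta"

lemma minus_one_power_cancel: "(-1) ^ k * ((-1) ^ k * z) = (z :: complex)"
  by (simp flip: mult.assoc power_mult_distrib)

lemma delta_conj_nth:
  "(delta ** A ** delta) $ i $ j = (-1) ^ index_pos i * ((-1) ^ index_pos j * A $ i $ j)"
  by (simp add: delta_def Diag_mult_nth mult_Diag_nth)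

lemma signed_adjoint_signed_adjoint [simp]: "signed_adjoint (signed_adjoint g) = g"
proof -
  have "signed_adjoint (signed_adjoint g) = (delta ** delta) ** g ** (delta ** delta)"
    by (simp add: signed_adjoint_def cadjoint_mult matrix_mul_assoc del: delta_delta)
  then show ?thesis by simp
qed

theorem signed_adjoint_unitary_nonneg:
  fixes g :: "'n::{finite,linorder} cmat"
  assumes "g \<in> unitary_nonneg"
  shows "signed_adjoint g \<in> unitary_nonneg"
proof -
  have g: "g \<in> unitary_group" "left_minors_nonneg CARD('n) (ent g)"
    using assms unitary_nonneg_iff by auto
  have "left_minors_nonneg CARD('n) (\<lambda>i j. (-1) ^ i * ((-1) ^ j * cnj (ent g j i)))"
    using g by (intro left_minors_nonneg_twist) (simp_all add: unitary_fun_iff)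
  moreover have "fdet k (\<lambda>a b. ent (signed_adjoint g) (r a) b) = fdet k (\<lambda>a b. (-1) ^ r a * ((-1) ^ b * cnj (ent g b (r a))))"
    if "k \<le> CARD('n)" "r ` {..<k} \<subseteq> {..<CARD('n)}" for k and r :: "nat \<Rightarrow> nat"
    using that by (intro fdet_cong) (auto simp: ent_def signed_adjoint_def delta_conj_nth image_subset_iff)
  ultimately have "left_minors_nonneg CARD('n) (ent (signed_adjoint g))"
    by (simp add: left_minors_nonneg_def)
  then show ?thesis
    unfolding unitary_nonneg_iff signed_adjoint_def
    using g by (simp add: unitary_group_mult cadjoint_unitary delta_unitary)
qed

text \<open>This makes the definite description in \<open>twist\<close> proper. The quotient
  \<open>d\<close> commutes with a diagonal matrix with distinct entries, so it is diagonal with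
  entries of modulus one. The product of its first \<open>k\<close> entries is the ratio of two
  nonnegative left-justified minors, the denominator being chosen nonzero; hence all these products,
  and then all entries, are \<open>1\<close>.\<close>

lemma unitary_nonneg_conj_unique:
  fixes lam :: "real^'n::{finite,linorder}"
  assumes lam: "\<And>i j. i \<noteq> j \<Longrightarrow> lam $ i \<noteq> lam $ j"
    and g: "g \<in> unitary_nonneg" "g' \<in> unitary_nonneg"
    and eq: "conj_by g (\<i> \<odot> Diag lam) = conj_by g' (\<i> \<odot> Diag lam)"
  shows "g = g'"
proof -
  let ?n = "CARD('n)"
  have u: "g \<in> unitary_group" "g' \<in> unitary_group"
    and l: "left_minors_nonneg ?n (ent g)" "left_minors_nonneg ?n (ent g')"
    using g unitary_nonneg_iff by auto
  define d where "d = cadjoint g ** g'"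
  have d: "d \<in> unitary_group" using u by (simp add: d_def unitary_group_mult cadjoint_unitary)
  have g': "g' = g ** d" by (simp add: d_def matrix_mul_assoc unitary_groupD u)
  have "(\<i> \<odot> Diag lam) ** d = cadjoint g ** conj_by g (\<i> \<odot> Diag lam) ** g'"
    by (simp add: conj_by_def matrix_mul_assoc unitary_groupD u d_def)
  also have "\<dots> = d ** (\<i> \<odot> Diag lam) ** (cadjoint g' ** g')"
    by (simp only: eq) (simp only: conj_by_def d_def matrix_mul_assoc)
  finally have comm: "(\<i> \<odot> Diag lam) ** d = d ** (\<i> \<odot> Diag lam)" by (simp add: unitary_groupD u)
  have off: "d $ i $ j = 0" if "i \<noteq> j" for i j
  proof -
    have "((\<i> \<odot> Diag lam) ** d) $ i $ j = (d ** (\<i> \<odot> Diag lam)) $ i $ j" by (simp only: comm)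
    then have "of_real (lam $ i) * d $ i $ j = d $ i $ j * of_real (lam $ j)"
      by (simp add: cscale_mult_left cscale_mult_right Diag_mult_nth mult_Diag_nth)
    then show ?thesis using lam[OF that] by (simp add: mult.commute)
  qed
  have norm_d: "cmod (d $ i $ i) = 1" for i
  proof -
    have "(\<Sum>k\<in>UNIV. cnj (d $ k $ i) * d $ k $ i) = (\<Sum>k\<in>UNIV. if k = i then cnj (d $ i $ i) * d $ i $ i else 0)"
      using off by (intro sum.cong) auto
    moreover have "(cadjoint d ** d) $ i $ i = (mat 1 :: 'n cmat) $ i $ i" using unitary_groupD[OF d] by simp
    ultimately have "cnj (d $ i $ i) * d $ i $ i = 1" by (simp add: matrix_mult_nth mat_def)
    then have "complex_of_real ((cmod (d $ i $ i))\<^sup>2) = 1"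
      unfolding complex_norm_square by (subst mult.commute)
    then have "(cmod (d $ i $ i))\<^sup>2 = 1" by (metis of_real_eq_1_iff)
    then show ?thesis by (simp add: power2_eq_1_iff) (metis norm_ge_zero neg_0_le_iff_le not_one_le_zero)
  qed
  have ent': "ent g' a b = ent d b b * ent g a b" for a b
  proof -
    have "ent g' a b = (\<Sum>k::'n\<in>UNIV. if k = ix b then g $ ix a $ ix b * d $ ix b $ ix b else 0)"
      unfolding g' ent_def matrix_mult_nth using off by (intro sum.cong) auto
    then show ?thesis by (simp add: ent_def)
  qed
  have prod1: "(\<Prod>b<k. ent d b b) = 1" if k: "k \<le> ?n" for k
  proof -
    obtain r where r: "incr k r" "r ` {..<k} \<subseteq> {..<?n}" "fdet k (\<lambda>a b. ent g (r a) b) \<noteq> 0"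
      using exists_left_minor_nonzero[OF unitary_fun_fdet_nonzero k] u by (metis unitary_fun_iff)
    have "fdet k (\<lambda>a b. ent g' (r a) b) = (\<Prod>b<k. ent d b b) * fdet k (\<lambda>a b. ent g (r a) b)"
      by (simp only: ent' fdet_scale_cols)
    moreover have "fdet k (\<lambda>a b. ent g (r a) b) \<in> \<real>\<^sub>\<ge>\<^sub>0" "fdet k (\<lambda>a b. ent g' (r a) b) \<in> \<real>\<^sub>\<ge>\<^sub>0"
      using l k r by (auto intro: left_minors_nonnegD)
    ultimately have "(\<Prod>b<k. ent d b b) \<in> \<real>\<^sub>\<ge>\<^sub>0"
      using nonneg_Reals_divide_I[of "fdet k (\<lambda>a b. ent g' (r a) b)" "fdet k (\<lambda>a b. ent g (r a) b)"] r(3) by simp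
    moreover have "cmod (\<Prod>b<k. ent d b b) = 1"
      by (simp add: norm_d ent_def flip: prod_norm)
    ultimately show ?thesis
      by (metis complex_nonneg_Reals_iff complex_eq_iff nonneg_Reals_cmod_eq_Re one_complex.sel)
  qed
  have "d $ i $ i = 1" for i
  proof -
    have le: "Suc (index_pos i) \<le> ?n" using index_pos_less[of i] by (simp only: Suc_le_eq)
    show ?thesis using prod1[OF le] prod1[OF Suc_leD[OF le]] by simp
  qed
  then have "d = mat 1" using off by (auto simp: vec_eq_iff mat_def)
  then show ?thesis by (simp add: g')
qed

lemma twist_conj_by:
  fixes lam :: "real^'n::{finite,linorder}"
  assumes lam: "\<And>i j. i \<noteq> j \<Longrightarrow> lam $ i \<noteq> lam $ j" and h: "h \<in> unitary_nonneg"
  shows "twist lam (conj_by (signed_adjoint h) (\<i> \<odot> Diag lam)) = conj_by h (\<i> \<odot> Diag lam)"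
proof -
  have inv: "g ** (\<i> \<odot> Diag lam) ** matrix_inv g = conj_by g (\<i> \<odot> Diag lam)" if "g \<in> unitary_nonneg" for g
    using that by (simp add: conj_by_def matrix_inv_unitary unitary_nonneg_iff)
  let ?g = "signed_adjoint h"
  have g: "?g \<in> unitary_nonneg" using h by (rule signed_adjoint_unitary_nonneg)
  have the: "(THE g. g \<in> unitary_nonneg \<and> conj_by ?g (\<i> \<odot> Diag lam) = g ** (\<i> \<odot> Diag lam) ** matrix_inv g) = ?g"
  proof (rule the_equality)
    show "?g \<in> unitary_nonneg \<and> conj_by ?g (\<i> \<odot> Diag lam) = ?g ** (\<i> \<odot> Diag lam) ** matrix_inv ?g"
      using inv[OF g] g by simp
    fix x assume x: "x \<in> unitary_nonneg \<and> conj_by ?g (\<i> \<odot> Diag lam) = x ** (\<i> \<odot> Diag lam) ** matrix_inv x"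
    then have "conj_by ?g (\<i> \<odot> Diag lam) = conj_by x (\<i> \<odot> Diag lam)" using inv[of x] by simp
    then show "x = ?g" using unitary_nonneg_conj_unique[OF lam g] x by metis
  qed
  have 1: "delta ** matrix_inv ?g = h ** delta"
  proof -
    have "matrix_inv ?g = cadjoint ?g" using g by (simp add: matrix_inv_unitary unitary_nonneg_iff)
    then have "delta ** matrix_inv ?g = (delta ** delta) ** h ** delta"
      by (simp add: signed_adjoint_def cadjoint_mult matrix_mul_assoc del: delta_delta)
    then show ?thesis by simp
  qed
  have 2: "?g ** delta = delta ** cadjoint h"
  proof -
    have "?g ** delta = delta ** cadjoint h ** (delta ** delta)"
      by (simp add: signed_adjoint_def matrix_mul_assoc del: delta_delta)
    then show ?thesis by simp
  qed
  have 3: "delta ** (\<i> \<odot> Diag lam) ** delta = \<i> \<odot> Diag lam"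
    by (auto simp: vec_eq_iff delta_conj_nth minus_one_power_cancel)
  have "delta ** matrix_inv ?g ** (\<i> \<odot> Diag lam) ** ?g ** delta =
      (delta ** matrix_inv ?g) ** (\<i> \<odot> Diag lam) ** (?g ** delta)"
    by (simp only: matrix_mul_assoc)
  also have "\<dots> = h ** (delta ** (\<i> \<odot> Diag lam) ** delta) ** cadjoint h"
    unfolding 1 2 by (simp only: matrix_mul_assoc)
  also have "\<dots> = conj_by h (\<i> \<odot> Diag lam)"
    unfolding 3 conj_by_def ..
  finally have "delta ** matrix_inv ?g ** (\<i> \<odot> Diag lam) ** ?g ** delta = conj_by h (\<i> \<odot> Diag lam)" .
  then show ?thesis unfolding twist_def the Let_def .
qed

section \<open>Uniqueness of the Toda flow\<close>

text \<open>Gronwall's argument for the squared distance \<open>p\<close>: since \<open>p'\<close>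
  is bounded by \<open>2 * K * p\<close> in absolute value, \<open>p\<close> times an exponential is
  monotone in either direction of time. The Lipschitz bound is asked only along the two
  solutions.\<close>

lemma Lipschitz_flow_unique:
  fixes x y :: "real \<Rightarrow> 'a::real_inner"
  assumes x: "\<And>t. (x has_vector_derivative F (x t)) (at t)"
    and y: "\<And>t. (y has_vector_derivative F (y t)) (at t)"
    and lip: "\<And>t. norm (F (x t) - F (y t)) \<le> K * norm (x t - y t)"
    and init: "x 0 = y 0"
  shows "x t = y t"
proof -
  define p where "p = (\<lambda>t. (x t - y t) \<bullet> (x t - y t))"
  define p' where "p' = (\<lambda>t. 2 * ((x t - y t) \<bullet> (F (x t) - F (y t))))"
  have dp: "(p has_real_derivative p' t) (at t)" for t
  proof -
    have "((\<lambda>t. x t - y t) has_derivative (\<lambda>s. s *\<^sub>R (F (x t) - F (y t)))) (at t)"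
      using has_vector_derivative_diff[OF x y] by (simp add: has_vector_derivative_def)
    from has_derivative_inner[OF this this] show ?thesis
      unfolding has_field_derivative_def p_def p'_def
      by (rule has_derivative_eq_rhs) (auto simp: inner_commute)
  qed
  have bound: "\<bar>p' t\<bar> \<le> 2 * K * p t" for t
  proof -
    have "\<bar>(x t - y t) \<bullet> (F (x t) - F (y t))\<bar> \<le> norm (x t - y t) * (K * norm (x t - y t))"
      by (rule order_trans[OF Cauchy_Schwarz_ineq2 mult_left_mono[OF lip]]) simp
    also have "\<dots> = K * p t" by (simp add: p_def dot_square_norm power2_eq_square)
    finally show ?thesis by (simp add: p'_def)
  qed
  have de: "((\<lambda>t. p t * exp (c * t)) has_real_derivative (p' t + c * p t) * exp (c * t)) (at t)" for c t
    by (rule derivative_eq_intros dp refl)+ (simp add: algebra_simps)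
  have p0: "p 0 = 0" by (simp add: p_def init)
  have "p t \<le> 0"
  proof (cases "0 \<le> t")
    case True
    have "p 0 * exp (- 2 * K * 0) \<ge> p t * exp (- 2 * K * t)"
    proof (rule DERIV_nonpos_imp_nonincreasing[OF True])
      fix s
      have "p' s + - 2 * K * p s \<le> 0" using bound[of s] by simp
      then have "(p' s + - 2 * K * p s) * exp (- 2 * K * s) \<le> 0" by (rule mult_nonpos_nonneg) simp
      then show "\<exists>y. ((\<lambda>t. p t * exp (- 2 * K * t)) has_real_derivative y) (at s) \<and> y \<le> 0"
        using de[of "- 2 * K" s] by blast
    qed
    then have "p t * exp (- 2 * K * t) \<le> 0" by (simp add: p0)
    then show ?thesis by (simp add: mult_le_0_iff)
  next
    case False
    then have "t \<le> 0" by simp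
    have "p t * exp (2 * K * t) \<le> p 0 * exp (2 * K * 0)"
    proof (rule DERIV_nonneg_imp_nondecreasing[OF \<open>t \<le> 0\<close>])
      fix s
      have "0 \<le> p' s + 2 * K * p s" using bound[of s] by simp
      then have "0 \<le> (p' s + 2 * K * p s) * exp (2 * K * s)" by (rule mult_nonneg_nonneg) simp
      then show "\<exists>y. ((\<lambda>t. p t * exp (2 * K * t)) has_real_derivative y) (at s) \<and> y \<ge> 0"
        using de[of "2 * K" s] by blast
    qed
    then have "p t * exp (2 * K * t) \<le> 0" by (simp add: p0)
    then show ?thesis by (simp add: mult_le_0_iff)
  qed
  then have "p t = 0" using inner_ge_zero[of "x t - y t"] by (simp add: p_def)
  then show ?thesis by (simp add: p_def)
qed

lemma proj_u_eq:
  fixes A :: "'n::{finite,linorder} cmat"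
  shows "proj_u A = (\<chi> i j. if j < i then A $ i $ j else if i < j then - cnj (A $ j $ i)
           else \<i> * complex_of_real (Im (A $ i $ i)))"
  unfolding proj_u_def proj_u_decomp_iff by simp

lemma proj_u_eqI:
  assumes "X \<in> skew_hermitian" "R \<in> strictly_upper" "A = X + Diag v + R"
  shows "proj_u A = X"
proof -
  have "X = (\<chi> i j. if j < i then A $ i $ j else if i < j then - cnj (A $ j $ i)
           else \<i> * complex_of_real (Im (A $ i $ i)))"
    by (rule proj_u_decomp_iff[THEN iffD1]) (use assms in blast)
  then show ?thesis by (simp only: proj_u_eq)
qed

lemma linear_ad_left: "linear (\<lambda>X. ad X (Y :: 'n::finite cmat))"
  by (rule linearI)
    (simp_all add: ad_def matrix_add_ldistrib matrix_mult_add_left matrix_mult_scaleR_left matrix_mult_scaleR_right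
      scaleR_right_diff_distrib)

lemma linear_ad_right: "linear (ad (X :: 'n::finite cmat))"
  by (rule linearI)
    (simp_all add: ad_def matrix_add_ldistrib matrix_mult_add_left matrix_mult_scaleR_left matrix_mult_scaleR_right
      scaleR_right_diff_distrib)

lemma linear_proj_u_cscale: "linear (\<lambda>L :: 'n::{finite,linorder} cmat. proj_u (c \<odot> L))"
  by (rule linearI) (auto simp: proj_u_eq vec_eq_iff complex_eq_iff algebra_simps)

lemma norm_conj_by: "g \<in> unitary_group \<Longrightarrow> norm (conj_by g X) = norm X"
  by (simp add: norm_eq_sqrt_inner inner_conj_by)

lemma mult_matrix_inv_unitary: "g \<in> unitary_group \<Longrightarrow> g ** X ** matrix_inv g = conj_by g X"
  by (simp add: conj_by_def matrix_inv_unitary)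

lemma orbit_conj_by: "L \<in> orbit lam \<longleftrightarrow> (\<exists>g \<in> unitary_group. L = conj_by g (\<i> \<odot> Diag lam))"
  unfolding orbit_def mem_Collect_eq using mult_matrix_inv_unitary by metis

lemma orbit_nonneg_conj_by:
  "L \<in> orbit_nonneg lam \<longleftrightarrow> (\<exists>g \<in> unitary_nonneg. L = conj_by g (\<i> \<odot> Diag lam))"
  unfolding orbit_nonneg_def mem_Collect_eq using mult_matrix_inv_unitary unitary_nonneg_iff by metis

lemma norm_orbit: "L \<in> orbit lam \<Longrightarrow> norm L = norm (\<i> \<odot> Diag lam)"
  by (auto simp: orbit_conj_by norm_conj_by)

text \<open>The vector field is the diagonal of a bilinear map, so it is only locally Lipschitz.
  Unitary conjugation preserves the norm, however, so both solutions stay on one sphere and a single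
  constant serves all times.\<close>

theorem toda_flow_unique:
  fixes lam :: "real^'n::{finite,linorder}"
  assumes L: "toda_flow lam L" and L': "toda_flow lam L'" and init: "L 0 = L' 0"
  shows "L t = L' t"
proof -
  define B where "B = (\<lambda>X Y :: 'n cmat. ad X (proj_u ((- \<i>) \<odot> Y)))"
  have lin: "linear (\<lambda>X. B X Y)" "linear (B X)" for X Y
    unfolding B_def using linear_ad_left linear_compose[OF linear_proj_u_cscale linear_ad_right]
    by (auto simp: o_def)
  then have "bilinear B" by (simp add: bilinear_def)
  then interpret B: bounded_bilinear B by (simp add: bilinear_conv_bounded_bilinear)
  obtain K where K: "0 \<le> K" "\<And>X Y. norm (B X Y) \<le> norm X * norm Y * K"
    using B.nonneg_bounded by blast
  define m where "m = norm (\<i> \<odot> Diag lam :: 'n cmat)"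
  have m: "norm (L t) = m" "norm (L' t) = m" for t
    using L L' by (auto simp: toda_flow_def m_def norm_orbit)
  show ?thesis
  proof (rule Lipschitz_flow_unique[where F = "\<lambda>X. B X X" and K = "2 * m * K"])
    fix t
    have "B (L t) (L t) - B (L' t) (L' t) = B (L t - L' t) (L t) + B (L' t) (L t - L' t)"
      by (simp add: B.diff_left B.diff_right)
    also have "norm \<dots> \<le> norm (L t - L' t) * norm (L t) * K + norm (L' t) * norm (L t - L' t) * K"
      by (intro order_trans[OF norm_triangle_ineq] add_mono K)
    also have "\<dots> = 2 * m * K * norm (L t - L' t)" by (simp add: m)
    finally show "norm (B (L t) (L t) - B (L' t) (L' t)) \<le> 2 * m * K * norm (L t - L' t)" .
  qed (use L L' init in \<open>auto simp: toda_flow_def B_def\<close>)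
qed

lemma upper_inverse:
  fixes R V :: "'n::{finite,linorder} cmat"
  assumes RV: "R ** V = mat 1" and R: "\<And>i j. j < i \<Longrightarrow> R $ i $ j = 0" and diag: "\<And>i. R $ i $ i \<noteq> 0"
  shows "j < i \<Longrightarrow> V $ i $ j = 0" "V $ i $ i = inverse (R $ i $ i)"
proof -
  have upper: "V $ i $ j = 0" if "j < i" for i j
  proof (rule ccontr)
    assume "V $ i $ j \<noteq> 0"
    define S where "S = {i. j < i \<and> V $ i $ j \<noteq> 0}"
    \<comment> \<open>The lowest nonzero entry of column \<open>j\<close> below the diagonal. In row
      \<open>m\<close> of \<open>R ** V\<close> only the product with the diagonal entry of
      \<open>R\<close> survives, which contradicts \<open>R ** V = mat 1\<close>.\<close>
    define m where "m = Max S"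
    have "i \<in> S" using that \<open>V $ i $ j \<noteq> 0\<close> by (simp add: S_def)
    then have m: "m \<in> S" "\<And>k. k \<in> S \<Longrightarrow> k \<le> m" unfolding m_def by (auto intro: Max_in)
    then have jm: "j < m" "V $ m $ j \<noteq> 0" by (auto simp: S_def)
    have "(R ** V) $ m $ j = (\<Sum>k\<in>UNIV. if k = m then R $ m $ m * V $ m $ j else 0)"
      unfolding matrix_mult_nth
    proof (rule sum.cong[OF refl])
      fix k
      consider "k < m" | "k = m" | "m < k" by fastforce
      then show "R $ m $ k * V $ k $ j = (if k = m then R $ m $ m * V $ m $ j else 0)"
      proof cases
        case 3
        then have "V $ k $ j = 0" using m(2)[of k] less_trans[OF jm(1), of k] by (auto simp: S_def not_le[symmetric])
        then show ?thesis using 3 by simp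
      qed (auto simp: R)
    qed
    then show False using jm diag[of m] unfolding RV by (auto simp: mat_def split: if_splits)
  qed
  then show "j < i \<Longrightarrow> V $ i $ j = 0" by simp
  have "(R ** V) $ i $ i = (\<Sum>k\<in>UNIV. if k = i then R $ i $ i * V $ i $ i else 0)"
    unfolding matrix_mult_nth
  proof (rule sum.cong[OF refl])
    fix k
    consider "k < i" | "k = i" | "i < k" by fastforce
    then show "R $ i $ k * V $ k $ i = (if k = i then R $ i $ i * V $ i $ i else 0)"
      by cases (auto simp: R upper)
  qed
  then have "R $ i $ i * V $ i $ i = 1" unfolding RV by (simp add: mat_def)
  then show "V $ i $ i = inverse (R $ i $ i)" by (metis inverse_unique)
qed

section \<open>The Toda flow\<close>

lemma bounded_bilinear_cmat_mult: "bounded_bilinear ((**) :: 'n::finite cmat \<Rightarrow> 'n cmat \<Rightarrow> 'n cmat)"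
proof -
  have "bilinear ((**) :: 'n::finite cmat \<Rightarrow> 'n cmat \<Rightarrow> 'n cmat)"
    unfolding bilinear_def
    by (auto intro!: linearI simp: matrix_add_ldistrib matrix_mult_add_left matrix_mult_scaleR_left matrix_mult_scaleR_right)
  then show ?thesis by (simp add: bilinear_conv_bounded_bilinear)
qed

lemmas has_vector_derivative_cmat_mult = bounded_bilinear.has_vector_derivative[OF bounded_bilinear_cmat_mult]

lemma bounded_linear_cadjoint: "bounded_linear (cadjoint :: 'n::finite cmat \<Rightarrow> 'n cmat)"
  by (intro linear_conv_bounded_linear[THEN iffD1] linearI) (simp_all add: vec_eq_iff)

lemmas has_vector_derivative_cadjoint = bounded_linear.has_vector_derivative[OF bounded_linear_cadjoint]

lemma bounded_linear_entry: "bounded_linear (\<lambda>A :: 'n::finite cmat. A $ i $ j)"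
  by (rule bounded_linear_compose[OF bounded_linear_vec_nth bounded_linear_vec_nth])

lemma has_vector_derivative_cmat:
  fixes f :: "real \<Rightarrow> 'n::finite cmat"
  assumes "\<And>i j. ((\<lambda>t. f t $ i $ j) has_vector_derivative f' $ i $ j) (at t)"
  shows "(f has_vector_derivative f') (at t)"
proof -
  have "bounded_linear (elem_mat i j :: complex \<Rightarrow> 'n cmat)" for i j
    by (intro linear_conv_bounded_linear[THEN iffD1] linearI) (simp_all add: vec_eq_iff elem_mat_def)
  note bounded_linear.has_vector_derivative[OF this assms]
  then have "((\<lambda>t. \<Sum>i\<in>UNIV. \<Sum>j\<in>UNIV. elem_mat i j (f t $ i $ j)) has_vector_derivative
      (\<Sum>i\<in>UNIV. \<Sum>j\<in>UNIV. elem_mat i j (f' $ i $ j))) (at t)"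
    by (intro has_vector_derivative_sum)
  then show ?thesis by (simp add: sum_elem_mat)
qed

lemma delta_Diag_delta: "delta ** Diag v ** delta = Diag v"
  by (auto simp: vec_eq_iff delta_conj_nth minus_one_power_cancel)

lemma proj_u_delta_conj:
  fixes A :: "'n::{finite,linorder} cmat"
  shows "proj_u (delta ** A ** delta) = delta ** proj_u A ** delta"
  by (auto simp: proj_u_eq vec_eq_iff delta_conj_nth minus_one_power_cancel)

lemma proj_u_skew: "proj_u A \<in> skew_hermitian"
  by (auto simp: proj_u_eq skew_hermitian_def vec_eq_iff)

section \<open>The explicit flow of unitary matrices\<close>

context
  fixes lam :: "real^'n::{finite,linorder}" and h0 :: "'n cmat"
  assumes h0: "h0 \<in> unitary_nonneg"
begin

definition "diag_exp t = (Diag (\<chi> i. exp (t * lam $ i)) :: 'n cmat)"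

definition "qr_flow t = (mat_of (qr_unitary CARD('n) (ent (diag_exp t ** h0))) :: 'n cmat)"

text \<open>The inverse of the triangular factor in the usual QR factorisation: it multiplies
  \<open>diag_exp t ** h0\<close> from the right to give \<open>qr_flow t\<close>.\<close>

definition "qr_flow_factor t = (mat_of (qr_factor CARD('n) (ent (diag_exp t ** h0))) :: 'n cmat)"

lemma h0_unitary: "h0 \<in> unitary_group"
  using h0 by (simp add: unitary_nonneg_iff)

lemma ent_diag_exp: "ent (diag_exp t ** h0) a b = of_real (exp (t * lam $ ix a)) * ent h0 a b"
  by (simp add: ent_def diag_exp_def Diag_mult_nth)

lemma fdet_diag_exp:
  "fdet k (\<lambda>a b. ent (diag_exp t ** h0) (r a) b) =
    (\<Prod>a<k. of_real (exp (t * lam $ ix (r a)))) * fdet k (\<lambda>a b. ent h0 (r a) b)"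
  by (simp only: ent_diag_exp fdet_scale_rows)

lemma fdet_diag_exp_nonzero: "fdet CARD('n) (ent (diag_exp t ** h0)) \<noteq> 0"
  using fdet_diag_exp[of "CARD('n)" t "\<lambda>a. a"] unitary_fun_fdet_nonzero[of "CARD('n)" "ent h0"] h0_unitary
  by (simp add: unitary_fun_iff)

lemma qr_flow_nonneg: "qr_flow t \<in> unitary_nonneg"
proof -
  let ?M = "ent (diag_exp t ** h0)"
  have e: "ent (qr_flow t) a b = qr_unitary CARD('n) ?M a b" if "a < CARD('n)" "b < CARD('n)" for a b
    using that by (simp add: qr_flow_def ent_mat_of)
  have "unitary_fun CARD('n) (ent (qr_flow t))"
    using unitary_qr[OF fdet_diag_exp_nonzero, of t] by (simp add: unitary_fun_def e)
  moreover have "left_minors_nonneg CARD('n) (ent (qr_flow t))"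
    unfolding left_minors_nonneg_def
  proof (intro allI impI)
    fix k and r :: "nat \<Rightarrow> nat"
    assume k: "k \<le> CARD('n)" and r: "incr k r" "r ` {..<k} \<subseteq> {..<CARD('n)}"
    have "fdet k (\<lambda>a b. ent (qr_flow t) (r a) b) = fdet k (\<lambda>a b. qr_unitary CARD('n) ?M (r a) b)"
      using k r by (intro fdet_cong e) auto
    also have "\<dots> = (\<Prod>a<k. of_real (exp (t * lam $ ix (r a)))) * fdet k (\<lambda>a b. ent h0 (r a) b) *
        (\<Prod>j<k. qr_factor CARD('n) ?M j j)"
      by (simp only: qr_left_minor[OF fdet_diag_exp_nonzero k] fdet_diag_exp)
    also have "\<dots> \<in> \<real>\<^sub>\<ge>\<^sub>0"
    proof (intro nonneg_Reals_mult_I nonneg_Reals_prod)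
      show "fdet k (\<lambda>a b. ent h0 (r a) b) \<in> \<real>\<^sub>\<ge>\<^sub>0"
        using h0 k r by (intro left_minors_nonnegD[of "CARD('n)"]) (auto simp: unitary_nonneg_iff)
    qed (use k in \<open>auto intro!: cposD(1)[OF qr_factor_diag_cpos[OF fdet_diag_exp_nonzero]]\<close>)
    finally show "fdet k (\<lambda>a b. ent (qr_flow t) (r a) b) \<in> \<real>\<^sub>\<ge>\<^sub>0" .
  qed
  ultimately show ?thesis by (simp add: unitary_nonneg_iff unitary_fun_iff)
qed

lemma qr_flow_unitary: "qr_flow t \<in> unitary_group"
  using qr_flow_nonneg by (simp add: unitary_nonneg_iff)

lemma qr_flow_0: "qr_flow 0 = h0"
proof -
  have "diag_exp 0 = mat 1" by (simp add: diag_exp_def vec_eq_iff mat_def)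
  then have "qr_flow 0 $ i $ j = h0 $ i $ j" for i j
    using qr_unitary_id[of "CARD('n)" "ent h0" "index_pos j" "index_pos i"] h0_unitary
    by (simp add: qr_flow_def mat_of_def unitary_fun_iff)
  then show ?thesis by (simp add: vec_eq_iff)
qed

lemma qr_flow_eq: "qr_flow t = diag_exp t ** h0 ** qr_flow_factor t"
  by (simp add: vec_eq_iff qr_flow_def qr_flow_factor_def mat_of_def qr_unitary_def matrix_mult_nth[of "_ ** h0"]
      sum_ix ent_def)

lemma diag_exp_mult: "diag_exp s ** diag_exp t = diag_exp (s + t)"
  by (simp add: vec_eq_iff diag_exp_def Diag_mult_nth exp_add distrib_right)

lemma diag_exp_0: "diag_exp 0 = mat 1"
  by (simp add: diag_exp_def vec_eq_iff mat_def)

text \<open>Solving \<open>qr_flow_eq\<close> for the factor expresses it by differentiable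
  functions, so its derivative comes from that of \<open>qr_flow\<close>.\<close>

lemma qr_flow_factor_eq: "qr_flow_factor t = cadjoint h0 ** diag_exp (- t) ** qr_flow t"
proof -
  have "cadjoint h0 ** diag_exp (- t) ** qr_flow t =
      cadjoint h0 ** (diag_exp (- t) ** diag_exp t) ** h0 ** qr_flow_factor t"
    by (simp add: qr_flow_eq matrix_mul_assoc)
  also have "\<dots> = qr_flow_factor t"
    by (simp add: diag_exp_mult diag_exp_0 unitary_groupD[OF h0_unitary])
  finally show ?thesis by simp
qed

lemma qr_flow_factor_upper: "j < i \<Longrightarrow> qr_flow_factor t $ i $ j = 0"
  by (simp add: qr_flow_factor_def mat_of_def qr_factor_upper index_pos_less_iff)

lemma qr_flow_factor_diag: "cpos (qr_flow_factor t $ i $ i)"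
  by (simp add: qr_flow_factor_def mat_of_def qr_factor_diag_cpos[OF fdet_diag_exp_nonzero])

lemma has_vector_derivative_diag_exp:
  "(diag_exp has_vector_derivative Diag lam ** diag_exp t) (at t)"
proof (rule has_vector_derivative_cmat)
  fix i j
  have "((\<lambda>t. complex_of_real (exp (t * lam $ i))) has_vector_derivative of_real (lam $ i * exp (t * lam $ i))) (at t)"
    by (rule has_vector_derivative_of_real)
      (auto intro!: derivative_eq_intros simp: has_real_derivative_iff_has_vector_derivative[symmetric])
  then show "((\<lambda>t. diag_exp t $ i $ j) has_vector_derivative (Diag lam ** diag_exp t) $ i $ j) (at t)"
    by (cases "i = j") (simp_all add: diag_exp_def Diag_mult_nth)
qed

text \<open>Only existence is taken from the determinantal formula; the value of the derivative is
  found afterwards from the triangular and unitary structure.\<close>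

lemma qr_flow_differentiable: "\<exists>h'. (qr_flow has_vector_derivative h') (at t)"
proof -
  have M: "(\<lambda>t. ent (diag_exp t ** h0) a b) differentiable at t" for a b
  proof -
    have "((\<lambda>t. diag_exp t ** h0) has_vector_derivative diag_exp t ** 0 + (Diag lam ** diag_exp t) ** h0) (at t)"
      by (rule has_vector_derivative_cmat_mult[OF has_vector_derivative_diag_exp has_vector_derivative_const])
    from bounded_linear.has_vector_derivative[OF bounded_linear_entry this, of "ix a" "ix b"]
    show ?thesis unfolding ent_def by (rule differentiableI_vector)
  qed
  have "(\<lambda>t. qr_flow t $ i $ j) differentiable at t" for i j
    unfolding qr_flow_def mat_of_def vec_lambda_beta
    by (rule differentiable_qr_unitary[OF M fdet_diag_exp_nonzero]) simp_all
  then have "((\<lambda>t. qr_flow t $ i $ j) has_vector_derivative vector_derivative (\<lambda>t. qr_flow t $ i $ j) (at t)) (at t)" for i j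
    by (simp add: vector_derivative_works)
  then have "(qr_flow has_vector_derivative (\<chi> i j. vector_derivative (\<lambda>t. qr_flow t $ i $ j) (at t))) (at t)"
    by (intro has_vector_derivative_cmat) simp
  then show ?thesis by blast
qed

text \<open>
  Differentiating \<open>h = e\<^sup>t\<^sup>\<Lambda> h\<^sub>0 R\<close>, with \<open>R\<close> the triangular factor, splits \<open>h\<^sup>* \<Lambda> h\<close> into the
  skew-Hermitian matrix \<open>h\<^sup>* h'\<close> and an upper triangular matrix with real diagonal.
\<close>

theorem has_vector_derivative_qr_flow:
  defines "X \<equiv> \<lambda>t. proj_u (cadjoint (qr_flow t) ** Diag lam ** qr_flow t)"
  shows "(qr_flow has_vector_derivative qr_flow t ** X t) (at t)"
proof -
  let ?h = "qr_flow t" and ?M = "diag_exp t ** h0" and ?R = "qr_flow_factor t"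
  obtain h' where h': "(qr_flow has_vector_derivative h') (at t)"
    using qr_flow_differentiable by blast
  have "(uminus has_vector_derivative (- 1 :: real)) (at t)"
    by (rule has_vector_derivative_minus[OF has_vector_derivative_id])
  then have "((\<lambda>s. diag_exp (- s)) has_vector_derivative (- 1) *\<^sub>R (Diag lam ** diag_exp (- t))) (at t)"
    using vector_diff_chain_at[of uminus "- 1" t diag_exp "Diag lam ** diag_exp (- t)"]
      has_vector_derivative_diag_exp[of "- t"]
    by (simp add: o_def)
  from has_vector_derivative_cmat_mult[OF has_vector_derivative_cmat_mult[OF has_vector_derivative_const this] h', of "cadjoint h0"]
  obtain R' where "((\<lambda>s. cadjoint h0 ** diag_exp (- s) ** qr_flow s) has_vector_derivative R') (at t)"
    by blast
  then have R': "(qr_flow_factor has_vector_derivative R') (at t)"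
    by (simp flip: qr_flow_factor_eq)
  have R'_entry: "((\<lambda>s. qr_flow_factor s $ i $ j) has_vector_derivative R' $ i $ j) (at t)" for i j
    by (rule bounded_linear.has_vector_derivative[OF bounded_linear_entry R'])
  \<comment> \<open>Vanishing below the diagonal and real diagonal entries hold at all times, so
    both pass to the derivative.\<close>
  have R'_upper: "R' $ i $ j = 0" if "j < i" for i j
    using vector_derivative_unique_at[OF R'_entry[of i j], of 0] that by (simp add: qr_flow_factor_upper)
  have R'_diag: "Im (R' $ i $ i) = 0" for i
    using vector_derivative_unique_at[OF bounded_linear.has_vector_derivative[OF bounded_linear_Im R'_entry[of i i]], of 0]
      qr_flow_factor_diag by (simp add: cpos_iff)
  have hM: "((\<lambda>t. diag_exp t ** h0) has_vector_derivative Diag lam ** ?M) (at t)"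
    using has_vector_derivative_cmat_mult[OF has_vector_derivative_diag_exp has_vector_derivative_const, of h0 t]
    by (simp add: matrix_mul_assoc bounded_bilinear.zero_right[OF bounded_bilinear_cmat_mult])
  have "(qr_flow has_vector_derivative ?M ** R' + Diag lam ** ?M ** ?R) (at t)"
    using has_vector_derivative_cmat_mult[OF hM R'] by (simp flip: qr_flow_eq)
  then have h'_eq: "h' = ?M ** R' + Diag lam ** ?h"
    using vector_derivative_unique_at[OF h'] by (simp add: qr_flow_eq matrix_mul_assoc)
  \<comment> \<open>\<open>V\<close> is the inverse of \<open>?R\<close>, hence upper triangular
    with positive diagonal, and \<open>U = V ** R'\<close> is upper triangular with real
    diagonal.\<close>
  define V where "V = cadjoint ?h ** ?M"
  have RV: "?R ** V = mat 1"
  proof -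
    have "?R ** V = cadjoint h0 ** diag_exp (- t) ** (?h ** cadjoint ?h) ** diag_exp t ** h0"
      by (simp add: V_def qr_flow_factor_eq matrix_mul_assoc)
    also have "\<dots> = cadjoint h0 ** (diag_exp (- t) ** diag_exp t) ** h0"
      by (simp add: unitary_groupD[OF qr_flow_unitary] matrix_mul_assoc)
    also have "\<dots> = mat 1"
      by (simp add: diag_exp_mult diag_exp_0 unitary_groupD[OF h0_unitary])
    finally show ?thesis .
  qed
  have R_diag: "?R $ i $ i \<noteq> 0" for i using cposD qr_flow_factor_diag by blast
  note V = upper_inverse[OF RV qr_flow_factor_upper R_diag]
  define U where "U = V ** R'"
  have U_upper: "U $ i $ j = 0" if "j < i" for i j
    unfolding U_def matrix_mult_nth
  proof (rule sum.neutral, rule ballI)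
    fix k
    have "k < i \<or> j < k" using that by force
    then show "V $ i $ k * R' $ k $ j = 0" using V(1)[of k i] R'_upper[of j k] by auto
  qed
  have U_diag: "Im (U $ i $ i) = 0" for i
  proof -
    have "U $ i $ i = (\<Sum>k\<in>UNIV. if k = i then V $ i $ i * R' $ i $ i else 0)"
      unfolding U_def matrix_mult_nth
    proof (rule sum.cong[OF refl])
      fix k
      consider "k < i" | "k = i" | "i < k" by fastforce
      then show "V $ i $ k * R' $ k $ i = (if k = i then V $ i $ i * R' $ i $ i else 0)"
        by cases (auto simp: V R'_upper)
    qed
    then show ?thesis using qr_flow_factor_diag[of t i] R'_diag[of i] by (simp add: V(2) cpos_iff)
  qed
  define Y where "Y = cadjoint ?h ** h'"
  have "((\<lambda>s. cadjoint (qr_flow s) ** qr_flow s) has_vector_derivative cadjoint ?h ** h' + cadjoint h' ** ?h) (at t)"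
    by (rule has_vector_derivative_cmat_mult[OF has_vector_derivative_cadjoint[OF h'] h'])
  then have "((\<lambda>s. mat 1 :: 'n cmat) has_vector_derivative cadjoint ?h ** h' + cadjoint h' ** ?h) (at t)"
    by (simp add: unitary_groupD[OF qr_flow_unitary])
  then have "cadjoint ?h ** h' + cadjoint h' ** ?h = 0"
    by (rule vector_derivative_unique_at[OF _ has_vector_derivative_const])
  then have "cadjoint Y = - Y"
    by (simp add: Y_def cadjoint_mult add_eq_0_iff)
  then have skew: "Y \<in> skew_hermitian" by (simp add: skew_hermitian_def)
  \<comment> \<open>Multiplying \<open>h'_eq\<close> by the adjoint of \<open>?h\<close> shows that
    the matrix to be projected is \<open>Y - U\<close>. Splitting \<open>- U\<close> into its real
    diagonal and its strictly upper part leaves \<open>Y\<close> as the skew-Hermitian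
    summand.\<close>
  have "Y = U + cadjoint ?h ** Diag lam ** ?h"
    by (simp add: Y_def h'_eq matrix_add_ldistrib matrix_mul_assoc U_def V_def)
  then have C: "cadjoint ?h ** Diag lam ** ?h = Y + Diag (\<chi> i. - Re (U $ i $ i)) + (- U - Diag (\<chi> i. - Re (U $ i $ i)))"
    by simp
  have "- U - Diag (\<chi> i. - Re (U $ i $ i)) \<in> strictly_upper"
    unfolding strictly_upper_def
  proof (intro CollectI allI impI)
    fix i j :: 'n assume "j \<le> i"
    then show "(- U - Diag (\<chi> i. - Re (U $ i $ i))) $ i $ j = 0"
      using U_upper[of j i] U_diag[of i] by (cases "j = i") (auto simp: complex_eq_iff)
  qed
  from proj_u_eqI[OF skew this C] have X: "X t = Y" by (simp add: X_def)
  have "?h ** X t = (?h ** cadjoint ?h) ** h'"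
    by (simp only: X Y_def matrix_mul_assoc)
  then show ?thesis using h' by (simp add: unitary_groupD[OF qr_flow_unitary])
qed

end

section \<open>Identification of the Toda flow and of the gradient flow with the explicit
  one\<close>

theorem theorem1p8:
  fixes lam :: "real^'n::{finite,linorder}"
    and L :: "real \<Rightarrow> 'n::{finite,linorder} cmat"
    and N :: "'n::{finite,linorder} cmat"
  assumes "\<And>i j. i < j \<Longrightarrow> lam $ j < lam $ i"
    and "toda_flow lam L"
    and "L 0 \<in> orbit_nonneg lam"
    and "N = (-\<i>) \<odot> Diag lam"
  shows "(\<forall>t. L t \<in> orbit_nonneg lam) \<and>
    kaehler_gradient_flow lam (\<lambda>M. Re (kappa M N)) (\<lambda>t. twist lam (L t))"
proof -
  have lam: "lam $ i \<noteq> lam $ j" if "i \<noteq> j" for i j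
    using assms(1)[of i j] assms(1)[of j i] that by (cases i j rule: linorder_cases) auto
  let ?D = "\<i> \<odot> Diag lam :: 'n cmat"
  obtain g0 where g0: "g0 \<in> unitary_nonneg" "L 0 = conj_by g0 ?D"
    using assms(3) by (auto simp: orbit_nonneg_conj_by)
  \<comment> \<open>The unitary factor of the twisted initial point. The flow is constructed on the
    twisted side and carried back by the involution \<open>signed_adjoint\<close>.\<close>
  define h0 where "h0 = signed_adjoint g0"
  have h0: "h0 \<in> unitary_nonneg" using g0 by (simp add: h0_def signed_adjoint_unitary_nonneg)
  define h where "h = qr_flow lam h0"
  define C where "C = (\<lambda>t. cadjoint (h t) ** Diag lam ** h t)"
  define X where "X = (\<lambda>t. proj_u (C t))"
  have h: "h t \<in> unitary_nonneg" "h t \<in> unitary_group" "h 0 = h0"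
    and dh: "(h has_vector_derivative h t ** X t) (at t)" for t
    using qr_flow_nonneg[OF h0] qr_flow_unitary[OF h0] qr_flow_0[OF h0] has_vector_derivative_qr_flow[OF h0]
    by (simp_all add: h_def X_def C_def)
  have Xskew: "cadjoint (X t) = - X t" for t
    using proj_u_skew by (simp add: X_def skew_hermitian_def)
  have conj_deriv: "((\<lambda>t. conj_by (f t) ?D) has_vector_derivative f' ** ?D ** cadjoint (f t) + f t ** ?D ** cadjoint f') (at t)"
    if "(f has_vector_derivative f') (at t)" for f f' t
    using has_vector_derivative_cmat_mult[OF has_vector_derivative_cmat_mult[OF that has_vector_derivative_const] has_vector_derivative_cadjoint[OF that], of ?D]
    by (simp add: conj_by_def add.commute bounded_bilinear.zero_right[OF bounded_bilinear_cmat_mult])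
  define g where "g = (\<lambda>t. signed_adjoint (h t))"
  have g: "g t \<in> unitary_nonneg" for t using h by (simp add: g_def signed_adjoint_unitary_nonneg)
  then have gu: "g t \<in> unitary_group" for t by (simp add: unitary_nonneg_iff)
  have g_0: "g 0 = g0" by (simp add: g_def h h0_def)
  have "toda_flow lam (\<lambda>t. conj_by (g t) ?D)"
    unfolding toda_flow_def
  proof (intro allI conjI)
    fix t
    show "conj_by (g t) ?D \<in> orbit lam" using gu orbit_conj_by by blast
    \<comment> \<open>Under the signed adjoint the right multiplication in \<open>h' = h X\<close>
      becomes a left multiplication, \<open>g' = - P g\<close>, which produces the commutator with
      \<open>P\<close>. Conjugation by \<open>delta\<close> commutes with \<open>proj_u\<close>, so
      \<open>P\<close> is the generator required by the Toda equation.\<close>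
    define P where "P = delta ** X t ** delta"
    have P: "cadjoint P = - P"
      by (simp add: P_def cadjoint_mult Xskew matrix_mult_minus_left matrix_mult_minus_right matrix_mul_assoc)
    have "((\<lambda>t. delta ** cadjoint (h t) ** delta) has_vector_derivative delta ** cadjoint (h t ** X t) ** delta) (at t)"
      using has_vector_derivative_cmat_mult[OF has_vector_derivative_cmat_mult[OF has_vector_derivative_const
            has_vector_derivative_cadjoint[OF dh]] has_vector_derivative_const, of delta delta]
      by (simp add: bounded_bilinear.zero_right[OF bounded_bilinear_cmat_mult] bounded_bilinear.zero_left[OF bounded_bilinear_cmat_mult])
    also have "delta ** cadjoint (h t ** X t) ** delta = - (delta ** X t ** (delta ** delta) ** cadjoint (h t) ** delta)"
      by (simp add: cadjoint_mult Xskew matrix_mult_minus_left matrix_mult_minus_right matrix_mul_assoc)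
    also have "\<dots> = - (P ** g t)"
      by (simp only: P_def g_def signed_adjoint_def matrix_mul_assoc)
    finally have "(g has_vector_derivative - (P ** g t)) (at t)"
      by (simp add: g_def[abs_def] signed_adjoint_def)
    from conj_deriv[OF this]
    have "((\<lambda>t. conj_by (g t) ?D) has_vector_derivative ad (conj_by (g t) ?D) P) (at t)"
      by (simp add: ad_def conj_by_def cadjoint_minus cadjoint_mult P matrix_mult_minus_left matrix_mult_minus_right matrix_mul_assoc)
    moreover have "proj_u ((- \<i>) \<odot> conj_by (g t) ?D) = P"
    proof -
      have "(- \<i>) \<odot> conj_by (g t) ?D = conj_by (g t) ((- \<i>) \<odot> ?D)"
        by (simp add: conj_by_def cscale_mult_left cscale_mult_right)
      also have "(- \<i>) \<odot> ?D = Diag lam" by (simp add: vec_eq_iff)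
      also have "conj_by (g t) (Diag lam) = delta ** cadjoint (h t) ** (delta ** Diag lam ** delta) ** h t ** delta"
        by (simp add: conj_by_def g_def signed_adjoint_def cadjoint_mult matrix_mul_assoc)
      also have "\<dots> = delta ** C t ** delta"
        by (simp add: delta_Diag_delta C_def matrix_mul_assoc)
      finally show ?thesis by (simp add: proj_u_delta_conj P_def X_def)
    qed
    ultimately show "((\<lambda>t. conj_by (g t) ?D) has_vector_derivative
        ad (conj_by (g t) ?D) (proj_u ((- \<i>) \<odot> conj_by (g t) ?D))) (at t)" by simp
  qed
  then have L: "L t = conj_by (g t) ?D" for t
    using toda_flow_unique[OF assms(2)] g0 g_0 by simp
  have tw: "twist lam (L t) = conj_by (h t) ?D" for t
    unfolding L g_def by (rule twist_conj_by[OF lam h(1)])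
  have "kaehler_gradient_flow lam (\<lambda>M. Re (kappa M N)) (\<lambda>t. conj_by (h t) ?D)"
    unfolding kaehler_gradient_flow_def
  proof (intro allI conjI)
    fix t
    show "conj_by (h t) ?D \<in> orbit lam" using h orbit_conj_by by blast
    interpret regular_orbit_point lam "h t" "conj_by (h t) ?D"
      by unfold_locales (use lam h in auto)
    define V where "V = (\<chi> i j. \<i> * of_real \<bar>lam $ i - lam $ j\<bar> * C t $ i $ j)"
    have "has_kaehler_gradient lam (\<lambda>M. Re (kappa M N)) (conj_by (h t) V) (conj_by (h t) ?D)"
      unfolding assms(4) V_def C_def by (rule has_kaehler_gradient_kappa)
    moreover have "((\<lambda>t. conj_by (h t) ?D) has_vector_derivative conj_by (h t) V) (at t)"
    proof -
      have "cadjoint (C t) = C t" by (simp add: C_def cadjoint_mult matrix_mul_assoc)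
      then have herm: "cnj (C t $ j $ i) = C t $ i $ j" for i j by (simp add: vec_eq_iff)
      have "X t ** ?D - ?D ** X t = V"
        unfolding vec_eq_iff
      proof (intro allI)
        fix i j
        have "(X t ** ?D - ?D ** X t) $ i $ j = \<i> * of_real (lam $ j - lam $ i) * X t $ i $ j"
          by (simp add: cscale_mult_left cscale_mult_right Diag_mult_nth mult_Diag_nth algebra_simps)
        \<comment> \<open>Here the order of \<open>lam\<close> enters. For \<open>j < i\<close> the
          entry of \<open>X t\<close> is that of \<open>C t\<close> and
          \<open>lam $ j - lam $ i\<close> is positive. For \<open>i < j\<close> the difference is
          negative, but \<open>proj_u\<close> contributes a second sign. Either way the absolute
          difference results.\<close>
        also have "\<dots> = V $ i $ j"
        proof (cases i j rule: linorder_cases)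
          case less
          then show ?thesis using assms(1)[OF less] by (simp add: X_def proj_u_eq V_def herm not_less_iff_gr_or_eq algebra_simps)
        next
          case greater
          then show ?thesis using assms(1)[OF greater] by (simp add: X_def proj_u_eq V_def algebra_simps)
        qed (simp add: V_def)
        finally show "(X t ** ?D - ?D ** X t) $ i $ j = V $ i $ j" .
      qed
      then have "conj_by (h t) V = (h t ** X t) ** ?D ** cadjoint (h t) + h t ** ?D ** cadjoint (h t ** X t)"
        by (simp add: conj_by_def cadjoint_mult Xskew matrix_mult_diff_left matrix_mult_diff_right
            matrix_mult_minus_left matrix_mult_minus_right matrix_mul_assoc flip: \<open>X t ** ?D - ?D ** X t = V\<close>)
      then show ?thesis using conj_deriv[OF dh] by simp
    qed
    ultimately show "\<exists>V. has_kaehler_gradient lam (\<lambda>M. Re (kappa M N)) V (conj_by (h t) ?D) \<and>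
        ((\<lambda>t. conj_by (h t) ?D) has_vector_derivative V) (at t)" by blast
  qed
  moreover have "\<forall>t. L t \<in> orbit_nonneg lam" using L g orbit_nonneg_conj_by by blast
  ultimately show ?thesis by (simp add: tw)
qed

end
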